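(* Let $\Gamma\cong C_2\star C_3$ be a convex cocompact deformation of $\mathrm{PSL}_2\mathbb{Z}$ in $\mathrm{PSL}_2\mathbb{R}$. Then every non-trivial affine deformation of $\sigma_7(\Gamma)$ determines a proper affine action on $\mathbb{R}^7$; that is, for every cocycle $u\colon\Gamma\to\mathbb{R}^7$ for $\sigma_7(\Gamma)$ that is not a coboundary, the affine action $\gamma\cdot x=\sigma_7(\gamma)x+u(\gamma)$ of $\Gamma$ on $\mathbb{R}^7$ is properly discontinuous.
   Context: $\sigma_7\colon\mathrm{PSL}_2\mathbb{R}\to\mathrm{SO}(4,3)<\mathrm{GL}_7\mathbb{R}$ is the irreducible representation, i.e. the action of $\mathrm{SL}_2\mathbb{R}$ on $\mathrm{Sym}^6(\mathbb{R}^2)\cong\mathbb{R}^7$ (which factors through $\mathrm{PSL}_2\mathbb{R}$). A convex cocompact deformation of $\mathrm{PSL}_2\mathbb{Z}\cong C_2\star C_3$ is a discrete subgroup $\Gamma<\mathrm{PSL}_2\mathbb{R}$ generated by a rotation of order $2$ and a rotation of order $3$ of $\mathbb{H}^2$, abstractly the free product of the two cyclic groups they generate, such that the convex hull in $\mathbb{H}^2$ of its limit set has compact quotient by $\Gamma$ (equivalently, all infinite-order elements are loxodromic, i.e. have two distinct real eigenvalues). A cocycle for $\sigma_7(\Gamma)$ is a map $u\colon\Gamma\to\mathbb{R}^7$ with $u(\gamma_1\gamma_2)=\sigma_7(\gamma_1)u(\gamma_2)+u(\gamma_1)$; it is a coboundary if there is $v\in\mathbb{R}^7$ with $u(\gamma)=v-\sigma_7(\gamma)v$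 for all $\gamma\in\Gamma$. An affine deformation is non-trivial if its cocycle is not a coboundary. *)

theory Defs
  imports "HOL-Analysis.Analysis" "HOL-Algebra.Generated_Groups" "HOL-Algebra.Multiplicative_Group"
    "HOL-Computational_Algebra.Polynomial"
begin

definition quotient_topology :: "'a topology \<Rightarrow> ('a \<Rightarrow> 'b) \<Rightarrow> 'b topology" where
  "quotient_topology T q =
     topology (\<lambda>U. U \<subseteq> q ` topspace T \<and> openin T {x \<in> topspace T. q x \<in> U})"

lemma openin_quotient_topology:
  "openin (quotient_topology T q) U \<longleftrightarrow>
     U \<subseteq> q ` topspace T \<and> openin T {x \<in> topspace T. q x \<in> U}"
proof -
  have "istopology (\<lambda>U. U \<subseteq> q ` topspace T \<and> openin T {x \<in> topspace T. q x \<in> U})"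
    unfolding istopology_def
  proof (intro conjI allI impI)
    fix U V
    assume "U \<subseteq> q ` topspace T \<and> openin T {x \<in> topspace T. q x \<in> U}"
      and "V \<subseteq> q ` topspace T \<and> openin T {x \<in> topspace T. q x \<in> V}"
    moreover have "{x \<in> topspace T. q x \<in> U \<inter> V} =
        {x \<in> topspace T. q x \<in> U} \<inter> {x \<in> topspace T. q x \<in> V}" by auto
    ultimately show "U \<inter> V \<subseteq> q ` topspace T"
      and "openin T {x \<in> topspace T. q x \<in> U \<inter> V}" by auto
  next
    fix \<U> assume U: "\<forall>U\<in>\<U>. U \<subseteq> q ` topspace T \<and> openin T {x \<in> topspace T. q x \<in> U}"
    then show "\<Union>\<U> \<subseteq> q ` topspace T" by blast
    have "{x \<in> topspace T. q x \<in> \<Union>\<U>} = (\<Union>U\<in>\<U>. {x \<in> topspace T. q x \<in> U})" by auto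
    then show "openin T {x \<in> topspace T. q x \<in> \<Union>\<U>}" using U by auto
  qed
  then show ?thesis by (simp add: quotient_topology_def)
qed

definition SL2 :: "(real^2^2) monoid" where
  "SL2 = \<lparr>carrier = {A. det A = 1}, mult = (**), one = mat 1\<rparr>"

text \<open>Elements of \<open>PSL2\<close> are the cosets \<open>{A, - A}\<close>.\<close>

definition PSL2 :: "(real^2^2) set monoid" where
  "PSL2 = SL2 Mod {mat 1, - mat 1}"

definition PSL2_topology :: "(real^2^2) set topology" where
  "PSL2_topology =
     quotient_topology (top_of_set (carrier SL2)) (\<lambda>A. {mat 1, - mat 1} #>\<^bsub>SL2\<^esub> A)"

definition discrete_subgroup :: "(real^2^2) set set \<Rightarrow> bool" where
  "discrete_subgroup \<Gamma> \<longleftrightarrow>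
     subgroup \<Gamma> PSL2 \<and> subtopology PSL2_topology \<Gamma> = discrete_topology \<Gamma>"

text \<open>
  The hyperbolic plane in its projective (Klein) model: symmetric positive definite matrices up
  to scaling, normalised to have trace 1. They form a round open disc in an affine plane, with
  ideal boundary the matrices of rank one, and \<open>A\<close> acts by \<open>X \<mapsto> A X A\<^sup>T\<close>, rescaled. The point
  \<open>x + i y\<close> of the upper half-plane corresponds to the ray of the matrix with rows
  \<open>(x\<^sup>2 + y\<^sup>2, x)\<close> and \<open>(x, 1)\<close>, the ideal point \<open>t\<close> to that of the matrix with rows \<open>(t\<^sup>2, t)\<close> and
  \<open>(t, 1)\<close>, and the action to the action by Moebius transformations. Geodesics are Euclidean
  segments, so that hyperbolic convex hulls are Euclidean convex hulls.
\<close>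

definition H2 :: "(real^2^2) set" where
  "H2 = {X. transpose X = X \<and> trace X = 1 \<and> det X > 0}"

definition ideal_boundary :: "(real^2^2) set" where
  "ideal_boundary = {X. transpose X = X \<and> trace X = 1 \<and> det X = 0}"

definition SL2_act :: "real^2^2 \<Rightarrow> real^2^2 \<Rightarrow> real^2^2" where
  "SL2_act A X = (1 / trace (A ** X ** transpose A)) *\<^sub>R (A ** X ** transpose A)"

definition PSL2_act :: "(real^2^2) set \<Rightarrow> real^2^2 \<Rightarrow> real^2^2" where
  "PSL2_act \<gamma> X = the_elem ((\<lambda>A. SL2_act A X) ` \<gamma>)"

definition orbit_of :: "(real^2^2) set set \<Rightarrow> real^2^2 \<Rightarrow> (real^2^2) set" where
  "orbit_of \<Gamma> X = (\<lambda>\<gamma>. PSL2_act \<gamma> X) ` \<Gamma>"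

definition rotation_of_order :: "nat \<Rightarrow> (real^2^2) set \<Rightarrow> bool" where
  "rotation_of_order n \<gamma> \<longleftrightarrow>
     \<gamma> \<in> carrier PSL2 \<and> group.ord PSL2 \<gamma> = n \<and> (\<exists>X\<in>H2. PSL2_act \<gamma> X = X)"

definition limit_set :: "(real^2^2) set set \<Rightarrow> (real^2^2) set" where
  "limit_set \<Gamma> = {\<xi> \<in> ideal_boundary. \<exists>X\<in>H2. \<xi> islimpt orbit_of \<Gamma> X}"

definition limit_hull :: "(real^2^2) set set \<Rightarrow> (real^2^2) set" where
  "limit_hull \<Gamma> = convex hull (limit_set \<Gamma>) \<inter> H2"

definition convex_cocompact :: "(real^2^2) set set \<Rightarrow> bool" where
  "convex_cocompact \<Gamma> \<longleftrightarrow>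
     discrete_subgroup \<Gamma> \<and>
     compact_space (quotient_topology (top_of_set (limit_hull \<Gamma>)) (orbit_of \<Gamma>))"

text \<open>
  \<open>P\<close> is the internal free product of its subgroups \<open>H\<close> and \<open>K\<close>: they generate it, and no
  non-empty word in non-trivial letters taken alternately from \<open>H\<close> and \<open>K\<close> is trivial. A
  non-trivial element \<open>x\<close> of \<open>H \<inter> K\<close> is excluded by the word \<open>x, x\<^sup>-\<^sup>1\<close>.
\<close>

definition is_free_product ::
  "('a, 'b) monoid_scheme \<Rightarrow> 'a set \<Rightarrow> 'a set \<Rightarrow> 'a set \<Rightarrow> bool" where
  "is_free_product G H K P \<longleftrightarrow>
     subgroup H G \<and> subgroup K G \<and> P = generate G (H \<union> K) \<and>
     (\<forall>w. w \<noteq> [] \<and> set w \<subseteq> (H \<union> K) - {\<one>\<^bsub>G\<^esub>} \<and>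
          successively (\<lambda>x y. x \<in> H \<and> y \<in> K \<or> x \<in> K \<and> y \<in> H) w \<longrightarrow>
          foldr (mult G) w \<one>\<^bsub>G\<^esub> \<noteq> \<one>\<^bsub>G\<^esub>)"

definition convex_cocompact_deformation_PSL2Z :: "(real^2^2) set set \<Rightarrow> bool" where
  "convex_cocompact_deformation_PSL2Z \<Gamma> \<longleftrightarrow>
     convex_cocompact \<Gamma> \<and>
     (\<exists>s t. rotation_of_order 2 s \<and> rotation_of_order 3 t \<and>
            \<Gamma> = generate PSL2 {s, t} \<and>
            is_free_product PSL2 (generate PSL2 {s}) (generate PSL2 {t}) \<Gamma>)"

text \<open>
  \<open>Sym\<^sup>6(\<real>\<^sup>2)\<close> has the basis \<open>e\<^sub>1\<^bsup>6-i\<^esup> e\<^sub>2\<^bsup>i\<^esup>\<close> for \<open>i = 0, \<dots>, 6\<close>; it is identified with the real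
  polynomials of degree at most 6 by \<open>e\<^sub>1 = 1\<close>, \<open>e\<^sub>2 = X\<close>. The matrix \<open>A\<close> sends \<open>e\<^sub>1\<close>, \<open>e\<^sub>2\<close> to its
  columns, and products to products. Coordinates are indexed by residues modulo 7.
\<close>

definition Sym6_act :: "real^2^2 \<Rightarrow> real^7 \<Rightarrow> real^7" where
  "Sym6_act A v =
     (let p = (\<Sum>i\<le>6. Polynomial.smult (v $ of_nat i) ([:A$1$1, A$2$1:] ^ (6 - i) * [:A$1$2, A$2$2:] ^ i))
      in \<Sum>j\<le>6. axis (of_nat j) (Polynomial.coeff p j))"

definition sigma7 :: "(real^2^2) set \<Rightarrow> real^7 \<Rightarrow> real^7" where
  "sigma7 \<gamma> v = the_elem ((\<lambda>A. Sym6_act A v) ` \<gamma>)"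

definition cocycle :: "(real^2^2) set set \<Rightarrow> ((real^2^2) set \<Rightarrow> real^7) \<Rightarrow> bool" where
  "cocycle \<Gamma> u \<longleftrightarrow>
     (\<forall>\<gamma>\<^sub>1\<in>\<Gamma>. \<forall>\<gamma>\<^sub>2\<in>\<Gamma>. u (\<gamma>\<^sub>1 \<otimes>\<^bsub>PSL2\<^esub> \<gamma>\<^sub>2) = sigma7 \<gamma>\<^sub>1 (u \<gamma>\<^sub>2) + u \<gamma>\<^sub>1)"

definition coboundary :: "(real^2^2) set set \<Rightarrow> ((real^2^2) set \<Rightarrow> real^7) \<Rightarrow> bool" where
  "coboundary \<Gamma> u \<longleftrightarrow> (\<exists>v. \<forall>\<gamma>\<in>\<Gamma>. u \<gamma> = v - sigma7 \<gamma> v)"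

definition affine_act ::
  "((real^2^2) set \<Rightarrow> real^7) \<Rightarrow> (real^2^2) set \<Rightarrow> real^7 \<Rightarrow> real^7" where
  "affine_act u \<gamma> x = sigma7 \<gamma> x + u \<gamma>"

definition properly_discontinuous ::
  "'g set \<Rightarrow> ('g \<Rightarrow> 'a \<Rightarrow> 'a) \<Rightarrow> 'a::topological_space set \<Rightarrow> bool" where
  "properly_discontinuous \<Gamma> act S \<longleftrightarrow>
     (\<forall>C. C \<subseteq> S \<and> compact C \<longrightarrow> finite {\<gamma> \<in> \<Gamma>. act \<gamma> ` C \<inter> C \<noteq> {}})"

end

theory Submission
  imports Defs
begin

text \<open>
  After a conjugation the two rotations are the rotation \<open>S\<close> about \<open>i\<close> and a rotation \<open>T\<close> about \<open>i \<tau>\<close>,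
  with \<open>\<tau> \<ge> 1\<close>. If \<open>\<tau> < sqrt 3\<close>, then \<open>S T\<close> is elliptic, which contradicts discreteness and freeness;
  if \<open>\<tau> = sqrt 3\<close>, the group preserves a lattice in the plane and has parabolic elements, and the hull
  of its limit set is not cocompact. So \<open>\<tau> > sqrt 3\<close>, and \<open>S\<close>, \<open>T\<close> play ping-pong on two disjoint
  closed arcs of the projective line.

  The first cohomology is one-dimensional, because the invariants of \<open>S\<close> and of \<open>T\<close> have dimension 3
  each and intersect trivially. It is spanned by the cocycle that vanishes on \<open>S\<close> and is \<open>w - T w\<close>
  on \<open>T\<close>, for the sextic \<open>w = x + x\<^sup>3 + x\<^sup>5\<close>. The pairing of \<open>w\<close> with the neutral vector of the geodesic
  from a point of one arc to a point of the other is bounded away from zero, with a fixed sign.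
  Hence the translation part of a reduced word, paired with the neutral vector of a geodesic whose
  endpoints the word leaves in the two arcs, grows linearly in the length of the word, whereas the
  pairings with a bounded vector and its image stay bounded.
\<close>

section \<open>Sextic forms and neutral vectors\<close>

text \<open>The count 7 - 3 - 3 = 1 lets a single sextic suffice: up to coboundaries every cocycle
  is a multiple of one cocycle, and non-triviality says only that the factor is not zero. The merit
  of the chosen sextic is positivity: its pairing with a geodesic between the arcs has the form
  \<open>(1 + r) * (k + 1 + r\<^sup>2) / (1 - r) ^ 3\<close> with \<open>k \<ge> 0\<close> and |r| <
  1.

  The geodesic attached to a word is not its axis. One endpoint is a point of the first arc; the
  other is the preimage under the word of a point of the second arc. Ping-pong then places both
  endpoints of the geodesic and of its image in the arcs, so one constant bounds all pairings with
  bounded vectors, and no eigenvectors of the word are involved.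

  The threshold \<open>\<tau> = sqrt 3\<close> is a conjugate of the modular group, which is
  discrete and a free product; only cocompactness can exclude it. There the orbit of a cusp vector
  stays away from zero, because it lies in the image of a lattice, and this prevents the group from
  moving points deep in the cusp back to a compact region.\<close>

lemma UNIV_7: "(UNIV :: 7 set) = of_nat ` {..6}"
proof -
  have "{0,1,2,3,4,5,6} = (UNIV :: 7 set)" by (rule card_subset_eq) simp_all
  moreover have "{..6::nat} = {0,1,2,3,4,5,6}" by auto
  ultimately show ?thesis by simp
qed

lemma inj_on_of_nat_7: "inj_on (of_nat :: nat \<Rightarrow> 7) {..6}"
  by (rule eq_card_imp_inj_on) (simp_all flip: UNIV_7)

lemma sum_atMost_6: "(\<Sum>i\<le>6. f i) = f 0 + f 1 + f 2 + f 3 + f 4 + f 5 + f (6::nat)"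
  for f :: "nat \<Rightarrow> 'a::comm_monoid_add"
proof -
  have "{..6::nat} = {0,1,2,3,4,5,6}" by auto
  then show ?thesis by (simp add: ac_simps)
qed

lemma vec_7_eq_iff: "v = w \<longleftrightarrow> (\<forall>i\<le>6. v $ of_nat i = w $ of_nat i)" for v w :: "'a^7"
proof -
  have "v $ k = w $ k" if "\<forall>i\<le>6. v $ of_nat i = w $ of_nat i" for k
    using that UNIV_7 by (metis UNIV_I atMost_iff imageE)
  then show ?thesis by (auto simp: vec_eq_iff)
qed

lemma sum_axis_7_nth:
  fixes f :: "nat \<Rightarrow> real"
  assumes "k \<le> 6"
  shows "(\<Sum>j\<le>6. axis (of_nat j :: 7) (f j)) $ of_nat k = f k"
proof -
  have "(\<Sum>j\<le>6. axis (of_nat j :: 7) (f j)) $ of_nat k = (\<Sum>j\<le>6. if j = k then f j else 0)"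
    using assms inj_on_of_nat_7 unfolding sum_component
    by (intro sum.cong) (auto simp: axis_def inj_on_def)
  also have "\<dots> = f k" using assms by simp
  finally show ?thesis .
qed

section \<open>Vectors as binary sextic forms\<close>

definition sextic :: "real^7 \<Rightarrow> real \<Rightarrow> real \<Rightarrow> real" where
  "sextic v a b = (\<Sum>i\<le>6. v $ of_nat i * (a ^ (6 - i) * b ^ i))"

text \<open>The form restricted to the line \<open>x + z * y\<close>, as a polynomial in
  \<open>z\<close>, so that single coefficients can be extracted. For \<open>x\<close>,
  \<open>y\<close> the rows of \<open>A\<close> it is the polynomial in the definition of
  \<open>Sym6_act\<close>.\<close>

definition pencil :: "real^7 \<Rightarrow> real^2 \<Rightarrow> real^2 \<Rightarrow> real poly" where
  "pencil v x y = (\<Sum>i\<le>6. Polynomial.smult (v $ of_nat i) ([:x$1, y$1:] ^ (6 - i) * [:x$2, y$2:] ^ i))"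

lemma sextic_expand:
  "sextic v a b = v$0 * a^6 + v$1 * a^5 * b + v$2 * a^4 * b^2 + v$3 * a^3 * b^3
     + v$4 * a^2 * b^4 + v$5 * a * b^5 + v$6 * b^6"
  unfolding sextic_def sum_atMost_6 by simp

lemma poly_pencil: "poly (pencil v x y) z = sextic v (x$1 + z * y$1) (x$2 + z * y$2)"
  by (simp add: pencil_def sextic_def poly_sum)

lemma degree_pencil: "degree (pencil v x y) \<le> 6"
  unfolding pencil_def
proof (rule degree_sum_le)
  fix i :: nat assume "i \<in> {..6}"
  have "degree ([:x$1, y$1:] ^ (6 - i)) \<le> 6 - i" 
    using degree_power_le[of "[:x$1, y$1:]" "6 - i"] by (auto split: if_splits)
  moreover have "degree ([:x$2, y$2:] ^ i) \<le> i"
    using degree_power_le[of "[:x$2, y$2:]" i] by (auto split: if_splits)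
  ultimately have "degree ([:x$1, y$1:] ^ (6 - i) * [:x$2, y$2:] ^ i) \<le> 6"
    using degree_mult_le[of "[:x$1, y$1:] ^ (6 - i)" "[:x$2, y$2:] ^ i"] \<open>i \<in> {..6}\<close> by auto
  then show "degree (Polynomial.smult (v $ of_nat i) ([:x$1, y$1:] ^ (6 - i) * [:x$2, y$2:] ^ i)) \<le> 6"
    using degree_smult_le order_trans by blast
qed simp

lemma Sym6_act_nth: "k \<le> 6 \<Longrightarrow> Sym6_act A v $ of_nat k = Polynomial.coeff (pencil v (A$1) (A$2)) k"
  unfolding Sym6_act_def Let_def by (subst sum_axis_7_nth) (simp_all add: pencil_def)

text \<open>At \<open>a = 1\<close> the form is a polynomial in \<open>b\<close> whose coefficients
  are the coordinates of \<open>v\<close>. Identities between vectors are reduced in this way to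
  identities between forms.\<close>

lemma sextic_inject: "(\<And>a b. sextic v a b = sextic w a b) \<Longrightarrow> v = w"
proof -
  assume eq: "\<And>a b. sextic v a b = sextic w a b"
  have *: "(\<Sum>i\<le>6. Polynomial.monom (v $ of_nat i) i) = (\<Sum>i\<le>6. Polynomial.monom (w $ of_nat i) i)"
    by (rule poly_ext) (use eq[of 1] in \<open>simp add: poly_sum poly_monom sextic_def\<close>)
  have "v $ of_nat k = w $ of_nat k" if "k \<le> 6" for k
    using arg_cong[OF *, of "\<lambda>p. Polynomial.coeff p k"] that by (simp add: coeff_sum)
  then show ?thesis by (simp add: vec_7_eq_iff)
qed

text \<open>The action becomes substitution of the row vector \<open>(a, b) A\<close>, which is why
  row vectors and \<open>v*\<close> are used from here on. For \<open>a \<noteq> 0\<close> evaluate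
  the pencil at \<open>b / a\<close> and clear denominators with \<open>a ^ 6\<close>; the case
  \<open>a = 0\<close> follows by continuity.\<close>

lemma sextic_Sym6_act:
  "sextic (Sym6_act A v) a b = sextic v (a * A$1$1 + b * A$2$1) (a * A$1$2 + b * A$2$2)"
proof -
  let ?p = "pencil v (A$1) (A$2)"
  let ?f = "\<lambda>a. sextic (Sym6_act A v) a b"
  let ?g = "\<lambda>a. sextic v (a * A$1$1 + b * A$2$1) (a * A$1$2 + b * A$2$2)"
  have nz: "?f a = ?g a" if "a \<noteq> 0" for a
  proof -
    have scale: "a ^ 6 * sextic v c d = sextic v (a * c) (a * d)" for c d
      unfolding sextic_expand by (simp add: power_mult_distrib algebra_simps eval_nat_numeral)
    have "poly ?p (b / a) = (\<Sum>j\<le>6. Polynomial.coeff ?p j * (b / a) ^ j)"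
      unfolding poly_altdef using degree_pencil[of v "A$1" "A$2"]
      by (intro sum.mono_neutral_left) (auto simp: coeff_eq_0)
    then have "a ^ 6 * poly ?p (b / a) = (\<Sum>j\<le>6. Polynomial.coeff ?p j * (a ^ 6 * (b / a) ^ j))"
      by (simp add: sum_distrib_left algebra_simps)
    also have "\<dots> = ?f a"
      unfolding sextic_def using that
      by (intro sum.cong) (auto simp: Sym6_act_nth power_divide power_diff)
    finally show ?thesis using that
      by (simp add: poly_pencil scale algebra_simps)
  qed
  have "(?f \<longlongrightarrow> ?f 0) (at 0)" "(?g \<longlongrightarrow> ?g 0) (at 0)"
    unfolding sextic_expand by (auto intro!: tendsto_eq_intros)
  moreover have "(?g \<longlongrightarrow> ?f 0) (at 0)"
    using calculation(1) by (rule Lim_transform_eventually) (use nz in \<open>auto simp: eventually_at_filter\<close>)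
  ultimately have "?f 0 = ?g 0" using LIM_unique by blast
  then show ?thesis using nz by (cases "a = 0") auto
qed

lemma sextic_add: "sextic (v + w) a b = sextic v a b + sextic w a b"
  by (simp add: sextic_def algebra_simps sum.distrib)

lemma sextic_scale: "sextic (c *\<^sub>R v) a b = c * sextic v a b"
  by (simp add: sextic_def algebra_simps sum_distrib_left)

lemma linear_Sym6_act: "linear (Sym6_act A)"
  by (rule linearI; rule sextic_inject; simp add: sextic_Sym6_act sextic_add sextic_scale)

lemma Sym6_act_mult: "Sym6_act (A ** B) v = Sym6_act A (Sym6_act B v)"
  by (rule sextic_inject) (simp add: sextic_Sym6_act matrix_matrix_mult_def sum_2 algebra_simps)

lemma Sym6_act_one [simp]: "Sym6_act (mat 1) v = v"
  by (rule sextic_inject) (simp add: sextic_Sym6_act mat_def)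

lemma Sym6_act_uminus [simp]: "Sym6_act (- A) v = Sym6_act A v"
proof (rule sextic_inject)
  have even: "sextic v (- a) (- b) = sextic v a b" for a b
    unfolding sextic_expand by simp
  fix a b
  show "sextic (Sym6_act (- A) v) a b = sextic (Sym6_act A v) a b"
    using even[of "a * A$1$1 + b * A$2$1" "a * A$1$2 + b * A$2$2"]
    by (simp add: sextic_Sym6_act)
qed

section \<open>The pairing with the neutral vector of a geodesic\<close>

definition wedge :: "real^2 \<Rightarrow> real^2 \<Rightarrow> real" where
  "wedge x y = x$1 * y$2 - x$2 * y$1"

text \<open>Up to the factor 20, the coefficient of \<open>z ^ 3\<close> is the polarised form with
  three arguments \<open>x\<close> and three arguments \<open>y\<close>; it is invariant under
  matrices of determinant one that have \<open>x\<close> and \<open>y\<close> as row eigenvectors.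
  Division by \<open>wedge x y ^ 3\<close> makes the value depend only on the two lines, and makes
  it odd under their exchange.\<close>

definition neutral :: "real^2 \<Rightarrow> real^2 \<Rightarrow> real^7 \<Rightarrow> real" where
  "neutral x y v = Polynomial.coeff (pencil v x y) 3 / wedge x y ^ 3"

lemma pencil_Sym6_act: "pencil (Sym6_act A v) x y = pencil v (x v* A) (y v* A)"
  by (rule poly_ext)
    (simp add: poly_pencil sextic_Sym6_act vector_matrix_mult_def sum_2 algebra_simps)

lemma wedge_vector_matrix_mult: "wedge (x v* A) (y v* A) = det A * wedge x y"
  by (simp add: wedge_def vector_matrix_mult_def sum_2 det_2 algebra_simps)

lemma neutral_Sym6_act:
  "det A = 1 \<Longrightarrow> neutral x y (Sym6_act A v) = neutral (x v* A) (y v* A) v"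
  by (simp add: neutral_def pencil_Sym6_act wedge_vector_matrix_mult)

lemma linear_neutral: "linear (neutral x y)"
proof
  show "neutral x y (v + w) = neutral x y v + neutral x y w" for v w
    by (simp add: neutral_def pencil_def coeff_sum sum.distrib add_divide_distrib algebra_simps
        smult_add_left)
  show "neutral x y (c *\<^sub>R v) = c *\<^sub>R neutral x y v" for c v
    by (simp add: neutral_def pencil_def coeff_sum sum_distrib_left algebra_simps)
qed

lemma neutral_diff: "neutral x y (v - w) = neutral x y v - neutral x y w"
  by (simp add: linear_neutral linear_diff)

lemma neutral_plus: "neutral x y (v + w) = neutral x y v + neutral x y w"
  by (simp add: linear_neutral linear_add)

lemma neutral_scale: "neutral x y (c *\<^sub>R v) = c * neutral x y v"
  by (simp add: linear_neutral linear_cmul)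

section \<open>Cones over the two arcs, and bounds for the pairing on them\<close>

definition hcone :: "real \<Rightarrow> (real^2) set" where
  "hcone m = {x. x$1 \<noteq> 0 \<and> \<bar>x$2\<bar> \<le> m * \<bar>x$1\<bar>}"

definition vcone :: "real \<Rightarrow> (real^2) set" where
  "vcone m = {x. x$2 \<noteq> 0 \<and> \<bar>x$1\<bar> \<le> m * \<bar>x$2\<bar>}"

text \<open>Method of majorants: coefficientwise domination survives products, so every term of a
  pencil is dominated by the sixth power of one linear polynomial.\<close>

lemma abs_coeff_mult_le:
  fixes p q P Q :: "real poly"
  assumes "\<And>k. \<bar>Polynomial.coeff p k\<bar> \<le> Polynomial.coeff P k"
    and "\<And>k. \<bar>Polynomial.coeff q k\<bar> \<le> Polynomial.coeff Q k"
  shows "\<bar>Polynomial.coeff (p * q) k\<bar> \<le> Polynomial.coeff (P * Q) k"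
  unfolding coeff_mult
  by (rule order_trans[OF sum_abs], rule sum_mono)
    (simp add: abs_mult mult_mono assms order_trans[OF abs_ge_zero assms(1)])

lemma abs_coeff_power_le:
  fixes p P :: "real poly"
  assumes "\<And>k. \<bar>Polynomial.coeff p k\<bar> \<le> Polynomial.coeff P k"
  shows "\<bar>Polynomial.coeff (p ^ n) k\<bar> \<le> Polynomial.coeff (P ^ n) k"
proof (induction n arbitrary: k)
  case (Suc n)
  then show ?case using abs_coeff_mult_le[OF assms, of "p ^ n"] by simp
qed (simp add: coeff_pCons split: nat.split)

lemma abs_coeff_pencil_le:
  assumes "\<bar>x$1\<bar> \<le> P" "\<bar>x$2\<bar> \<le> P" "\<bar>y$1\<bar> \<le> Q" "\<bar>y$2\<bar> \<le> Q"
  shows "\<bar>Polynomial.coeff (pencil v x y) 3\<bar> \<le> 140 * norm v * (P ^ 3 * Q ^ 3)"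
proof -
  have lin: "\<bar>Polynomial.coeff [:a, b:] k\<bar> \<le> Polynomial.coeff [:P, Q:] k"
    if "\<bar>a\<bar> \<le> P" "\<bar>b\<bar> \<le> Q" for a b k
    using that by (auto simp: coeff_pCons split: nat.split)
  \<comment> \<open>20 is the binomial coefficient 6 over 3; the seven coordinates of
    \<open>v\<close> turn it into the constant 140.\<close>
  have c20: "Polynomial.coeff ([:P, Q:] ^ 6) 3 = 20 * (P ^ 3 * Q ^ 3)"
    by (simp add: eval_nat_numeral coeff_pCons algebra_simps)
  have PQ: "0 \<le> P" "0 \<le> Q" using assms by auto
  have "\<bar>v $ of_nat i * Polynomial.coeff ([:x$1, y$1:] ^ (6 - i) * [:x$2, y$2:] ^ i) 3\<bar>
      \<le> norm v * (20 * (P ^ 3 * Q ^ 3))" if "i \<le> 6" for i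
  proof -
    have "\<bar>Polynomial.coeff ([:x$1, y$1:] ^ (6 - i) * [:x$2, y$2:] ^ i) 3\<bar>
        \<le> Polynomial.coeff ([:P, Q:] ^ (6 - i) * [:P, Q:] ^ i) 3"
      using assms by (intro abs_coeff_mult_le abs_coeff_power_le lin)
    also have "\<dots> = 20 * (P ^ 3 * Q ^ 3)"
      using that by (simp flip: power_add add: c20)
    finally show ?thesis
      unfolding abs_mult using component_le_norm_cart[of v "of_nat i"] PQ
      by (intro mult_mono) auto
  qed
  then have "(\<Sum>i\<le>6. \<bar>v $ of_nat i * Polynomial.coeff ([:x$1, y$1:] ^ (6 - i) * [:x$2, y$2:] ^ i) 3\<bar>)
      \<le> (\<Sum>i\<le>6::nat. norm v * (20 * (P ^ 3 * Q ^ 3)))"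
    by (intro sum_mono) auto
  moreover have "\<bar>Polynomial.coeff (pencil v x y) 3\<bar>
      \<le> (\<Sum>i\<le>6. \<bar>v $ of_nat i * Polynomial.coeff ([:x$1, y$1:] ^ (6 - i) * [:x$2, y$2:] ^ i) 3\<bar>)"
    unfolding pencil_def coeff_sum coeff_smult by (rule sum_abs)
  ultimately show ?thesis by simp
qed

lemma abs_cross_le:
  fixes x y :: "real^2"
  assumes "x \<in> hcone m" "y \<in> vcone m" "0 \<le> m"
  shows "\<bar>x$2 * y$1\<bar> \<le> m\<^sup>2 * \<bar>x$1 * y$2\<bar>"
proof -
  have "\<bar>x$2\<bar> * \<bar>y$1\<bar> \<le> (m * \<bar>x$1\<bar>) * (m * \<bar>y$2\<bar>)"
    using assms by (intro mult_mono) (auto simp: hcone_def vcone_def)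
  then show ?thesis by (simp add: abs_mult power2_eq_square algebra_simps)
qed

text \<open>Numerator and denominator are both of the size of |\<open>x$1 * y$2\<close>| cubed: on
  the cones these two coordinates dominate, and \<open>abs_cross_le\<close> keeps the wedge at least
  \<open>1 - m\<^sup>2\<close> times their product. The scale cancels, so the bound is uniform over
  all geodesics between the cones.\<close>

lemma abs_neutral_le:
  assumes "x \<in> hcone m" "y \<in> vcone m" "0 \<le> m" "m < 1"
  shows "\<bar>neutral x y v\<bar> \<le> 140 / (1 - m\<^sup>2) ^ 3 * norm v"
proof -
  define d where "d = \<bar>x$1 * y$2\<bar>"
  have d: "d > 0" using assms by (simp add: d_def hcone_def vcone_def)
  have m2: "m\<^sup>2 < 1" using assms by (simp add: power_less_one_iff abs_square_less_1)
  have "(1 - m\<^sup>2) * d \<le> \<bar>wedge x y\<bar>"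
    using abs_cross_le[OF assms(1-3)] by (simp add: wedge_def d_def algebra_simps)
  then have w: "((1 - m\<^sup>2) * d) ^ 3 \<le> \<bar>wedge x y\<bar> ^ 3"
    using m2 d by (intro power_mono) auto
  have pos: "0 < ((1 - m\<^sup>2) * d) ^ 3" using m2 d by simp
  have "m * \<bar>a\<bar> \<le> \<bar>a\<bar>" for a using mult_right_mono[of m 1 "\<bar>a\<bar>"] assms by simp
  then have "\<bar>x$2\<bar> \<le> \<bar>x$1\<bar>" "\<bar>y$1\<bar> \<le> \<bar>y$2\<bar>"
    using assms order_trans unfolding hcone_def vcone_def by blast+
  then have "\<bar>Polynomial.coeff (pencil v x y) 3\<bar> \<le> 140 * norm v * (\<bar>x$1\<bar> ^ 3 * \<bar>y$2\<bar> ^ 3)"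
    by (intro abs_coeff_pencil_le) auto
  also have "\<bar>x$1\<bar> ^ 3 * \<bar>y$2\<bar> ^ 3 = d ^ 3" by (simp add: d_def abs_mult power_mult_distrib)
  finally have "\<bar>neutral x y v\<bar> \<le> 140 * norm v * d ^ 3 / ((1 - m\<^sup>2) * d) ^ 3"
    unfolding neutral_def abs_divide power_abs using w pos by (intro frac_le) (auto simp: power_abs)
  then show ?thesis using d by (simp add: power_mult_distrib)
qed

section \<open>Positivity of the pairing with the strip vector\<close>

definition strip :: "real^7" where
  "strip = axis 1 1 + axis 3 1 + axis 5 1"

lemma sextic_strip: "sextic strip a b = a ^ 5 * b + a ^ 3 * b ^ 3 + a * b ^ 5"
  by (simp add: sextic_expand strip_def axis_def)

lemma neutral_strip:
  "neutral x y strip = (x$1 * y$2 + x$2 * y$1) *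
     (10 * (x$1 * y$1)\<^sup>2 + 10 * (x$2 * y$2)\<^sup>2 + 8 * (x$1 * y$1) * (x$2 * y$2)
       + (x$1 * y$2)\<^sup>2 + (x$2 * y$1)\<^sup>2) / (x$1 * y$2 - x$2 * y$1) ^ 3"
proof -
  have "pencil strip x y = [:x$1, y$1:] ^ 5 * [:x$2, y$2:] + [:x$1, y$1:] ^ 3 * [:x$2, y$2:] ^ 3
      + [:x$1, y$1:] * [:x$2, y$2:] ^ 5"
    by (rule poly_ext) (simp add: poly_pencil sextic_strip algebra_simps)
  then have "Polynomial.coeff (pencil strip x y) 3 = (x$1 * y$2 + x$2 * y$1) *
     (10 * (x$1 * y$1)\<^sup>2 + 10 * (x$2 * y$2)\<^sup>2 + 8 * (x$1 * y$1) * (x$2 * y$2)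
       + (x$1 * y$2)\<^sup>2 + (x$2 * y$1)\<^sup>2)"
    by (simp add: eval_nat_numeral coeff_pCons algebra_simps)
  then show ?thesis by (simp add: neutral_def wedge_def)
qed

text \<open>The numerator is symmetric in \<open>x\<close> and \<open>y\<close>, the wedge is odd.
  This sign makes the two terms of \<open>strip - T strip\<close> add up rather than cancel when
  \<open>T\<close> exchanges the arcs.\<close>

lemma neutral_strip_swap: "neutral y x strip = - neutral x y strip"
proof -
  have "(y$1 * x$2 - y$2 * x$1) ^ 3 = - ((x$1 * y$2 - x$2 * y$1) ^ 3)"
    by (simp add: eval_nat_numeral algebra_simps)
  then show ?thesis unfolding neutral_strip by (simp add: algebra_simps)
qed

definition gap :: "real \<Rightarrow> real" where
  "gap m = (1 - m\<^sup>2) / (1 + m\<^sup>2) ^ 3"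

lemma gap_pos: "0 \<le> m \<Longrightarrow> m < 1 \<Longrightarrow> gap m > 0"
  by (simp add: gap_def abs_square_less_1 add_pos_nonneg)

text \<open>After division by powers of \<open>D\<close> only the ratio \<open>r = E / D\<close>, of
  modulus at most \<open>m\<^sup>2\<close>, and the value \<open>k\<close> of a positive definite
  quadratic form in \<open>x$1 * y$1\<close> and \<open>x$2 * y$2\<close> remain. All factors are
  positive, and \<open>gap m\<close> takes the worst value of each.\<close>

lemma neutral_strip_ge:
  assumes "x \<in> hcone m" "y \<in> vcone m" "0 \<le> m" "m < 1"
  shows "neutral x y strip \<ge> gap m"
proof -
  define D E a b where "D = x$1 * y$2" and "E = x$2 * y$1" and "a = x$1 * y$1" and "b = x$2 * y$2"
  have m2: "m\<^sup>2 < 1" using assms by (simp add: abs_square_less_1)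
  have D: "D \<noteq> 0" using assms by (auto simp: D_def hcone_def vcone_def)
  define r where "r = E / D"
  have r: "\<bar>r\<bar> \<le> m\<^sup>2" using abs_cross_le[OF assms(1-3)] D
    by (simp add: r_def D_def E_def abs_divide divide_simps)
  have E: "E = r * D" using D by (simp add: r_def)
  define k where "k = (10 * a\<^sup>2 + 10 * b\<^sup>2 + 8 * a * b) / D\<^sup>2"
  have "10 * a\<^sup>2 + 10 * b\<^sup>2 + 8 * a * b = 6 * a\<^sup>2 + 6 * b\<^sup>2 + 4 * (a + b)\<^sup>2"
    by (simp add: power2_eq_square algebra_simps)
  then have k: "k \<ge> 0" unfolding k_def by (metis (no_types) add_nonneg_nonneg divide_nonneg_nonneg mult_nonneg_nonneg zero_le_numeral zero_le_power2)
  have "neutral x y strip = (D + E) * (D\<^sup>2 * k + D\<^sup>2 + E\<^sup>2) / (D - E) ^ 3"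
    unfolding neutral_strip k_def using D by (simp add: D_def E_def a_def b_def)
  also have "D + E = D * (1 + r)" by (simp add: E algebra_simps)
  also have "D\<^sup>2 * k + D\<^sup>2 + E\<^sup>2 = D\<^sup>2 * (k + 1 + r\<^sup>2)" by (simp add: E power2_eq_square algebra_simps)
  also have "D - E = D * (1 - r)" by (simp add: E algebra_simps)
  also have "D * (1 + r) * (D\<^sup>2 * (k + 1 + r\<^sup>2)) / (D * (1 - r)) ^ 3
      = (1 + r) * (k + 1 + r\<^sup>2) / (1 - r) ^ 3"
    using D by (simp add: power_mult_distrib power2_eq_square power3_eq_cube)
  finally have eq: "neutral x y strip = (1 + r) * (k + 1 + r\<^sup>2) / (1 - r) ^ 3" .
  have "(1 - m\<^sup>2) * 1 \<le> (1 + r) * (k + 1 + r\<^sup>2)"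
    using r k m2 by (intro mult_mono) auto
  moreover have "(1 - r) ^ 3 \<le> (1 + m\<^sup>2) ^ 3" using r m2 by (intro power_mono) auto
  moreover have "0 < (1 - r) ^ 3" using r m2 by simp
  ultimately show ?thesis unfolding eq gap_def using m2 by (intro frac_le) auto
qed

section \<open>The two rotations in normal position, and ping-pong\<close>

definition mat2 :: "real \<Rightarrow> real \<Rightarrow> real \<Rightarrow> real \<Rightarrow> real^2^2" where
  "mat2 a b c d = vector [vector [a, b], vector [c, d]]"

lemma mat2_nth [simp]:
  "mat2 a b c d $ 1 $ 1 = a" "mat2 a b c d $ 1 $ 2 = b"
  "mat2 a b c d $ 2 $ 1 = c" "mat2 a b c d $ 2 $ 2 = d"
  by (simp_all add: mat2_def)

lemma matrix2_eq_iff: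
  "A = B \<longleftrightarrow> A$1$1 = B$1$1 \<and> A$1$2 = B$1$2 \<and> A$2$1 = B$2$1 \<and> A$2$2 = B$2$2"
  for A B :: "'a^2^2"
  by (auto simp: vec_eq_iff forall_2)

lemma matrix2_mult_nth:
  "(A ** B) $ i $ j = A$i$1 * B$1$j + A$i$2 * B$2$j" for A B :: "real^2^2"
  by (simp add: matrix_matrix_mult_def sum_2)

lemma vector_matrix_mult_nth_2:
  "(x v* A) $ j = A$1$j * x$1 + A$2$j * x$2" for A :: "real^2^2"
  by (simp add: vector_matrix_mult_def sum_2)

definition rotS :: "real^2^2" where "rotS = mat2 0 (-1) 1 0"

text \<open>For \<open>\<tau> > 0\<close> this is the linear rotation by pi/3 conjugated by a
  diagonal matrix, so that its fixed point in the upper half-plane is \<open>i \<tau>\<close>. In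
  \<open>PSL2\<close> it has order three, with inverse \<open>rotT'\<close>.\<close>

definition rotT :: "real \<Rightarrow> real^2^2" where
  "rotT \<tau> = mat2 (1/2) (- (sqrt 3 * \<tau> / 2)) (sqrt 3 / (2 * \<tau>)) (1/2)"

definition rotT' :: "real \<Rightarrow> real^2^2" where
  "rotT' \<tau> = mat2 (1/2) (sqrt 3 * \<tau> / 2) (- (sqrt 3 / (2 * \<tau>))) (1/2)"

lemma det_rotS: "det rotS = 1" by (simp add: det_2 rotS_def)

lemma det_rotT: "\<tau> \<noteq> 0 \<Longrightarrow> det (rotT \<tau>) = 1" "\<tau> \<noteq> 0 \<Longrightarrow> det (rotT' \<tau>) = 1"
  by (simp_all add: det_2 rotT_def rotT'_def field_simps)

lemma rotT_rotT': "\<tau> \<noteq> 0 \<Longrightarrow> rotT \<tau> ** rotT' \<tau> = mat 1" "\<tau> \<noteq> 0 \<Longrightarrow> rotT' \<tau> ** rotT \<tau> = mat 1"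
  by (simp_all add: matrix2_eq_iff matrix2_mult_nth rotT_def rotT'_def mat_def field_simps)

lemma rotS_rotS: "rotS ** rotS = - mat 1"
  by (simp add: matrix2_eq_iff matrix2_mult_nth rotS_def mat_def)

lemma rotS_hcone: "x v* rotS \<in> hcone m \<longleftrightarrow> x \<in> vcone m"
  by (simp add: vcone_def hcone_def vector_matrix_mult_nth_2 rotS_def)

lemma rotS_vcone: "x v* rotS \<in> vcone m \<longleftrightarrow> x \<in> hcone m"
  by (simp add: vcone_def hcone_def vector_matrix_mult_nth_2 rotS_def)

text \<open>The last inequality compares two estimates for the image under
  \<open>rotT \<tau>\<close> of a row vector \<open>(a, b)\<close> of \<open>hcone m\<close>: its
  first coordinate is at most \<open>(1 + sqrt 3 * m / \<tau>) * \<bar>a\<bar> / 2\<close> and its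
  second at least \<open>(sqrt 3 * \<tau> - m) * \<bar>a\<bar> / 2\<close> in modulus.\<close>

definition pingpong :: "real \<Rightarrow> real \<Rightarrow> bool" where
  "pingpong \<tau> m \<longleftrightarrow> 0 < \<tau> \<and> 0 < m \<and> m < 1 \<and> 1 + sqrt 3 * m / \<tau> \<le> m * (sqrt 3 * \<tau> - m)"

text \<open>At \<open>m = 1\<close> the inequality has slack \<open>\<eta>\<close>, which for
  positive \<open>\<tau>\<close> is positive exactly when \<open>\<tau> > sqrt 3\<close>. At
  \<open>m = 1 - \<delta>\<close> the slack is
  \<open>(1 - \<delta>) * \<eta> - \<delta> * \<delta>\<close>, so a small \<open>\<delta>\<close>
  buys \<open>m < 1\<close>.\<close>

lemma ex_pingpong:
  assumes "\<tau> > sqrt 3"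
  shows "\<exists>m. pingpong \<tau> m"
proof -
  have \<tau>: "\<tau> > 0" using assms by (smt (verit) real_sqrt_ge_zero)
  have "sqrt 3 * sqrt 3 < sqrt 3 * \<tau>" using assms by (intro mult_strict_left_mono) auto
  then have "3 < sqrt 3 * \<tau>" by simp
  moreover have "sqrt 3 / \<tau> < 1" using assms \<tau> by simp
  ultimately have \<eta>: "sqrt 3 * \<tau> - sqrt 3 / \<tau> - 2 > 0" by simp
  define \<eta> where "\<eta> = sqrt 3 * \<tau> - sqrt 3 / \<tau> - 2"
  define \<delta> where "\<delta> = min (1/2) (\<eta>/2)"
  have \<delta>: "0 < \<delta>" "\<delta> \<le> 1/2" "\<delta> \<le> \<eta>/2" 
  proof -
    have "\<eta> > 0" using \<eta> by (simp add: \<eta>_def)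
    then show "0 < \<delta>" "\<delta> \<le> 1/2" "\<delta> \<le> \<eta>/2" by (auto simp: \<delta>_def)
  qed
  have "\<delta> * \<delta> \<le> (1/2) * (\<eta>/2)" using \<delta> by (intro mult_mono) auto
  also have "\<dots> \<le> (1 - \<delta>) * \<eta>" using mult_right_mono[of "1/2" "1 - \<delta>" \<eta>] \<delta> by auto
  finally have "1 + sqrt 3 * (1 - \<delta>) / \<tau> \<le> (1 - \<delta>) * (sqrt 3 * \<tau> - (1 - \<delta>))"
    using \<tau> by (simp add: \<eta>_def field_simps)
  then show ?thesis using \<delta> \<tau> unfolding pingpong_def by (intro exI[of _ "1 - \<delta>"]) auto
qed

lemma rotT_pingpong:
  assumes "pingpong \<tau> m" "x \<in> hcone m"
  shows "x v* rotT \<tau> \<in> vcone m" "x v* rotT' \<tau> \<in> vcone m"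
proof -
  have *: "b' \<noteq> 0 \<and> \<bar>a'\<bar> \<le> m * \<bar>b'\<bar>"
    if ab: "a \<noteq> 0" "\<bar>b\<bar> \<le> m * \<bar>a\<bar>"
      and a': "a' = a / 2 + sqrt 3 / (2 * \<tau>) * b" and b': "b' = b / 2 - sqrt 3 * \<tau> / 2 * a"
    for a b a' b' :: real
  proof -
    have p: "0 < \<tau>" "0 < m" "m < 1" "1 + sqrt 3 * m / \<tau> \<le> m * (sqrt 3 * \<tau> - m)"
      using assms(1) by (auto simp: pingpong_def)
    have "0 < sqrt 3 * m / \<tau>" using p by simp
    then have "0 < m * (sqrt 3 * \<tau> - m)" using p(4) by linarith
    then have q: "0 < sqrt 3 * \<tau> - m" using p by (simp add: zero_less_mult_iff)
    have "\<bar>a'\<bar> \<le> \<bar>a\<bar> / 2 + sqrt 3 / (2 * \<tau>) * \<bar>b\<bar>"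
      unfolding a' using p by (intro order_trans[OF abs_triangle_ineq]) (simp add: abs_mult)
    also have "\<dots> \<le> \<bar>a\<bar> / 2 + sqrt 3 / (2 * \<tau>) * (m * \<bar>a\<bar>)"
      using ab p by (intro add_left_mono mult_left_mono) auto
    also have "\<dots> = (1 + sqrt 3 * m / \<tau>) * (\<bar>a\<bar> / 2)" using p by (simp add: field_simps)
    also have "\<dots> \<le> m * (sqrt 3 * \<tau> - m) * (\<bar>a\<bar> / 2)" using p by (intro mult_right_mono) auto
    also have "\<dots> = m * (sqrt 3 * \<tau> / 2 * \<bar>a\<bar> - m * \<bar>a\<bar> / 2)" by (simp add: algebra_simps)
    finally have 1: "\<bar>a'\<bar> \<le> m * (sqrt 3 * \<tau> / 2 * \<bar>a\<bar> - m * \<bar>a\<bar> / 2)" .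
    have "\<bar>sqrt 3 * \<tau> / 2 * a\<bar> = sqrt 3 * \<tau> / 2 * \<bar>a\<bar>" using p by (simp add: abs_mult)
    then have 2: "sqrt 3 * \<tau> / 2 * \<bar>a\<bar> - m * \<bar>a\<bar> / 2 \<le> \<bar>b'\<bar>" using ab(2) unfolding b' by linarith
    have "0 < (sqrt 3 * \<tau> - m) * (\<bar>a\<bar> / 2)" using q ab by simp
    then have "0 < \<bar>b'\<bar>" using 2 by (simp add: algebra_simps)
    moreover have "\<bar>a'\<bar> \<le> m * \<bar>b'\<bar>" using 1 mult_left_mono[OF 2, of m] p by linarith
    ultimately show ?thesis by simp
  qed
  have x: "x$1 \<noteq> 0" "\<bar>x$2\<bar> \<le> m * \<bar>x$1\<bar>" using assms(2) by (auto simp: hcone_def)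
  show "x v* rotT \<tau> \<in> vcone m"
    using *[OF x refl refl] by (simp add: vcone_def vector_matrix_mult_nth_2 rotT_def algebra_simps)
  \<comment> \<open>The reflection \<open>(x$1, - x$2)\<close> reduces the inverse rotation to the
    computation already made.\<close>
  define a' b' where "a' = x$1 / 2 + sqrt 3 / (2 * \<tau>) * (- x$2)"
    and "b' = (- x$2) / 2 - sqrt 3 * \<tau> / 2 * x$1"
  have "(x v* rotT' \<tau>) $ 1 = a'" "(x v* rotT' \<tau>) $ 2 = - b'"
    by (simp_all add: vector_matrix_mult_nth_2 rotT'_def a'_def b'_def)
  then show "x v* rotT' \<tau> \<in> vcone m"
    using *[OF x(1) _ a'_def b'_def] x by (simp add: vcone_def)
qed

definition rotT_pm :: "real \<Rightarrow> bool \<Rightarrow> real^2^2" where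
  "rotT_pm \<tau> e = (if e then rotT \<tau> else rotT' \<tau>)"

text \<open>Only blocks consisting of a rotation of order three followed by \<open>rotS\<close>
  occur, so that, acting on row vectors, each block maps \<open>hcone m\<close> into itself.\<close>

fun word :: "real \<Rightarrow> bool list \<Rightarrow> real^2^2" where
  "word \<tau> [] = mat 1"
| "word \<tau> (e # l) = rotT_pm \<tau> e ** rotS ** word \<tau> l"

text \<open>The value on the word of the cocycle that vanishes on \<open>rotS\<close> and is the
  coboundary of \<open>strip\<close> on \<open>rotT \<tau>\<close>.\<close>

fun word_translation :: "real \<Rightarrow> bool list \<Rightarrow> real^7" where
  "word_translation \<tau> [] = 0"
| "word_translation \<tau> (e # l) = strip - Sym6_act (rotT_pm \<tau> e) strip
     + Sym6_act (rotT_pm \<tau> e ** rotS) (word_translation \<tau> l)"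

lemma det_rotT_pm: "\<tau> \<noteq> 0 \<Longrightarrow> det (rotT_pm \<tau> e) = 1"
  by (simp add: rotT_pm_def det_rotT)

lemma det_word: "\<tau> \<noteq> 0 \<Longrightarrow> det (word \<tau> l) = 1"
  by (induction l) (simp_all add: det_mul det_rotT_pm det_rotS)

lemma rotT_pm_pingpong: "pingpong \<tau> m \<Longrightarrow> x \<in> hcone m \<Longrightarrow> x v* rotT_pm \<tau> e \<in> vcone m"
  by (simp add: rotT_pm_def rotT_pingpong)

text \<open>Ping-pong for the inverse letter. It serves to trace back the endpoint \<open>y\<close>,
  whose position is known only after the whole word has acted.\<close>

lemma rotT_pm_pingpong_inverse:
  assumes "pingpong \<tau> m" "x v* rotT_pm \<tau> e \<in> hcone m"
  shows "x \<in> vcone m"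
proof -
  have "rotT_pm \<tau> e ** rotT_pm \<tau> (\<not> e) = mat 1"
    using assms(1) by (simp add: rotT_pm_def rotT_rotT' pingpong_def)
  then have "x v* rotT_pm \<tau> e v* rotT_pm \<tau> (\<not> e) = x"
    by (simp add: vector_matrix_mul_assoc)
  then show ?thesis using rotT_pm_pingpong[OF assms] by metis
qed

text \<open>Every letter contributes at least \<open>2 * gap m\<close>: the geodesic with endpoints \<open>x\<close>, \<open>y\<close> crosses
  all the strips of the word in the same direction.\<close>

lemma neutral_word_translation_ge:
  assumes "pingpong \<tau> m"
  shows "x \<in> hcone m \<Longrightarrow> y v* word \<tau> l \<in> vcone m \<Longrightarrow>
    x v* word \<tau> l \<in> hcone m \<and> y \<in> vcone m \<and>
    neutral x y (word_translation \<tau> l) \<ge> 2 * gap m * length l"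
proof (induction l arbitrary: x y)
  case Nil
  then show ?case by (simp add: linear_0[OF linear_neutral])
next
  case (Cons e l)
  have m: "0 \<le> m" "m < 1" "\<tau> \<noteq> 0" using assms by (auto simp: pingpong_def)
  let ?T = "rotT_pm \<tau> e"
  have xT: "x v* ?T \<in> vcone m" using Cons.prems(1) assms by (simp add: rotT_pm_pingpong)
  have x': "x v* (?T ** rotS) \<in> hcone m"
    using xT by (simp flip: vector_matrix_mul_assoc add: rotS_hcone)
  have "y v* (?T ** rotS) v* word \<tau> l \<in> vcone m"
    using Cons.prems(2) by (simp add: vector_matrix_mul_assoc)
  note IH = Cons.IH[OF x' this]
  have yT: "y v* ?T \<in> hcone m"
    using IH by (simp flip: vector_matrix_mul_assoc add: rotS_vcone)
  have y: "y \<in> vcone m" using rotT_pm_pingpong_inverse[OF assms yT] .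
  have "neutral x y strip \<ge> gap m" using neutral_strip_ge[OF Cons.prems(1) y] m by simp
  \<comment> \<open>\<open>?T\<close> carries \<open>x\<close> to the vertical and \<open>y\<close>
    to the horizontal cone. The exchanged endpoints cost a sign, so both terms of
    \<open>strip - Sym6_act ?T strip\<close> contribute the gap.\<close>
  moreover have "neutral x y (Sym6_act ?T strip) \<le> - gap m"
    using neutral_strip_ge[OF yT xT] neutral_strip_swap[of "x v* ?T" "y v* ?T"] m
    by (simp add: neutral_Sym6_act det_rotT_pm)
  moreover have "neutral x y (Sym6_act (?T ** rotS) (word_translation \<tau> l)) \<ge> 2 * gap m * length l"
    using IH m by (simp add: neutral_Sym6_act det_mul det_rotT_pm det_rotS)
  ultimately show ?case
    using IH y by (simp add: neutral_plus neutral_diff vector_matrix_mul_assoc algebra_simps)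
qed

lemma length_word_le:
  assumes "pingpong \<tau> m" "Sym6_act (word \<tau> l) v + c *\<^sub>R word_translation \<tau> l = v'"
  shows "\<bar>c\<bar> * (2 * gap m * length l) \<le> 140 / (1 - m\<^sup>2) ^ 3 * (norm v + norm v')"
proof -
  have m: "0 \<le> m" "m < 1" "\<tau> \<noteq> 0" using assms by (auto simp: pingpong_def)
  have "invertible (word \<tau> l)" using m by (simp add: invertible_det_nz det_word)
  then obtain W where W: "W ** word \<tau> l = mat 1" unfolding invertible_def by auto
  \<comment> \<open>\<open>x\<close> is chosen before the word acts and \<open>y\<close> by its
    image, the second basis vector, as \<open>neutral_word_translation_ge\<close> requires.\<close>
  define x y :: "real^2" where "x = axis 1 1" and "y = axis 2 1 v* W"
  have yW: "y v* word \<tau> l = axis 2 1" using W by (simp add: y_def vector_matrix_mul_assoc)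
  have x: "x \<in> hcone m" using m by (simp add: x_def hcone_def axis_def)
  have yWc: "y v* word \<tau> l \<in> vcone m" unfolding yW using m by (simp add: vcone_def axis_def)
  note * = neutral_word_translation_ge[OF assms(1) x yWc]
  have "0 \<le> 2 * gap m * length l" using gap_pos[OF m(1,2)] by simp
  then have "2 * gap m * length l \<le> \<bar>neutral x y (word_translation \<tau> l)\<bar>" using * by linarith
  then have "\<bar>c\<bar> * (2 * gap m * length l) \<le> \<bar>c\<bar> * \<bar>neutral x y (word_translation \<tau> l)\<bar>"
    by (intro mult_left_mono) auto
  also have "\<dots> = \<bar>neutral x y (c *\<^sub>R word_translation \<tau> l)\<bar>" by (simp add: neutral_scale abs_mult)
  also have "c *\<^sub>R word_translation \<tau> l = v' - Sym6_act (word \<tau> l) v"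
    using assms(2) by (simp add: algebra_simps)
  also have "neutral x y (v' - Sym6_act (word \<tau> l) v)
      = neutral x y v' - neutral (x v* word \<tau> l) (y v* word \<tau> l) v"
    using m by (simp add: neutral_diff neutral_Sym6_act det_word)
  also have "\<bar>\<dots>\<bar> \<le> \<bar>neutral x y v'\<bar> + \<bar>neutral (x v* word \<tau> l) (y v* word \<tau> l) v\<bar>"
    by (rule abs_triangle_ineq4)
  also have "\<dots> \<le> 140 / (1 - m\<^sup>2) ^ 3 * norm v' + 140 / (1 - m\<^sup>2) ^ 3 * norm v"
    using * m x yWc by (intro add_mono abs_neutral_le) auto
  finally show ?thesis by (simp only: distrib_left add.commute)
qed

section \<open>Cocycles\<close>

lemma sextic_axis_combination:
  "sextic (x0 *\<^sub>R axis 0 1 + x1 *\<^sub>R axis 1 1 + x2 *\<^sub>R axis 2 1 + x3 *\<^sub>R axis 3 1 + x4 *\<^sub>R axis 4 1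
     + x5 *\<^sub>R axis 5 1 + x6 *\<^sub>R axis 6 1) a b
   = x0 * a^6 + x1 * a^5 * b + x2 * a^4 * b^2 + x3 * a^3 * b^3 + x4 * a^2 * b^4 + x5 * a * b^5 + x6 * b^6"
  by (simp add: sextic_expand axis_def)

lemma ex_sextic:
  "\<exists>v. \<forall>a b. sextic v a b = x0 * a^6 + x1 * a^5 * b + x2 * a^4 * b^2 + x3 * a^3 * b^3 + x4 * a^2 * b^4
     + x5 * a * b^5 + x6 * b^6"
  using sextic_axis_combination by blast

text \<open>The substitution multiplies the complex number \<open>x + i b\<close> by a sixth root of
  unity whose cube is -1; the two claims are the real and imaginary part of its effect on the
  cube.\<close>

lemma cube_rotation_third:
  fixes x b :: real
  defines "x' \<equiv> (x + sqrt 3 * b) / 2" and "b' \<equiv> (b - sqrt 3 * x) / 2"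
  shows "x' ^ 3 - 3 * x' * b'\<^sup>2 = - (x ^ 3 - 3 * x * b\<^sup>2)"
    and "3 * x'\<^sup>2 * b' - b' ^ 3 = - (3 * x\<^sup>2 * b - b ^ 3)"
proof -
  have *: "(x + r * b) ^ 3 - 3 * (x + r * b) * (b - r * x)\<^sup>2 = - 8 * (x ^ 3 - 3 * x * b\<^sup>2)"
    "3 * (x + r * b)\<^sup>2 * (b - r * x) - (b - r * x) ^ 3 = - 8 * (3 * x\<^sup>2 * b - b ^ 3)"
    if r: "r * r = 3" for r
  proof -
    have rr: "r * (r * z) = 3 * z" for z using r by (simp flip: mult.assoc)
    then show "(x + r * b) ^ 3 - 3 * (x + r * b) * (b - r * x)\<^sup>2 = - 8 * (x ^ 3 - 3 * x * b\<^sup>2)"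
      "3 * (x + r * b)\<^sup>2 * (b - r * x) - (b - r * x) ^ 3 = - 8 * (3 * x\<^sup>2 * b - b ^ 3)"
      using r by (simp_all add: power2_eq_square power3_eq_cube algebra_simps rr)
  qed
  have r: "sqrt 3 * sqrt 3 = (3::real)" by simp
  show "x' ^ 3 - 3 * x' * b'\<^sup>2 = - (x ^ 3 - 3 * x * b\<^sup>2)"
    using *(1)[OF r] unfolding x'_def b'_def by (simp add: power_divide)
  show "3 * x'\<^sup>2 * b' - b' ^ 3 = - (3 * x\<^sup>2 * b - b ^ 3)"
    using *(2)[OF r] unfolding x'_def b'_def by (simp add: power_divide)
qed

text \<open>With \<open>cubicIm\<close>, the real and imaginary part of
  \<open>(\<tau> * a + i * b) ^ 3\<close>. Both change sign under \<open>rotT \<tau>\<close>, so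
  products of two of them are invariant sextics.\<close>

definition cubicRe :: "real \<Rightarrow> real \<Rightarrow> real \<Rightarrow> real" where
  "cubicRe \<tau> a b = (\<tau> * a) ^ 3 - 3 * (\<tau> * a) * b\<^sup>2"

definition cubicIm :: "real \<Rightarrow> real \<Rightarrow> real \<Rightarrow> real" where
  "cubicIm \<tau> a b = 3 * (\<tau> * a)\<^sup>2 * b - b ^ 3"

lemma cubic_rotT:
  assumes "\<tau> \<noteq> 0"
  defines "a' \<equiv> \<lambda>a b. a * rotT \<tau>$1$1 + b * rotT \<tau>$2$1"
    and "b' \<equiv> \<lambda>a b. a * rotT \<tau>$1$2 + b * rotT \<tau>$2$2"
  shows "cubicRe \<tau> (a' a b) (b' a b) = - cubicRe \<tau> a b"
    and "cubicIm \<tau> (a' a b) (b' a b) = - cubicIm \<tau> a b"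
proof -
  have "\<tau> * a' a b = (\<tau> * a + sqrt 3 * b) / 2" "b' a b = (b - sqrt 3 * (\<tau> * a)) / 2"
    using assms(1) by (simp_all add: a'_def b'_def rotT_def field_simps)
  then show "cubicRe \<tau> (a' a b) (b' a b) = - cubicRe \<tau> a b"
    and "cubicIm \<tau> (a' a b) (b' a b) = - cubicIm \<tau> a b"
    unfolding cubicRe_def cubicIm_def using cube_rotation_third[of "\<tau> * a" b] by presburger+
qed

text \<open>The invariants of \<open>rotS\<close> and \<open>rotT\<close> are transverse to the strip vector, so the first cohomology
  of the free product is spanned by the strip cocycle.\<close>

lemma strip_decomposition:
  assumes "\<tau> > 1"
  obtains c p q where "v = c *\<^sub>R strip + p + q" "Sym6_act rotS p = p" "Sym6_act (rotT \<tau>) q = q"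
proof -
  \<comment> \<open>\<open>- \<Delta>\<close> is the determinant of the linear system
    \<open>e1\<close>, \<open>e2\<close> for \<open>\<alpha>\<close> and \<open>\<beta>\<close>,
    which are given by Cramer's rule. It comes from the even powers of \<open>b\<close> and vanishes
    at \<open>\<tau> = 1\<close>, where the two rotations commute.\<close>
  define \<Delta> where "\<Delta> = (\<tau>^6 - 1) * (6 * \<tau>^4 + 9 * \<tau>\<^sup>2) + \<tau>^6 * (3 * (\<tau>^4 - \<tau>\<^sup>2))"
  have "\<tau>^6 - 1 > 0" "\<tau>^4 - \<tau>\<^sup>2 > 0" using assms by (simp_all add: power_strict_increasing)
  then have \<Delta>: "\<Delta> > 0" using assms unfolding \<Delta>_def by (intro add_pos_pos mult_pos_pos) auto
  define d e where "d = v$0 - v$6" and "e = v$2 - v$4"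
  define \<alpha> \<beta> where "\<alpha> = ((6 * \<tau>^4 + 9 * \<tau>\<^sup>2) * d + \<tau>^6 * e) / \<Delta>"
    and "\<beta> = (3 * (\<tau>^4 - \<tau>\<^sup>2) * d - (\<tau>^6 - 1) * e) / \<Delta>"
  have e1: "\<alpha> * (\<tau>^6 - 1) + \<beta> * \<tau>^6 = d"
    using \<Delta> unfolding \<alpha>_def \<beta>_def by (simp add: divide_simps) (simp add: \<Delta>_def algebra_simps)
  have e2: "\<alpha> * (3 * (\<tau>^4 - \<tau>\<^sup>2)) - \<beta> * (6 * \<tau>^4 + 9 * \<tau>\<^sup>2) = e"
    using \<Delta> unfolding \<alpha>_def \<beta>_def by (simp add: divide_simps) (simp add: \<Delta>_def algebra_simps)
  \<comment> \<open>For the odd powers, \<open>c\<close> and \<open>\<kappa>\<close> both cancel in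
    \<open>v$1 + v$5 - 2 * v$3\<close>; what is left is \<open>\<mu>\<close> times this positive
    number.\<close>
  have "20 * \<tau>\<^sup>2 + 3 * \<tau>^4 + 3 > 0" by (simp add: add_nonneg_pos)
  define \<mu> where "\<mu> = (v$1 + v$5 - 2 * v$3) / (20 * \<tau>\<^sup>2 + 3 * \<tau>^4 + 3)"
  have \<mu>: "\<mu> * (20 * \<tau>\<^sup>2 + 3 * \<tau>^4 + 3) = v$1 + v$5 - 2 * v$3"
    unfolding \<mu>_def using \<open>20 * \<tau>\<^sup>2 + 3 * \<tau>^4 + 3 > 0\<close> by simp
  define c where "c = v$3 + 10 * \<tau>\<^sup>2 * \<mu>"
  define \<kappa> where "\<kappa> = c + 3 * \<mu> - v$5"
  obtain p where p: "\<And>a b. sextic p a b = (v$6 - \<alpha>) * (a^6 + b^6)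
      + (v$4 - 3 * \<tau>\<^sup>2 * \<alpha> - 9 * \<tau>\<^sup>2 * \<beta>) * (a^4 * b^2 + a^2 * b^4) + \<kappa> * (a^5 * b - a * b^5)"
    using ex_sextic[of "v$6 - \<alpha>" \<kappa> "v$4 - 3 * \<tau>\<^sup>2 * \<alpha> - 9 * \<tau>\<^sup>2 * \<beta>" 0
        "v$4 - 3 * \<tau>\<^sup>2 * \<alpha> - 9 * \<tau>\<^sup>2 * \<beta>" "- \<kappa>" "v$6 - \<alpha>"]
    by (auto simp: algebra_simps)
  \<comment> \<open>The mixed product \<open>cubicRe * cubicIm\<close> contains only odd powers of
    \<open>\<tau>\<close>; dividing by \<open>\<tau>\<close> makes the coefficients of
    \<open>q\<close> polynomial in \<open>\<mu>\<close> and \<open>\<tau>\<close>.\<close>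
  define \<nu> where "\<nu> = \<mu> / \<tau>"
  have \<nu>: "\<mu> = \<nu> * \<tau>" using assms by (simp add: \<nu>_def)
  obtain q where q: "\<And>a b. sextic q a b = (\<alpha> * \<tau>^6 + \<beta> * \<tau>^6) * a^6 + (3 * \<mu> * \<tau>^4) * a^5 * b
      + (3 * \<alpha> * \<tau>^4 - 6 * \<beta> * \<tau>^4) * a^4 * b^2 + (- 10 * \<mu> * \<tau>\<^sup>2) * a^3 * b^3
      + (3 * \<alpha> * \<tau>\<^sup>2 + 9 * \<beta> * \<tau>\<^sup>2) * a^2 * b^4 + (3 * \<mu>) * a * b^5 + \<alpha> * b^6"
    using ex_sextic by blast
  have cubic: "sextic q a b = \<alpha> * ((cubicRe \<tau> a b)\<^sup>2 + (cubicIm \<tau> a b)\<^sup>2)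
      + \<beta> * (cubicRe \<tau> a b)\<^sup>2 + \<nu> * (cubicRe \<tau> a b * cubicIm \<tau> a b)" for a b
    unfolding cubicRe_def cubicIm_def q \<nu> by (simp add: eval_nat_numeral algebra_simps)
  show ?thesis
  proof
    have "v$0 = v$6 - \<alpha> + (\<alpha> * \<tau>^6 + \<beta> * \<tau>^6)" "v$1 = c + \<kappa> + 3 * \<mu> * \<tau>^4"
      "v$2 = v$4 - 3 * \<tau>\<^sup>2 * \<alpha> - 9 * \<tau>\<^sup>2 * \<beta> + (3 * \<alpha> * \<tau>^4 - 6 * \<beta> * \<tau>^4)"
      "v$3 = c - 10 * \<mu> * \<tau>\<^sup>2" "v$5 = c - \<kappa> + 3 * \<mu>"
      using e1 e2 \<mu> unfolding d_def e_def \<kappa>_def c_def by (simp_all add: algebra_simps)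
    note v = this
    show "v = c *\<^sub>R strip + p + q"
      by (rule sextic_inject, unfold sextic_add sextic_scale sextic_strip p q sextic_expand[of v],
          subst v(1), subst v(2), subst v(3), subst v(4), subst v(5)) (simp add: algebra_simps)
    show "Sym6_act rotS p = p"
      by (rule sextic_inject) (simp add: sextic_Sym6_act p rotS_def algebra_simps)
    show "Sym6_act (rotT \<tau>) q = q"
      using cubic_rotT[of \<tau>] assms
      by (intro sextic_inject) (simp add: sextic_Sym6_act cubic)
  qed
qed

section \<open>Cocycles on matrices and their normal form\<close>

lemma rotT_square: "\<tau> \<noteq> 0 \<Longrightarrow> rotT \<tau> ** rotT \<tau> = - rotT' \<tau>"
  by (simp add: matrix2_eq_iff matrix2_mult_nth rotT_def rotT'_def field_simps)

lemma Sym6_act_arith: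
  "Sym6_act A (v + w) = Sym6_act A v + Sym6_act A w"
  "Sym6_act A (v - w) = Sym6_act A v - Sym6_act A w"
  "Sym6_act A (c *\<^sub>R v) = c *\<^sub>R Sym6_act A v"
  "Sym6_act A (- v) = - Sym6_act A v"
  "Sym6_act A 0 = 0"
  by (simp_all add: linear_Sym6_act linear_add linear_diff linear_cmul linear_neg linear_0)

text \<open>\<open>G\<close> stands for the preimage of the group in \<open>SL2\<close>, so that
  computations use matrices instead of cosets; invariance under sign records that \<open>f\<close>
  comes from the quotient.\<close>

locale matrix_cocycle =
  fixes G :: "(real^2^2) set" and f :: "real^2^2 \<Rightarrow> real^7" and \<tau> :: real
  assumes tau: "\<tau> > 1"
    and rotS_in: "rotS \<in> G" and rotT_in: "rotT \<tau> \<in> G"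
    and mult_in: "A \<in> G \<Longrightarrow> B \<in> G \<Longrightarrow> A ** B \<in> G"
    and uminus_in: "A \<in> G \<Longrightarrow> - A \<in> G"
    and f_mult: "A \<in> G \<Longrightarrow> B \<in> G \<Longrightarrow> f (A ** B) = Sym6_act A (f B) + f A"
    and f_uminus: "A \<in> G \<Longrightarrow> f (- A) = f A"
begin

lemma one_in: "mat 1 \<in> G"
  using uminus_in[OF mult_in[OF rotS_in rotS_in]] by (simp add: rotS_rotS)

lemma rotT'_in: "rotT' \<tau> \<in> G"
  using uminus_in[OF mult_in[OF rotT_in rotT_in]] tau by (simp add: rotT_square)

lemma f_one: "f (mat 1) = 0"
  using f_mult[OF one_in one_in] by simp

lemma f_rotT': "f (rotT' \<tau>) = - Sym6_act (rotT' \<tau>) (f (rotT \<tau>))"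
  using f_mult[OF rotT'_in rotT_in] tau f_one by (simp add: rotT_rotT' eq_neg_iff_add_eq_0 add.commute)

text \<open>Finite cyclic groups have no first cohomology over the reals, so \<open>f\<close> is a
  coboundary of some \<open>vS\<close> on \<open>rotS\<close> and of some \<open>vT\<close> on
  \<open>rotT \<tau>\<close>. These are determined only up to invariants: in the decomposition of
  \<open>vT - vS\<close> the part \<open>p\<close> is absorbed into \<open>vS\<close> and
  \<open>q\<close> into \<open>vT\<close>, which leaves the multiple of
  \<open>strip\<close>.\<close>

lemma normal_form:
  obtains c v where "f rotS = v - Sym6_act rotS v"
    "\<And>e. f (rotT_pm \<tau> e) = v - Sym6_act (rotT_pm \<tau> e) v + c *\<^sub>R (strip - Sym6_act (rotT_pm \<tau> e) strip)"
proof -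
  define vS where "vS = (1/2) *\<^sub>R f rotS"
  have "f (rotS ** rotS) = 0" using f_uminus[OF one_in] f_one by (simp add: rotS_rotS)
  then have "Sym6_act rotS (f rotS) = - f rotS"
    using f_mult[OF rotS_in rotS_in] by (simp add: eq_neg_iff_add_eq_0)
  then have vS: "f rotS = vS - Sym6_act rotS vS"
    by (simp add: vS_def Sym6_act_arith flip: scaleR_add_left)
  define T where "T = Sym6_act (rotT \<tau>)"
  define t where "t = f (rotT \<tau>)"
  have "f (rotT \<tau> ** rotT \<tau>) = f (rotT' \<tau>)"
    using tau f_uminus[OF rotT'_in] by (simp add: rotT_square)
  then have "T t + t = - Sym6_act (rotT' \<tau>) t"
    using f_mult[OF rotT_in rotT_in] by (simp add: T_def t_def f_rotT')
  moreover have "Sym6_act (rotT' \<tau>) t = T (T t)"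
    using tau unfolding T_def by (simp flip: Sym6_act_mult add: rotT_square)
  ultimately have "T (T t) = - (T t + t)" by simp
  then have TT: "T (T t) = - T t - t" by simp
  \<comment> \<open>\<open>t + T t + T (T t)\<close> is zero, and then
    \<open>(2 t + T t) / 3\<close> solves \<open>vT - T vT = t\<close>.\<close>
  define vT where "vT = (1/3) *\<^sub>R (t + t + T t)"
  have "vT - T vT = (1/3) *\<^sub>R (t + t + T t - (T t + T t + T (T t)))"
    by (simp only: vT_def T_def Sym6_act_arith scaleR_diff_right)
  also have "t + t + T t - (T t + T t + T (T t)) = t + t + t" by (simp add: TT)
  also have "(1/3) *\<^sub>R (t + t + t) = t" by (simp add: vec_eq_iff)
  finally have vT: "t = vT - T vT" by simp
  obtain c p q where pq: "vT - vS = c *\<^sub>R strip + p + q" "Sym6_act rotS p = p" "Sym6_act (rotT \<tau>) q = q"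
    using strip_decomposition[OF tau] by blast
  define v where "v = vS + p"
  have vTv: "vT = v + c *\<^sub>R strip + q" using pq(1) by (simp add: v_def algebra_simps)
  have T: "f (rotT \<tau>) = v - Sym6_act (rotT \<tau>) v + c *\<^sub>R (strip - Sym6_act (rotT \<tau>) strip)"
    using vT pq(3) unfolding t_def T_def vTv by (simp add: Sym6_act_arith algebra_simps)
  have inv: "Sym6_act (rotT' \<tau>) (Sym6_act (rotT \<tau>) x) = x" for x
    using tau by (simp flip: Sym6_act_mult add: rotT_rotT')
  have "f (rotT' \<tau>) = v - Sym6_act (rotT' \<tau>) v + c *\<^sub>R (strip - Sym6_act (rotT' \<tau>) strip)"
    unfolding f_rotT' T by (simp add: Sym6_act_arith inv algebra_simps)
  with T have "f (rotT_pm \<tau> e) = v - Sym6_act (rotT_pm \<tau> e) v + c *\<^sub>R (strip - Sym6_act (rotT_pm \<tau> e) strip)"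
    for e by (simp add: rotT_pm_def)
  moreover have "f rotS = v - Sym6_act rotS v" using vS pq(2) by (simp add: v_def Sym6_act_arith)
  ultimately show ?thesis using that by blast
qed

lemma rotT_pm_in: "rotT_pm \<tau> e \<in> G"
  by (simp add: rotT_pm_def rotT_in rotT'_in)

lemma word_in: "word \<tau> l \<in> G"
  by (induction l) (simp_all add: one_in mult_in rotT_pm_in rotS_in)

lemma f_word:
  assumes "f rotS = v - Sym6_act rotS v"
    and "\<And>e. f (rotT_pm \<tau> e) = v - Sym6_act (rotT_pm \<tau> e) v + c *\<^sub>R (strip - Sym6_act (rotT_pm \<tau> e) strip)"
  shows "f (word \<tau> l) = v - Sym6_act (word \<tau> l) v + c *\<^sub>R word_translation \<tau> l"
proof (induction l)
  case Nil
  then show ?case by (simp add: f_one)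
next
  case (Cons e l)
  have "f (rotT_pm \<tau> e ** rotS ** word \<tau> l)
      = Sym6_act (rotT_pm \<tau> e ** rotS) (f (word \<tau> l)) + (Sym6_act (rotT_pm \<tau> e) (f rotS) + f (rotT_pm \<tau> e))"
    by (simp add: f_mult mult_in rotT_pm_in rotS_in word_in)
  then show ?case
    by (simp add: Cons.IH assms Sym6_act_arith Sym6_act_mult algebra_simps)
qed

lemma word_length_bounded:
  assumes "pingpong \<tau> m"
    and "\<nexists>v. f rotS = v - Sym6_act rotS v \<and> f (rotT \<tau>) = v - Sym6_act (rotT \<tau>) v"
  obtains n where "\<And>l x. norm x \<le> R \<Longrightarrow> norm (Sym6_act (word \<tau> l) x + f (word \<tau> l)) \<le> R \<Longrightarrow> length l \<le> n"
proof -
  obtain c v where cv: "f rotS = v - Sym6_act rotS v"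
    "\<And>e. f (rotT_pm \<tau> e) = v - Sym6_act (rotT_pm \<tau> e) v + c *\<^sub>R (strip - Sym6_act (rotT_pm \<tau> e) strip)"
    using normal_form by blast
  have "c \<noteq> 0"
  proof
    assume "c = 0"
    then show False using assms(2) cv(1) cv(2)[of True] by (auto simp: rotT_pm_def)
  qed
  have m: "0 \<le> m" "m < 1" using assms by (auto simp: pingpong_def)
  define K where "K = 140 / (1 - m\<^sup>2) ^ 3"
  have m2: "m\<^sup>2 < 1" using m by (simp add: abs_square_less_1)
  then have K: "K \<ge> 0" by (simp add: K_def)
  define D where "D = \<bar>c\<bar> * (2 * gap m)"
  have D: "D > 0" using \<open>c \<noteq> 0\<close> gap_pos[OF m] by (simp add: D_def)
  define B where "B = K * (2 * R + 2 * norm v) / D"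
  have "length l \<le> nat \<lceil>B\<rceil>" if "norm x \<le> R" "norm (Sym6_act (word \<tau> l) x + f (word \<tau> l)) \<le> R" for l x
  proof -
    let ?y = "Sym6_act (word \<tau> l) x + f (word \<tau> l)"
    \<comment> \<open>Moving the origin to \<open>v\<close> removes the coboundary part of the
      action; only the strip translation remains.\<close>
    have "Sym6_act (word \<tau> l) (x - v) + c *\<^sub>R word_translation \<tau> l = ?y - v"
      by (simp add: f_word[OF cv] Sym6_act_arith)
    from length_word_le[OF assms(1) this]
    have "D * length l \<le> K * (norm (x - v) + norm (?y - v))" by (simp add: D_def K_def)
    also have "\<dots> \<le> K * (2 * R + 2 * norm v)"
      using that norm_triangle_ineq4[of x v] norm_triangle_ineq4[of ?y v] K by (intro mult_left_mono) auto
    finally have "real (length l) \<le> B" using D by (simp add: B_def field_simps)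
    then show ?thesis by linarith
  qed
  then show ?thesis using that by blast
qed

end

section \<open>Rotations in PSL2\<close>

lemma matrix2_uminus_mult [simp]:
  "(- A) ** B = - (A ** B)" "A ** (- B) = - (A ** B)" for A B :: "real^2^2"
  by (simp_all add: matrix2_eq_iff matrix2_mult_nth)

lemma det_uminus_2 [simp]: "det (- A) = det A" for A :: "real^2^2"
  by (simp add: det_2)

lemma carrier_SL2: "A \<in> carrier SL2 \<longleftrightarrow> det A = 1" by (simp add: SL2_def)

lemma mult_SL2 [simp]: "A \<otimes>\<^bsub>SL2\<^esub> B = A ** B" by (simp add: SL2_def)

lemma one_SL2 [simp]: "\<one>\<^bsub>SL2\<^esub> = mat 1" by (simp add: SL2_def)

lemma group_SL2: "group SL2"
proof (rule groupI)
  fix A assume "A \<in> carrier SL2"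
  then have A: "det A = 1" by (simp add: carrier_SL2)
  then obtain B where "B ** A = mat 1" by (metis invertible_det_nz invertible_def zero_neq_one)
  moreover from this A have "det B = 1" using det_mul[of B A] by simp
  ultimately show "\<exists>B\<in>carrier SL2. B \<otimes>\<^bsub>SL2\<^esub> A = \<one>\<^bsub>SL2\<^esub>" by (auto simp: carrier_SL2)
qed (simp_all add: carrier_SL2 det_mul matrix_mul_assoc)

definition psl :: "real^2^2 \<Rightarrow> (real^2^2) set" where
  "psl A = {A, - A}"

lemma psl_eq_iff: "psl A = psl B \<longleftrightarrow> A = B \<or> A = - B"
  by (auto simp: psl_def doubleton_eq_iff)

lemma psl_uminus [simp]: "psl (- A) = psl A"
  by (auto simp: psl_def)

lemma r_coset_center: "{mat 1, - mat 1} #>\<^bsub>SL2\<^esub> A = psl A"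
  by (auto simp: r_coset_def psl_def)

lemma normal_center: "normal {mat 1, - mat 1} SL2"
proof -
  have "subgroup {mat 1, - mat 1} SL2"
  proof (rule group.subgroupI[OF group_SL2])
    fix A assume A: "A \<in> {mat 1, - mat 1 :: real^2^2}"
    have "inv\<^bsub>SL2\<^esub> A = A"
      by (rule group.inv_equality[OF group_SL2]) (use A in \<open>auto simp: carrier_SL2\<close>)
    then show "inv\<^bsub>SL2\<^esub> A \<in> {mat 1, - mat 1}" using A by simp
  qed (auto simp: carrier_SL2)
  moreover have "{mat 1, - mat 1} #>\<^bsub>SL2\<^esub> A = A <#\<^bsub>SL2\<^esub> {mat 1, - mat 1}" for A
    by (auto simp: r_coset_def l_coset_def)
  ultimately show ?thesis using group.normalI[OF group_SL2] by blast
qed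

lemma group_PSL2: "group PSL2"
  unfolding PSL2_def by (rule normal.factorgroup_is_group[OF normal_center])

lemma carrier_PSL2: "\<gamma> \<in> carrier PSL2 \<longleftrightarrow> (\<exists>A. det A = 1 \<and> \<gamma> = psl A)"
  by (auto simp: PSL2_def FactGroup_def RCOSETS_def r_coset_center carrier_SL2)

lemma psl_mult: "det A = 1 \<Longrightarrow> det B = 1 \<Longrightarrow> psl A \<otimes>\<^bsub>PSL2\<^esub> psl B = psl (A ** B)"
  using normal.rcos_sum[OF normal_center, of A B]
  by (simp add: PSL2_def FactGroup_def r_coset_center carrier_SL2)

lemma one_PSL2: "\<one>\<^bsub>PSL2\<^esub> = psl (mat 1)"
  by (simp add: PSL2_def FactGroup_def psl_def)

lemma sigma7_psl: "sigma7 (psl A) v = Sym6_act A v"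
  by (simp add: sigma7_def psl_def)

lemma SL2_act_uminus [simp]: "SL2_act (- A) X = SL2_act A X"
proof -
  have "transpose (- A) = - transpose A" by (simp add: transpose_def vec_eq_iff)
  then show ?thesis by (simp add: SL2_act_def)
qed

lemma PSL2_act_psl: "PSL2_act (psl A) X = SL2_act A X"
  by (simp add: PSL2_act_def psl_def)

text \<open>By Cayley-Hamilton the square of \<open>A\<close> is its trace times \<open>A\<close>,
  minus the identity. If the square is scalar and the trace is not zero, then \<open>A\<close>
  itself is scalar, hence plus or minus the identity.\<close>

lemma rotation_2_cases:
  assumes "rotation_of_order 2 s"
  obtains A where "s = psl A" "det A = 1" "A$1$1 + A$2$2 = 0"
proof -
  have s: "s \<in> carrier PSL2" "group.ord PSL2 s = 2" using assms by (auto simp: rotation_of_order_def)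
  then obtain A where A: "s = psl A" "det A = 1" by (auto simp: carrier_PSL2)
  have "s [^]\<^bsub>PSL2\<^esub> (2::nat) = \<one>\<^bsub>PSL2\<^esub>"
    using group.pow_ord_eq_1[OF group_PSL2 s(1)] s(2) by simp
  then have "psl (A ** A) = psl (mat 1)"
    using A s(1) monoid.nat_pow_Suc[of PSL2 s 1] group_PSL2
    by (simp add: numeral_2_eq_2 psl_mult one_PSL2 group.is_monoid monoid.nat_pow_eone)
  then have sq: "A ** A = mat 1 \<or> A ** A = - mat 1" by (simp add: psl_eq_iff)
  have "s \<noteq> \<one>\<^bsub>PSL2\<^esub>" using s group.ord_eq_1[OF group_PSL2 s(1)] by auto
  then have ne: "A \<noteq> mat 1" "A \<noteq> - mat 1" using A by (auto simp: one_PSL2)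
  have "A$1$1 + A$2$2 = 0"
  proof (rule ccontr)
    assume tr: "A$1$1 + A$2$2 \<noteq> 0"
    have "A$1$2 * (A$1$1 + A$2$2) = 0" "A$2$1 * (A$1$1 + A$2$2) = 0"
      "(A$1$1 - A$2$2) * (A$1$1 + A$2$2) = 0"
      using sq by (auto simp: matrix2_eq_iff matrix2_mult_nth mat_def algebra_simps)
    then have *: "A$1$2 = 0" "A$2$1 = 0" "A$1$1 = A$2$2" using tr by auto
    then have "A$1$1 * A$1$1 = 1" using A(2) by (simp add: det_2)
    then have "A$1$1 = 1 \<or> A$1$1 = - 1" using square_eq_1_iff by blast
    then show False using ne * by (auto simp: matrix2_eq_iff mat_def)
  qed
  then show ?thesis using A that by blast
qed

text \<open>By Cayley-Hamilton the cube of \<open>A\<close> is \<open>(T\<^sup>2 - 1) A - T\<close>.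
  As it is scalar and \<open>A\<close> is not, \<open>T\<^sup>2 = 1\<close>; of the two lifts of
  \<open>t\<close> the one with trace 1 is taken.\<close>

lemma rotation_3_cases:
  assumes "rotation_of_order 3 t"
  obtains A where "t = psl A" "det A = 1" "A$1$1 + A$2$2 = 1"
proof -
  have t: "t \<in> carrier PSL2" "group.ord PSL2 t = 3" using assms by (auto simp: rotation_of_order_def)
  then obtain A where A: "t = psl A" "det A = 1" by (auto simp: carrier_PSL2)
  have "t [^]\<^bsub>PSL2\<^esub> (3::nat) = \<one>\<^bsub>PSL2\<^esub>"
    using group.pow_ord_eq_1[OF group_PSL2 t(1)] t(2) by simp
  then have "psl (A ** A ** A) = psl (mat 1)"
    using A t(1) group_PSL2
    by (simp add: numeral_3_eq_3 psl_mult one_PSL2 group.is_monoid monoid.nat_pow_Suc det_mul)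
  then have cube: "A ** A ** A = mat 1 \<or> A ** A ** A = - mat 1" by (simp add: psl_eq_iff)
  have "t \<noteq> \<one>\<^bsub>PSL2\<^esub>" using t group.ord_eq_1[OF group_PSL2 t(1)] by auto
  then have ne: "A \<noteq> mat 1" "A \<noteq> - mat 1" using A by (auto simp: one_PSL2)
  define T where "T = A$1$1 + A$2$2"
  have d: "A$1$1 * A$2$2 - A$1$2 * A$2$1 = 1" using A(2) by (simp add: det_2)
  have "T\<^sup>2 = 1"
  proof (rule ccontr)
    assume tr: "T\<^sup>2 \<noteq> 1"
    have sq: "(A ** A)$1$1 = T * A$1$1 - 1" "(A ** A)$1$2 = T * A$1$2"
      "(A ** A)$2$1 = T * A$2$1" "(A ** A)$2$2 = T * A$2$2 - 1"
      using d unfolding T_def matrix2_mult_nth by (simp_all add: algebra_simps)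
    have "(A ** A ** A)$1$2 = A$1$2 * (T\<^sup>2 - 1)" "(A ** A ** A)$2$1 = A$2$1 * (T\<^sup>2 - 1)"
      "(A ** A ** A)$1$1 - (A ** A ** A)$2$2 = (A$1$1 - A$2$2) * (T\<^sup>2 - 1)"
      unfolding matrix2_mult_nth[of "A ** A"] sq by (simp_all add: T_def power2_eq_square algebra_simps)
    then have "A$1$2 * (T\<^sup>2 - 1) = 0" "A$2$1 * (T\<^sup>2 - 1) = 0" "(A$1$1 - A$2$2) * (T\<^sup>2 - 1) = 0"
      using cube by (auto simp: mat_def)
    then have *: "A$1$2 = 0" "A$2$1 = 0" "A$1$1 = A$2$2" using tr by auto
    then have "A$1$1 * A$1$1 = 1" using A(2) by (simp add: det_2)
    then have "A$1$1 = 1 \<or> A$1$1 = - 1" using square_eq_1_iff by blast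
    then show False using ne * by (auto simp: matrix2_eq_iff mat_def)
  qed
  then have "T = 1 \<or> T = - 1" by (simp add: power2_eq_1_iff)
  then show ?thesis
  proof
    assume "T = 1" then show ?thesis using A that by (simp add: T_def)
  next
    assume "T = - 1" then show ?thesis using A that[of "- A"] by (simp add: T_def)
  qed
qed

section \<open>Conjugation into normal position\<close>

definition conjugators :: "real^2^2 \<Rightarrow> real^2^2 \<Rightarrow> bool" where
  "conjugators g h \<longleftrightarrow> det g = 1 \<and> det h = 1 \<and> g ** h = mat 1 \<and> h ** g = mat 1"

lemma conjugators_mult:
  assumes "conjugators g h" "conjugators g' h'"
  shows "conjugators (g' ** g) (h ** h')"
proof -
  have "g' ** g ** (h ** h') = g' ** (g ** h) ** h'" "h ** h' ** (g' ** g) = h ** (h' ** g') ** g"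
    by (simp_all add: matrix_mul_assoc)
  then show ?thesis using assms by (simp add: conjugators_def det_mul)
qed

lemma conjugate_order_2:
  assumes "det A = 1" "A$1$1 + A$2$2 = 0"
  obtains g h where "conjugators g h" "g ** A ** h = rotS \<or> g ** A ** h = - rotS"
proof -
  have main: "\<exists>g h. conjugators g h \<and> g ** A ** h = rotS"
    if A: "det A = 1" "A$1$1 + A$2$2 = 0" "A$2$1 > 0" for A
  proof -
    define a b c where "a = A$1$1" and "b = A$1$2" and "c = A$2$1"
    have A22: "A$2$2 = - a" using A by (simp add: a_def)
    have c: "c > 0" using A by (simp add: c_def)
    define r where "r = sqrt c"
    have r: "r > 0" "r * r = c" using c by (simp_all add: r_def)
    have b: "b = - (1 + a * a) / (r * r)"
      using A c unfolding r(2) by (simp add: det_2 A22 field_simps flip: a_def b_def c_def)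
    \<comment> \<open>\<open>g\<close> acts on the upper half-plane by
      \<open>z \<mapsto> c * z - a\<close>, which moves the fixed point \<open>(a + i) / c\<close>
      of \<open>A\<close> to \<open>i\<close>.\<close>
    define g h where "g = mat2 r (- a / r) 0 (1 / r)" and "h = mat2 (1 / r) (a / r) 0 r"
    have "conjugators g h"
      using r(1) by (simp add: conjugators_def g_def h_def det_2 matrix2_eq_iff matrix2_mult_nth mat_def)
    moreover have "g ** A ** h = rotS"
      using r(1) unfolding g_def h_def matrix2_eq_iff matrix2_mult_nth rotS_def A22
      by (simp flip: a_def b_def c_def) (simp add: b flip: r(2), simp add: field_simps)
    ultimately show ?thesis by blast
  qed
  have "A$2$1 \<noteq> 0"
  proof
    assume "A$2$1 = 0"
    moreover have "A$2$2 = - A$1$1" using assms(2) by linarith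
    ultimately have "- (A$1$1 * A$1$1) = 1" using assms(1) by (simp add: det_2)
    then show False using zero_le_square[of "A$1$1"] by linarith
  qed
  then consider "A$2$1 > 0" | "(- A)$2$1 > 0" by (auto simp: neq_iff)
  then show ?thesis
  proof cases
    case 1
    then show ?thesis using main assms that by blast
  next
    case 2
    have "(- A)$1$1 + (- A)$2$2 = 0" using assms(2) by simp
    then obtain g h where "conjugators g h" "g ** (- A) ** h = rotS" using main[of "- A"] assms 2 by auto
    moreover from this have "g ** A ** h = - rotS" by simp (metis minus_minus)
    ultimately show ?thesis using that by blast
  qed
qed

lemma ex_angle: "\<exists>\<theta>. u * sin (2 * \<theta>) = v * cos (2 * \<theta>)" for u v :: real
proof (cases "u = 0")
  case True
  then show ?thesis by (intro exI[of _ "pi/4"]) simp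
next
  case False
  then show ?thesis
    by (intro exI[of _ "arctan (v / u) / 2"]) (use tan_arctan[of "v / u"] cos_arctan_not_zero[of "v / u"] in \<open>auto simp: tan_def field_simps\<close>)
qed

text \<open>Rotations about \<open>i\<close> commute with \<open>rotS\<close>, and one of them moves
  the fixed point of \<open>B\<close> to the imaginary axis, which makes the diagonal entries equal.
  A fixed point below \<open>i\<close> is reflected above it by \<open>rotS\<close> itself, which
  maps \<open>i \<tau>\<close> to \<open>i / \<tau>\<close>.\<close>

lemma conjugate_order_3:
  assumes "det B = 1" "B$1$1 + B$2$2 = 1"
  obtains k k' \<tau> where "conjugators k k'" "k ** rotS ** k' = rotS" "\<tau> \<ge> 1"
    "k ** B ** k' = rotT \<tau> \<or> k ** B ** k' = rotT' \<tau>"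
proof -
  define p q r where "p = B$1$1 - 1/2" and "q = B$1$2" and "r = B$2$1"
  have B: "B$1$1 = 1/2 + p" "B$1$2 = q" "B$2$1 = r" "B$2$2 = 1/2 - p" using assms(2) by (simp_all add: p_def q_def r_def)
  \<comment> \<open>Conjugation by the rotation through \<open>\<theta>\<close> turns the trace-free
    symmetric part of \<open>B\<close>, with entries \<open>p\<close> and
    \<open>(q + r) / 2\<close>, through \<open>2 * \<theta>\<close>; this angle makes its diagonal
    vanish.\<close>
  obtain \<theta> where \<theta>: "(q + r) / 2 * sin (2 * \<theta>) = p * cos (2 * \<theta>)" using ex_angle by blast
  define k1 k1' where "k1 = mat2 (cos \<theta>) (- sin \<theta>) (sin \<theta>) (cos \<theta>)"
    and "k1' = mat2 (cos \<theta>) (sin \<theta>) (- sin \<theta>) (cos \<theta>)"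
  have cs: "cos \<theta> * cos \<theta> + sin \<theta> * sin \<theta> = 1"
    using sin_cos_squared_add[of \<theta>] by (simp add: power2_eq_square)
  have k1: "conjugators k1 k1'" "k1 ** rotS ** k1' = rotS"
    using cs sin_cos_squared_add3[of \<theta>] unfolding conjugators_def k1_def k1'_def
    by (simp_all add: det_2 matrix2_eq_iff matrix2_mult_nth mat_def rotS_def algebra_simps)
  define C where "C = k1 ** B ** k1'"
  have zero: "p * (cos \<theta> * cos \<theta> - sin \<theta> * sin \<theta>) = (q + r) * (sin \<theta> * cos \<theta>)"
    using \<theta>[unfolded cos_double sin_double] by (simp add: power2_eq_square field_simps)
  have "C$1$1 = 1/2 * (cos \<theta> * cos \<theta> + sin \<theta> * sin \<theta>)
      + (p * (cos \<theta> * cos \<theta> - sin \<theta> * sin \<theta>) - (q + r) * (sin \<theta> * cos \<theta>))"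
    "C$2$2 = 1/2 * (cos \<theta> * cos \<theta> + sin \<theta> * sin \<theta>)
      - (p * (cos \<theta> * cos \<theta> - sin \<theta> * sin \<theta>) - (q + r) * (sin \<theta> * cos \<theta>))"
    unfolding C_def k1_def k1'_def matrix2_mult_nth B by (simp_all add: algebra_simps)
  then have Cd: "C$1$1 = 1/2" "C$2$2 = 1/2" using zero cs by simp_all
  have "det C = 1" using k1(1) assms(1) by (simp add: C_def det_mul conjugators_def)
  then have Cqr: "C$1$2 * C$2$1 = - 3/4" using Cd by (simp add: det_2)
  have fin: "\<exists>\<tau>\<ge>1. D = rotT \<tau> \<or> D = rotT' \<tau>"
    if D: "D$1$1 = 1/2" "D$2$2 = 1/2" "D$1$2 * D$2$1 = - 3/4" "\<bar>D$1$2\<bar> \<ge> sqrt 3 / 2" for D :: "real^2^2"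
  proof -
    define \<tau> where "\<tau> = 2 * \<bar>D$1$2\<bar> / sqrt 3"
    have \<tau>: "\<tau> \<ge> 1" using D(4) by (simp add: \<tau>_def field_simps)
    have abs: "\<bar>D$1$2\<bar> = sqrt 3 * \<tau> / 2" by (simp add: \<tau>_def)
    have "D$1$2 \<noteq> 0" using D(3) by auto
    then have D21: "D$2$1 = - 3 / (4 * D$1$2)" using D(3) by (simp add: field_simps)
    have s3: "3 / (4 * (sqrt 3 * \<tau> / 2)) = sqrt 3 / (2 * \<tau>)"
    proof -
      have "3 = sqrt 3 * sqrt 3" by simp
      then have "3 / (4 * (sqrt 3 * \<tau> / 2)) = (sqrt 3 * sqrt 3) / (4 * (sqrt 3 * \<tau> / 2))" by simp
      also have "\<dots> = sqrt 3 / (2 * \<tau>)" using \<tau> by (simp add: field_simps)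
      finally show ?thesis .
    qed
    have "D = rotT \<tau> \<or> D = rotT' \<tau>"
    proof (cases "D$1$2 > 0")
      case True
      then have e: "D$1$2 = sqrt 3 * \<tau> / 2" using abs by simp
      have "D$2$1 = - (sqrt 3 / (2 * \<tau>))" unfolding D21 e using s3 by simp
      then have "D = rotT' \<tau>" using D e by (simp add: matrix2_eq_iff rotT'_def)
      then show ?thesis ..
    next
      case False
      then have e: "D$1$2 = - (sqrt 3 * \<tau> / 2)" using abs by simp
      have "D$2$1 = sqrt 3 / (2 * \<tau>)" unfolding D21 e using s3 by simp
      then have "D = rotT \<tau>" using D e by (simp add: matrix2_eq_iff rotT_def)
      then show ?thesis ..
    qed
    then show ?thesis using \<tau> by blast
  qed
  show ?thesis
  proof (cases "\<bar>C$1$2\<bar> \<ge> sqrt 3 / 2")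
    case True
    then show ?thesis using fin[OF Cd Cqr] that k1 unfolding C_def by blast
  next
    case False
    \<comment> \<open>Conjugation by \<open>rotS\<close> exchanges the off-diagonal entries up to
      sign. Their product has modulus 3/4, so one of them has modulus at least
      \<open>sqrt 3 / 2\<close>, that is, \<open>\<tau> \<ge> 1\<close> on one of the two
      sides.\<close>
    define D where "D = rotS ** C ** (- rotS)"
    have De: "D$1$1 = 1/2" "D$2$2 = 1/2" "D$1$2 = - C$2$1" "D$2$1 = - C$1$2"
      unfolding D_def by (simp_all add: matrix2_mult_nth rotS_def Cd)
    have "\<bar>C$2$1\<bar> \<ge> sqrt 3 / 2"
    proof (rule ccontr)
      assume n: "\<not> \<bar>C$2$1\<bar> \<ge> sqrt 3 / 2"
      have "\<bar>C$1$2\<bar> * \<bar>C$2$1\<bar> < (sqrt 3 / 2) * (sqrt 3 / 2)"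
        by (rule mult_strict_mono) (use False n in auto)
      then show False using arg_cong[OF Cqr, of abs] by (simp add: abs_mult)
    qed
    then obtain \<tau> where \<tau>: "\<tau> \<ge> 1" "D = rotT \<tau> \<or> D = rotT' \<tau>"
      using fin[of D] De Cqr by (auto simp: mult.commute)
    have cS: "conjugators rotS (- rotS)" by (simp add: conjugators_def det_rotS rotS_rotS)
    have D': "rotS ** k1 ** B ** (k1' ** (- rotS)) = D" by (simp add: D_def C_def matrix_mul_assoc)
    have S': "rotS ** k1 ** rotS ** (k1' ** (- rotS)) = rotS"
    proof -
      have "rotS ** k1 ** rotS ** (k1' ** (- rotS)) = rotS ** (k1 ** rotS ** k1') ** (- rotS)"
        by (simp add: matrix_mul_assoc)
      then show ?thesis unfolding k1(2) by (simp add: rotS_rotS)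
    qed
    show ?thesis using that[OF conjugators_mult[OF k1(1) cS] S' \<tau>(1)] \<tau>(2) unfolding D' by blast
  qed
qed

definition conj_psl :: "real^2^2 \<Rightarrow> real^2^2 \<Rightarrow> real^2^2 \<Rightarrow> (real^2^2) set" where
  "conj_psl g h M = psl (h ** M ** g)"

lemma conj_psl_uminus [simp]: "conj_psl g h (- M) = conj_psl g h M"
  by (simp add: conj_psl_def)

lemma conj_psl_mult:
  assumes "conjugators g h" "det M = 1" "det N = 1"
  shows "conj_psl g h (M ** N) = conj_psl g h M \<otimes>\<^bsub>PSL2\<^esub> conj_psl g h N"
proof -
  have "h ** M ** g ** (h ** N ** g) = h ** M ** (g ** h) ** N ** g" by (simp add: matrix_mul_assoc)
  also have "\<dots> = h ** (M ** N) ** g" using assms(1) by (simp add: conjugators_def matrix_mul_assoc)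
  finally show ?thesis
    using assms psl_mult[of "h ** M ** g" "h ** N ** g"] by (simp add: conj_psl_def det_mul conjugators_def)
qed

lemma conj_psl_one: "conjugators g h \<Longrightarrow> conj_psl g h (mat 1) = \<one>\<^bsub>PSL2\<^esub>"
  by (simp add: conj_psl_def one_PSL2 conjugators_def)

lemma conj_psl_in_carrier: "conjugators g h \<Longrightarrow> det M = 1 \<Longrightarrow> conj_psl g h M \<in> carrier PSL2"
  unfolding conj_psl_def carrier_PSL2 conjugators_def by (intro exI[of _ "h ** M ** g"]) (simp add: det_mul)

lemma conj_psl_conjugate:
  assumes "conjugators g h" shows "conj_psl g h (g ** A ** h) = psl A"
proof -
  have "h ** (g ** A ** h) ** g = (h ** g) ** A ** (h ** g)" by (simp add: matrix_mul_assoc)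
  then show ?thesis using assms by (simp add: conj_psl_def conjugators_def)
qed

lemma conj_psl_inv:
  assumes "conjugators g h" "det M = 1" "det N = 1" "M ** N = mat 1 \<or> M ** N = - mat 1"
  shows "inv\<^bsub>PSL2\<^esub> (conj_psl g h N) = conj_psl g h M"
  using assms conj_psl_mult[OF assms(1-3)] conj_psl_one[OF assms(1)] conj_psl_uminus[of g h "mat 1"]
  by (intro group.inv_equality[OF group_PSL2]) (auto simp: conj_psl_in_carrier simp del: conj_psl_uminus)

section \<open>Reduced words up to sign\<close>

definition normal_words :: "real \<Rightarrow> (real^2^2) set" where
  "normal_words \<tau> = {M. \<exists>a\<in>{mat 1, rotS}. \<exists>b\<in>{mat 1, rotT \<tau>, rotT' \<tau>}. \<exists>l.
     M = a ** word \<tau> l ** b \<or> M = - (a ** word \<tau> l ** b)}"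

lemma det_normal_words: "\<tau> \<noteq> 0 \<Longrightarrow> M \<in> normal_words \<tau> \<Longrightarrow> det M = 1"
  unfolding normal_words_def by (auto simp: det_mul det_rotS det_rotT det_word)

lemma rotT'_square: "\<tau> \<noteq> 0 \<Longrightarrow> rotT' \<tau> ** rotT' \<tau> = - rotT \<tau>"
  by (simp add: matrix2_eq_iff matrix2_mult_nth rotT_def rotT'_def field_simps)

lemma rotT_pm_square: "\<tau> \<noteq> 0 \<Longrightarrow> rotT_pm \<tau> e ** rotT_pm \<tau> e = - rotT_pm \<tau> (\<not> e)"
  by (simp add: rotT_pm_def rotT_square rotT'_square)

lemma rotT_pm_inverse: "\<tau> \<noteq> 0 \<Longrightarrow> rotT_pm \<tau> e ** rotT_pm \<tau> (\<not> e) = mat 1"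
  by (simp add: rotT_pm_def rotT_rotT')

lemma normal_words_uminus: "M \<in> normal_words \<tau> \<Longrightarrow> - M \<in> normal_words \<tau>"
  unfolding normal_words_def by fastforce

lemma normal_wordsI:
  "a \<in> {mat 1, rotS} \<Longrightarrow> b \<in> {mat 1, rotT \<tau>, rotT' \<tau>} \<Longrightarrow> a ** word \<tau> l ** b \<in> normal_words \<tau>"
  unfolding normal_words_def by blast

lemma normal_words_one: "mat 1 \<in> normal_words \<tau>"
  using normal_wordsI[of "mat 1" "mat 1" \<tau> "[]"] by simp

lemma rotS_normal_words: "M \<in> normal_words \<tau> \<Longrightarrow> rotS ** M \<in> normal_words \<tau>"
proof -
  have *: "rotS ** (a ** word \<tau> l ** b) \<in> normal_words \<tau>"
    if ab: "a \<in> {mat 1, rotS}" "b \<in> {mat 1, rotT \<tau>, rotT' \<tau>}" for a b l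
  proof (cases "a = rotS")
    case True
    have "rotS ** (rotS ** word \<tau> l ** b) = (rotS ** rotS) ** word \<tau> l ** b" by (simp add: matrix_mul_assoc)
    also have "\<dots> = - (mat 1 ** word \<tau> l ** b)" by (simp add: rotS_rotS)
    finally show ?thesis
      unfolding True using normal_words_uminus[OF normal_wordsI[OF _ ab(2), of "mat 1"]] by simp
  next
    case False
    then show ?thesis
      using normal_wordsI[OF _ ab(2), of rotS l] ab(1) by (simp add: matrix_mul_assoc)
  qed
  assume "M \<in> normal_words \<tau>"
  then obtain a b l where ab: "a \<in> {mat 1, rotS}" "b \<in> {mat 1, rotT \<tau>, rotT' \<tau>}"
    "M = a ** word \<tau> l ** b \<or> M = - (a ** word \<tau> l ** b)" unfolding normal_words_def by blast
  then show ?thesis using *[OF ab(1,2), of l] normal_words_uminus by auto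
qed

text \<open>A new rotation either precedes \<open>rotS\<close> and opens a block, or meets another
  rotation of order three, namely the end \<open>b\<close> or the first letter of the word. Two
  equal letters give the opposite one up to sign; two opposite ones cancel.\<close>

lemma rotT_pm_normal_words:
  assumes "\<tau> \<noteq> 0" "M \<in> normal_words \<tau>"
  shows "rotT_pm \<tau> e ** M \<in> normal_words \<tau>"
proof -
  have *: "rotT_pm \<tau> e ** (a ** word \<tau> l ** b) \<in> normal_words \<tau>"
    if ab: "a \<in> {mat 1, rotS}" "b \<in> {mat 1, rotT \<tau>, rotT' \<tau>}" for a b l
  proof (cases "a = rotS")
    case True
    then show ?thesis
      using normal_wordsI[OF _ ab(2), of "mat 1" "e # l"] by (simp add: matrix_mul_assoc)
  next
    case a: False
    show ?thesis
    proof (cases l)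
      case Nil
      have b: "rotT_pm \<tau> e' \<in> normal_words \<tau>" for e'
        using normal_wordsI[of "mat 1" "rotT_pm \<tau> e'" \<tau> "[]"] by (simp add: rotT_pm_def split: if_splits)
      consider "b = mat 1" | "b = rotT_pm \<tau> e" | "b = rotT_pm \<tau> (\<not> e)"
        using ab(2) by (cases e) (auto simp: rotT_pm_def)
      then have "rotT_pm \<tau> e ** b \<in> normal_words \<tau>"
        by cases (use b normal_words_uminus[OF b] normal_words_one assms(1)
            in \<open>auto simp: rotT_pm_square rotT_pm_inverse\<close>)
      then show ?thesis using a ab(1) Nil by simp
    next
      case (Cons e' l')
      have eq: "rotT_pm \<tau> e ** (a ** word \<tau> l ** b) = (rotT_pm \<tau> e ** rotT_pm \<tau> e') ** rotS ** word \<tau> l' ** b"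
        using a ab(1) Cons by (simp add: matrix_mul_assoc)
      show ?thesis
      proof (cases "e' = e")
        case True
        have "- (mat 1 ** word \<tau> ((\<not> e) # l') ** b) \<in> normal_words \<tau>"
          by (intro normal_words_uminus normal_wordsI ab(2)) simp
        then show ?thesis unfolding eq using True assms(1) by (simp add: rotT_pm_square)
      next
        case False
        then have "e' = (\<not> e)" by auto
        then show ?thesis
          unfolding eq using assms(1) normal_wordsI[OF _ ab(2), of rotS l'] by (simp add: rotT_pm_inverse)
      qed
    qed
  qed
  obtain a b l where ab: "a \<in> {mat 1, rotS}" "b \<in> {mat 1, rotT \<tau>, rotT' \<tau>}"
    "M = a ** word \<tau> l ** b \<or> M = - (a ** word \<tau> l ** b)"
    using assms(2) unfolding normal_words_def by blast
  then show ?thesis using *[OF ab(1,2), of l] normal_words_uminus by auto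
qed

text \<open>The induction proves that left multiplication by an element of the group preserves the
  set of normal words. Unlike mere membership, this passes through the product rule of
  \<open>generate\<close>; applied to the identity it gives the claim.\<close>

lemma generate_subset_normal_words:
  assumes gh: "conjugators g h" and \<tau>: "\<tau> \<noteq> 0"
    and t: "t = conj_psl g h (rotT \<tau>) \<or> t = conj_psl g h (rotT' \<tau>)"
  shows "generate PSL2 {conj_psl g h rotS, t} \<subseteq> conj_psl g h ` normal_words \<tau>"
proof -
  have closed: "conj_psl g h A \<otimes>\<^bsub>PSL2\<^esub> \<gamma> \<in> conj_psl g h ` normal_words \<tau>"
    if A: "A \<in> {rotS, rotT \<tau>, rotT' \<tau>}" and \<gamma>: "\<gamma> \<in> conj_psl g h ` normal_words \<tau>" for A \<gamma>
  proof -
    obtain M where M: "M \<in> normal_words \<tau>" "\<gamma> = conj_psl g h M" using \<gamma> by blast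
    have "A ** M \<in> normal_words \<tau>"
      using A rotS_normal_words[OF M(1)] rotT_pm_normal_words[OF \<tau> M(1), of True]
        rotT_pm_normal_words[OF \<tau> M(1), of False] by (auto simp: rotT_pm_def)
    moreover have "det A = 1" using A \<tau> by (auto simp: det_rotS det_rotT)
    ultimately show ?thesis
      unfolding M(2) using det_normal_words[OF \<tau> M(1)] conj_psl_mult[OF gh] by (metis image_eqI)
  qed
  have gen: "\<gamma> \<in> generate PSL2 {conj_psl g h rotS, t} \<Longrightarrow>
     \<gamma> \<in> carrier PSL2 \<and> (\<forall>\<delta>\<in>conj_psl g h ` normal_words \<tau>. \<gamma> \<otimes>\<^bsub>PSL2\<^esub> \<delta> \<in> conj_psl g h ` normal_words \<tau>)" for \<gamma>
  proof (induction rule: generate.induct)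
    case one
    have "\<delta> \<in> carrier PSL2" if "\<delta> \<in> conj_psl g h ` normal_words \<tau>" for \<delta>
      using that det_normal_words[OF \<tau>] conj_psl_in_carrier[OF gh] by auto
    then show ?case
      using group_PSL2 by (simp add: group.is_monoid monoid.l_one)
  next
    case (incl x)
    then obtain A where "A \<in> {rotS, rotT \<tau>, rotT' \<tau>}" "x = conj_psl g h A" using t by blast
    moreover from this have "det A = 1" using \<tau> by (auto simp: det_rotS det_rotT)
    ultimately show ?case using closed conj_psl_in_carrier[OF gh] by auto
  next
    case (inv x)
    have "inv\<^bsub>PSL2\<^esub> conj_psl g h rotS = conj_psl g h rotS"
      "inv\<^bsub>PSL2\<^esub> conj_psl g h (rotT \<tau>) = conj_psl g h (rotT' \<tau>)"
      "inv\<^bsub>PSL2\<^esub> conj_psl g h (rotT' \<tau>) = conj_psl g h (rotT \<tau>)"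
      using \<tau> by (intro conj_psl_inv[OF gh]; simp add: det_rotS det_rotT rotT_rotT' rotS_rotS)+
    then obtain A where "A \<in> {rotS, rotT \<tau>, rotT' \<tau>}" "inv\<^bsub>PSL2\<^esub> x = conj_psl g h A" using t inv by auto
    moreover from this have "det A = 1" using \<tau> by (auto simp: det_rotS det_rotT)
    ultimately show ?case using closed conj_psl_in_carrier[OF gh] by auto
  next
    case (eng x y)
    have "x \<otimes>\<^bsub>PSL2\<^esub> y \<otimes>\<^bsub>PSL2\<^esub> \<delta> = x \<otimes>\<^bsub>PSL2\<^esub> (y \<otimes>\<^bsub>PSL2\<^esub> \<delta>)" if "\<delta> \<in> conj_psl g h ` normal_words \<tau>" for \<delta>
      using that det_normal_words[OF \<tau>] conj_psl_in_carrier[OF gh] eng.IH group_PSL2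
      by (intro monoid.m_assoc) (auto simp: group.is_monoid)
    moreover have "x \<otimes>\<^bsub>PSL2\<^esub> y \<in> carrier PSL2"
      using eng.IH group_PSL2 by (simp add: group.is_monoid monoid.m_closed)
    ultimately show ?case using eng.IH by metis
  qed
  show ?thesis
  proof
    fix \<gamma> assume "\<gamma> \<in> generate PSL2 {conj_psl g h rotS, t}"
    note * = gen[OF this]
    have "\<one>\<^bsub>PSL2\<^esub> \<in> conj_psl g h ` normal_words \<tau>"
      using normal_words_one conj_psl_one[OF gh] by (metis image_eqI)
    then have "\<gamma> \<otimes>\<^bsub>PSL2\<^esub> \<one>\<^bsub>PSL2\<^esub> \<in> conj_psl g h ` normal_words \<tau>" using * by blast
    then show "\<gamma> \<in> conj_psl g h ` normal_words \<tau>" using * group_PSL2 by (simp add: group.is_monoid)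
  qed
qed

section \<open>Deformations in normal position\<close>

fun matpow :: "real^2^2 \<Rightarrow> nat \<Rightarrow> real^2^2" where
  "matpow A 0 = mat 1"
| "matpow A (Suc n) = A ** matpow A n"

lemma det_matpow: "det A = 1 \<Longrightarrow> det (matpow A n) = 1"
  by (induction n) (simp_all add: det_mul)

lemma matpow_add: "matpow A (m + n) = matpow A m ** matpow A n"
  by (induction m) (simp_all add: matrix_mul_assoc)

lemma free_product_alternating:
  assumes fp: "is_free_product G H K P"
    and "s \<in> H" "s \<noteq> \<one>\<^bsub>G\<^esub>" "t \<in> K" "t \<noteq> \<one>\<^bsub>G\<^esub>" "n > 0"
  shows "foldr (mult G) (concat (replicate n [s, t])) \<one>\<^bsub>G\<^esub> \<noteq> \<one>\<^bsub>G\<^esub>"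
proof -
  let ?P = "\<lambda>x y. x \<in> H \<and> y \<in> K \<or> x \<in> K \<and> y \<in> H"
  have succ: "successively ?P (concat (replicate n [s, t]))" for n
  proof (induction n)
    case (Suc n)
    then show ?case using assms by (cases n) auto
  qed simp
  have "set (concat (replicate n [s, t])) \<subseteq> (H \<union> K) - {\<one>\<^bsub>G\<^esub>}" using assms by auto
  moreover have "concat (replicate n [s, t]) \<noteq> []" using \<open>n > 0\<close> by (cases n) auto
  ultimately show ?thesis using fp succ unfolding is_free_product_def by blast
qed

text \<open>Freeness enters in the last conclusion: the product of the two rotations has infinite
  order, which later prevents it from being elliptic.\<close>

lemma deformation_normal_form:
  assumes "convex_cocompact_deformation_PSL2Z \<Gamma>"
  obtains g h \<tau> where "conjugators g h" "\<tau> \<ge> 1" "subgroup \<Gamma> PSL2"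
    "conj_psl g h rotS \<in> \<Gamma>" "conj_psl g h (rotT \<tau>) \<in> \<Gamma>" "\<Gamma> \<subseteq> conj_psl g h ` normal_words \<tau>"
    "\<And>n. n > 0 \<Longrightarrow> conj_psl g h (matpow (rotS ** rotT \<tau>) n) \<noteq> \<one>\<^bsub>PSL2\<^esub>"
proof -
  obtain s t where st: "rotation_of_order 2 s" "rotation_of_order 3 t" "\<Gamma> = generate PSL2 {s, t}"
    and free: "is_free_product PSL2 (generate PSL2 {s}) (generate PSL2 {t}) \<Gamma>"
    and cc: "convex_cocompact \<Gamma>"
    using assms unfolding convex_cocompact_deformation_PSL2Z_def by blast
  have sub: "subgroup \<Gamma> PSL2" using cc by (simp add: convex_cocompact_def discrete_subgroup_def)
  obtain A where A: "s = psl A" "det A = 1" "A$1$1 + A$2$2 = 0" using rotation_2_cases[OF st(1)] .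
  obtain B where B: "t = psl B" "det B = 1" "B$1$1 + B$2$2 = 1" using rotation_3_cases[OF st(2)] .
  obtain g1 h1 where gh1: "conjugators g1 h1" "g1 ** A ** h1 = rotS \<or> g1 ** A ** h1 = - rotS"
    using conjugate_order_2[OF A(2,3)] .
  define B1 where "B1 = g1 ** B ** h1"
  have "det B1 = 1" using gh1(1) B(2) by (simp add: B1_def det_mul conjugators_def)
  moreover have "B1$1$1 + B1$2$2 = 1"
  proof -
    have "B1$1$1 + B1$2$2 = B$1$1 * (h1 ** g1)$1$1 + B$1$2 * (h1 ** g1)$2$1
        + B$2$1 * (h1 ** g1)$1$2 + B$2$2 * (h1 ** g1)$2$2"
      unfolding B1_def matrix2_mult_nth by (simp add: algebra_simps)
    then show ?thesis using gh1(1) B(3) by (simp add: conjugators_def mat_def)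
  qed
  ultimately obtain k k' \<tau> where k: "conjugators k k'" "k ** rotS ** k' = rotS" "\<tau> \<ge> 1"
    "k ** B1 ** k' = rotT \<tau> \<or> k ** B1 ** k' = rotT' \<tau>"
    using conjugate_order_3 by blast
  define g h where "g = k ** g1" and "h = h1 ** k'"
  have gh: "conjugators g h" unfolding g_def h_def using conjugators_mult[OF gh1(1) k(1)] .
  have gc: "g ** C ** h = k ** (g1 ** C ** h1) ** k'" for C
    by (simp add: g_def h_def matrix_mul_assoc)
  have s: "conj_psl g h rotS = s"
  proof -
    have "g ** A ** h = rotS \<or> g ** A ** h = - rotS" using gh1(2) unfolding gc by (auto simp: k(2))
    then show ?thesis using conj_psl_conjugate[OF gh, of A] A(1) by (metis conj_psl_uminus)
  qed
  have t: "t = conj_psl g h (rotT \<tau>) \<or> t = conj_psl g h (rotT' \<tau>)"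
    using conj_psl_conjugate[OF gh, of B] k(4) unfolding gc B(1) B1_def by metis
  have \<tau>: "\<tau> \<noteq> 0" using k(3) by simp
  have tin: "conj_psl g h (rotT \<tau>) \<in> generate PSL2 {t}"
  proof (cases "t = conj_psl g h (rotT \<tau>)")
    case True then show ?thesis by (simp add: generate.incl)
  next
    case False
    then have "inv\<^bsub>PSL2\<^esub> t = conj_psl g h (rotT \<tau>)"
      using t \<tau> conj_psl_inv[OF gh, of "rotT \<tau>" "rotT' \<tau>"] by (simp add: det_rotT rotT_rotT')
    then show ?thesis using generate.inv[of t "{t}" PSL2] by simp
  qed
  have tin': "conj_psl g h (rotT \<tau>) \<in> \<Gamma>"
    using tin group.mono_generate[OF group_PSL2, of "{t}" "{s, t}"] unfolding st(3) by auto
  have sin: "conj_psl g h rotS \<in> generate PSL2 {s}" unfolding s by (simp add: generate.incl)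
  have sin': "conj_psl g h rotS \<in> \<Gamma>" unfolding s st(3) by (simp add: generate.incl)
  have gsub: "\<Gamma> \<subseteq> conj_psl g h ` normal_words \<tau>"
    unfolding st(3) s[symmetric] by (rule generate_subset_normal_words[OF gh \<tau> t])
  have ne: "conj_psl g h M \<noteq> \<one>\<^bsub>PSL2\<^esub>" if "M \<noteq> mat 1" "M \<noteq> - mat 1" for M
  proof
    assume "conj_psl g h M = \<one>\<^bsub>PSL2\<^esub>"
    then have "h ** M ** g = mat 1 \<or> h ** M ** g = - mat 1" by (simp add: conj_psl_def one_PSL2 psl_eq_iff)
    moreover have "g ** (h ** M ** g) ** h = (g ** h) ** M ** (g ** h)" by (simp add: matrix_mul_assoc)
    ultimately show False using that gh by (auto simp: conjugators_def)
  qed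
  have sne: "conj_psl g h rotS \<noteq> \<one>\<^bsub>PSL2\<^esub>" by (rule ne) (auto simp: matrix2_eq_iff rotS_def mat_def)
  have tne: "conj_psl g h (rotT \<tau>) \<noteq> \<one>\<^bsub>PSL2\<^esub>" by (rule ne) (auto simp: matrix2_eq_iff rotT_def mat_def)
  have fold: "foldr (mult PSL2) (concat (replicate n [conj_psl g h rotS, conj_psl g h (rotT \<tau>)])) \<one>\<^bsub>PSL2\<^esub>
      = conj_psl g h (matpow (rotS ** rotT \<tau>) n)" for n
  proof (induction n)
    case 0 then show ?case by (simp add: conj_psl_one[OF gh])
  next
    case (Suc n)
    have "det (matpow (rotS ** rotT \<tau>) n) = 1"
      using \<tau> by (intro det_matpow) (simp add: det_mul det_rotS det_rotT)
    then show ?case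
      using \<tau> Suc.IH conj_psl_mult[OF gh, of rotS "rotT \<tau> ** matpow (rotS ** rotT \<tau>) n"]
        conj_psl_mult[OF gh, of "rotT \<tau>" "matpow (rotS ** rotT \<tau>) n"]
      by (simp add: det_mul det_rotS det_rotT flip: matrix_mul_assoc)
  qed
  have "conj_psl g h (matpow (rotS ** rotT \<tau>) n) \<noteq> \<one>\<^bsub>PSL2\<^esub>" if "n > 0" for n
    using free_product_alternating[OF free sin sne tin tne that] unfolding fold .
  then show ?thesis using that[OF gh k(3) sub sin' tin' gsub] by blast
qed

section \<open>Discreteness and cocompactness\<close>

text \<open>The identity is open in the subgroup; an open set of the quotient that isolates it has
  an open preimage in \<open>SL2\<close>, which contains a ball around the identity matrix.\<close>

lemma discrete_subgroup_isolated:
  assumes "discrete_subgroup \<Gamma>"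
  obtains \<epsilon> where "\<epsilon> > 0"
    "\<And>A. det A = 1 \<Longrightarrow> psl A \<in> \<Gamma> \<Longrightarrow> dist A (mat 1) < \<epsilon> \<Longrightarrow> psl A = \<one>\<^bsub>PSL2\<^esub>"
proof -
  have sub: "subgroup \<Gamma> PSL2" and disc: "subtopology PSL2_topology \<Gamma> = discrete_topology \<Gamma>"
    using assms by (auto simp: discrete_subgroup_def)
  have one: "\<one>\<^bsub>PSL2\<^esub> \<in> \<Gamma>" using sub by (rule subgroup.one_closed)
  then have "openin (subtopology PSL2_topology \<Gamma>) {\<one>\<^bsub>PSL2\<^esub>}" unfolding disc by simp
  then obtain U where U: "openin PSL2_topology U" "{\<one>\<^bsub>PSL2\<^esub>} = U \<inter> \<Gamma>" by (auto simp: openin_subtopology)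
  have "openin (top_of_set (carrier SL2)) {A \<in> carrier SL2. psl A \<in> U}"
    using U(1) unfolding PSL2_topology_def openin_quotient_topology by (simp add: r_coset_center)
  moreover have "mat 1 \<in> {A \<in> carrier SL2. psl A \<in> U}"
    using U(2) by (auto simp: carrier_SL2 one_PSL2)
  ultimately obtain \<epsilon> where "\<epsilon> > 0" "ball (mat 1) \<epsilon> \<inter> carrier SL2 \<subseteq> {A \<in> carrier SL2. psl A \<in> U}"
    unfolding openin_contains_ball by blast
  note \<epsilon> = this
  show ?thesis
  proof (rule that[OF \<epsilon>(1)])
    fix A assume A: "det A = 1" "psl A \<in> \<Gamma>" "dist A (mat 1) < \<epsilon>"
    then have "A \<in> ball (mat 1) \<epsilon> \<inter> carrier SL2" by (simp add: carrier_SL2 dist_commute)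
    then have "psl A \<in> U" using \<epsilon>(2) by blast
    then show "psl A = \<one>\<^bsub>PSL2\<^esub>" using A(2) U(2) by blast
  qed
qed

section \<open>Powers of elliptic matrices\<close>

lemma tendsto_matrix2:
  fixes f :: "'a \<Rightarrow> real^2^2"
  assumes "((\<lambda>x. f x $1$1) \<longlongrightarrow> L$1$1) F" "((\<lambda>x. f x $1$2) \<longlongrightarrow> L$1$2) F"
    "((\<lambda>x. f x $2$1) \<longlongrightarrow> L$2$1) F" "((\<lambda>x. f x $2$2) \<longlongrightarrow> L$2$2) F"
  shows "(f \<longlongrightarrow> L) F"
proof (intro vec_tendstoI)
  fix i j :: 2
  show "((\<lambda>x. f x $ i $ j) \<longlongrightarrow> L $ i $ j) F"
    using exhaust_2[of i] exhaust_2[of j] assms by auto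
qed

lemma tendsto_matrix2_mult:
  fixes A B :: "'a \<Rightarrow> real^2^2"
  assumes "(A \<longlongrightarrow> a) F" "(B \<longlongrightarrow> b) F"
  shows "((\<lambda>x. A x ** B x) \<longlongrightarrow> a ** b) F"
proof -
  have "((\<lambda>x. (A x ** B x)$i$j) \<longlongrightarrow> (a ** b)$i$j) F" for i j
    unfolding matrix2_mult_nth by (intro tendsto_add tendsto_mult tendsto_vec_nth assms)
  then show ?thesis by (intro vec_tendstoI)
qed

text \<open>Cayley-Hamilton gives the powers the recursion of the Chebyshev polynomials of the
  second kind. The bounded sines on the right show that the powers of an elliptic matrix stay
  bounded.\<close>

lemma matpow_elliptic:
  assumes "det M = 1" "M$1$1 + M$2$2 = 2 * cos \<theta>"
  shows "sin \<theta> *\<^sub>R matpow M (Suc n) = sin (real (Suc n) * \<theta>) *\<^sub>R M - sin (real n * \<theta>) *\<^sub>R mat 1"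
proof (induction n)
  case (Suc n)
  define a b where "a = sin (real (Suc n) * \<theta>)" and "b = sin (real n * \<theta>)"
  have rec: "sin (real (Suc (Suc n)) * \<theta>) = 2 * cos \<theta> * a - b"
  proof -
    have "sin (real (Suc (Suc n)) * \<theta>) = sin (real (Suc n) * \<theta> + \<theta>)"
      "b = sin (real (Suc n) * \<theta> - \<theta>)" unfolding b_def by (simp_all add: algebra_simps)
    then show ?thesis unfolding a_def sin_add sin_diff by simp
  qed
  have sq: "M ** M = (2 * cos \<theta>) *\<^sub>R M - mat 1"
    using assms(1) unfolding assms(2)[symmetric] det_2
    by (simp add: matrix2_eq_iff matrix2_mult_nth mat_def algebra_simps)
  have "sin \<theta> *\<^sub>R matpow M (Suc (Suc n)) = M ** (sin \<theta> *\<^sub>R matpow M (Suc n))"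
    by (simp add: matrix2_eq_iff matrix2_mult_nth algebra_simps)
  also have "\<dots> = M ** (a *\<^sub>R M - b *\<^sub>R mat 1)" using Suc.IH by (simp add: a_def b_def)
  also have "\<dots> = a *\<^sub>R (M ** M) - b *\<^sub>R M"
    by (simp add: matrix2_eq_iff matrix2_mult_nth mat_def algebra_simps)
  also have "\<dots> = (2 * cos \<theta> * a - b) *\<^sub>R M - a *\<^sub>R mat 1"
    unfolding sq by (simp add: algebra_simps)
  finally show ?case unfolding rec a_def by simp
qed simp

text \<open>Bounded powers have a convergent subsequence, and the quotient of two consecutive terms
  is again a positive power, which tends to the identity. Rational and irrational angles are treated
  alike.\<close>

lemma elliptic_power_near_one:
  assumes M: "det M = 1" "\<bar>M$1$1 + M$2$2\<bar> < 2" and gh: "conjugators g h" and "\<epsilon> > 0"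
  shows "\<exists>n>0. dist (h ** matpow M n ** g) (mat 1) < \<epsilon>"
proof -
  define \<theta> where "\<theta> = arccos ((M$1$1 + M$2$2) / 2)"
  have c: "cos \<theta> = (M$1$1 + M$2$2) / 2" using M(2) by (simp add: \<theta>_def cos_arccos_abs)
  have "(cos \<theta>)\<^sup>2 < 1" unfolding c using M(2) by (simp add: abs_square_less_1)
  then have "(sin \<theta>)\<^sup>2 > 0" by (simp add: sin_squared_eq)
  then have s: "sin \<theta> \<noteq> 0" by auto
  have bd: "norm (matpow M (Suc n)) \<le> (norm M + norm (mat 1 :: real^2^2)) / \<bar>sin \<theta>\<bar>" for n
  proof -
    have eq: "sin \<theta> *\<^sub>R matpow M (Suc n) = sin (real (Suc n) * \<theta>) *\<^sub>R M - sin (real n * \<theta>) *\<^sub>R mat 1"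
      by (rule matpow_elliptic) (use M c in auto)
    have "\<bar>sin \<theta>\<bar> * norm (matpow M (Suc n)) = norm (sin \<theta> *\<^sub>R matpow M (Suc n))" by simp
    also have "\<dots> \<le> norm (sin (real (Suc n) * \<theta>) *\<^sub>R M) + norm (sin (real n * \<theta>) *\<^sub>R (mat 1 :: real^2^2))"
      unfolding eq by (rule norm_triangle_ineq4)
    also have "\<dots> \<le> 1 * norm M + 1 * norm (mat 1 :: real^2^2)"
      unfolding norm_scaleR by (intro add_mono mult_right_mono) auto
    finally show ?thesis using s by (simp add: field_simps)
  qed
  then have "bounded (range (\<lambda>n. matpow M (Suc n)))" by (auto simp: bounded_iff)
  from bounded_imp_convergent_subsequence[OF this] obtain L r
    where r: "strict_mono r" and L: "((\<lambda>n. matpow M (Suc n)) \<circ> r) \<longlonglongrightarrow> L" by blast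
  define P where "P k = matpow M (Suc (r k))" for k
  have P: "P \<longlonglongrightarrow> L" using L unfolding P_def comp_def .
  have P1: "(\<lambda>k. P (Suc k)) \<longlonglongrightarrow> L" using P by (rule LIMSEQ_Suc)
  have Pe: "(\<lambda>k. P k $ i $ j) \<longlonglongrightarrow> L $ i $ j" "(\<lambda>k. P (Suc k) $ i $ j) \<longlonglongrightarrow> L $ i $ j" for i j
    by (intro tendsto_vec_nth P P1)+
  have detP: "det (P k) = 1" for k unfolding P_def using M(1) by (rule det_matpow)
  have "(\<lambda>k. det (P k)) \<longlonglongrightarrow> det L" unfolding det_2 by (intro tendsto_intros Pe)
  then have detL: "det L = 1" using detP LIMSEQ_const_iff[of 1 "det L"] by simp
  \<comment> \<open>The adjugate inverts matrices of determinant one and is linear in the entries,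
    so it passes to the limit.\<close>
  define adj where "adj A = mat2 (A$2$2) (- A$1$2) (- A$2$1) (A$1$1)" for A :: "real^2^2"
  have adj: "A ** adj A = mat 1" if "det A = 1" for A
    using that by (simp add: adj_def matrix2_eq_iff matrix2_mult_nth mat_def det_2 algebra_simps)
  define d where "d k = r (Suc k) - r k" for k
  have d: "d k > 0" for k using strict_monoD[OF r, of k "Suc k"] by (simp add: d_def)
  have Md: "matpow M (d k) = P (Suc k) ** adj (P k)" for k
  proof -
    have "Suc (r (Suc k)) = d k + Suc (r k)" using strict_monoD[OF r, of k "Suc k"] by (simp add: d_def)
    then have "P (Suc k) = matpow M (d k) ** P k" unfolding P_def by (metis matpow_add)
    then show ?thesis using adj[OF detP, of k] by (simp flip: matrix_mul_assoc)
  qed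
  have "(\<lambda>k. adj (P k)) \<longlonglongrightarrow> adj L"
    by (rule tendsto_matrix2) (simp_all add: adj_def Pe tendsto_minus)
  then have "(\<lambda>k. h ** matpow M (d k) ** g) \<longlonglongrightarrow> h ** (L ** adj L) ** g"
    unfolding Md by (intro tendsto_matrix2_mult tendsto_const P1)
  moreover have "h ** (L ** adj L) ** g = mat 1" using adj[OF detL] gh by (simp add: conjugators_def)
  ultimately have "\<forall>\<^sub>F k in sequentially. dist (h ** matpow M (d k) ** g) (mat 1) < \<epsilon>"
    using \<open>\<epsilon> > 0\<close> by (simp add: tendsto_iff)
  then obtain k where "dist (h ** matpow M (d k) ** g) (mat 1) < \<epsilon>"
    using eventually_happens' sequentially_bot by blast
  then show ?thesis using d by blast
qed

lemma conj_psl_matpow_in: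
  assumes "conjugators g h" "subgroup \<Gamma> PSL2" "det M = 1" "conj_psl g h M \<in> \<Gamma>"
  shows "conj_psl g h (matpow M n) \<in> \<Gamma>"
proof (induction n)
  case 0
  then show ?case using assms by (simp add: conj_psl_one subgroup.one_closed)
next
  case (Suc n)
  then show ?case using assms by (simp add: conj_psl_mult det_matpow subgroup.m_closed)
qed

lemma no_elliptic_of_infinite_order:
  assumes "discrete_subgroup \<Gamma>" "conjugators g h" "det M = 1" "conj_psl g h M \<in> \<Gamma>"
    and "\<And>n. n > 0 \<Longrightarrow> conj_psl g h (matpow M n) \<noteq> \<one>\<^bsub>PSL2\<^esub>"
  shows "\<bar>M$1$1 + M$2$2\<bar> \<ge> 2"
proof (rule ccontr)
  assume "\<not> ?thesis"
  then have tr: "\<bar>M$1$1 + M$2$2\<bar> < 2" by simp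
  obtain \<epsilon> where \<epsilon>: "\<epsilon> > 0"
    "\<And>A. det A = 1 \<Longrightarrow> psl A \<in> \<Gamma> \<Longrightarrow> dist A (mat 1) < \<epsilon> \<Longrightarrow> psl A = \<one>\<^bsub>PSL2\<^esub>"
    using discrete_subgroup_isolated[OF assms(1)] by blast
  obtain n where n: "n > 0" "dist (h ** matpow M n ** g) (mat 1) < \<epsilon>"
    using elliptic_power_near_one[OF assms(3) tr assms(2) \<epsilon>(1)] by blast
  have "subgroup \<Gamma> PSL2" using assms(1) by (simp add: discrete_subgroup_def)
  then have "psl (h ** matpow M n ** g) \<in> \<Gamma>"
    using conj_psl_matpow_in[OF assms(2) _ assms(3,4)] by (simp add: conj_psl_def)
  moreover have "det (h ** matpow M n ** g) = 1"
    using assms(2,3) by (simp add: det_mul det_matpow conjugators_def)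
  ultimately have "conj_psl g h (matpow M n) = \<one>\<^bsub>PSL2\<^esub>" using \<epsilon>(2) n(2) by (simp add: conj_psl_def)
  then show False using assms(5) n(1) by blast
qed

section \<open>The action on the disc model, horoballs and compactness\<close>

lemma trace_2: "trace A = A$1$1 + A$2$2" for A :: "real^2^2"
  by (simp add: trace_def sum_2)

lemma det_scaleR_2: "det (c *\<^sub>R A) = c\<^sup>2 * det A" for A :: "real^2^2"
  by (simp add: det_2 power2_eq_square algebra_simps)

lemma H2_D:
  assumes "X \<in> H2"
  shows "X$2$1 = X$1$2" "X$1$1 + X$2$2 = 1" "X$1$1 > 0" "X$2$2 > 0" "X$1$1 * X$2$2 - X$1$2 * X$1$2 > 0"
proof -
  have X: "transpose X = X" "trace X = 1" "det X > 0" using assms by (auto simp: H2_def)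
  have "transpose X $1$2 = X$1$2" by (simp only: X(1))
  then show s: "X$2$1 = X$1$2" by (simp add: transpose_def)
  show t: "X$1$1 + X$2$2 = 1" using X(2) by (simp add: trace_2)
  show d: "X$1$1 * X$2$2 - X$1$2 * X$1$2 > 0" using X(3) s by (simp add: det_2)
  have "X$1$1 * X$2$2 > 0" using d zero_le_square[of "X$1$2"] by linarith
  then show "X$1$1 > 0" "X$2$2 > 0" using t by (auto simp: zero_less_mult_iff)
qed

lemma H2_I:
  "X$2$1 = X$1$2 \<Longrightarrow> X$1$1 + X$2$2 = 1 \<Longrightarrow> X$1$1 * X$2$2 - X$1$2 * X$1$2 > 0 \<Longrightarrow> X \<in> H2"
  by (simp add: H2_def trace_2 det_2 matrix2_eq_iff transpose_def)

text \<open>The quadratic form of the adjugate of \<open>X\<close>. For \<open>X\<close> in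
  \<open>H2\<close> the quotient \<open>disc_form X l / sqrt (det X)\<close> does not change when
  \<open>X\<close> is rescaled or when \<open>SL2\<close> acts on \<open>X\<close> and
  \<open>l\<close> together; its sublevel sets are the horoballs at the ideal point of
  \<open>l\<close>.\<close>

definition disc_form :: "real^2^2 \<Rightarrow> real^2 \<Rightarrow> real" where
  "disc_form X l = X$2$2 * (l$1)\<^sup>2 - 2 * X$1$2 * l$1 * l$2 + X$1$1 * (l$2)\<^sup>2"

lemma trace_action_pos:
  assumes "X \<in> H2" "det A = 1"
  shows "trace (A ** X ** transpose A) > 0"
proof -
  note X = H2_D[OF assms(1)]
  have q: "X$1$1 * a\<^sup>2 + 2 * X$1$2 * a * b + X$2$2 * b\<^sup>2 > 0" if "a \<noteq> 0 \<or> b \<noteq> 0" for a b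
  proof -
    have "X$1$1 * (X$1$1 * a\<^sup>2 + 2 * X$1$2 * a * b + X$2$2 * b\<^sup>2)
        = (X$1$1 * a + X$1$2 * b)\<^sup>2 + (X$1$1 * X$2$2 - X$1$2 * X$1$2) * b\<^sup>2"
      by (simp add: power2_eq_square algebra_simps)
    also have "\<dots> > 0"
    proof (cases "b = 0")
      case True then show ?thesis using that X by simp
    next
      case False then show ?thesis using X by (intro add_nonneg_pos mult_pos_pos) auto
    qed
    finally show ?thesis using X by (simp add: zero_less_mult_iff)
  qed
  have "A$1$1 \<noteq> 0 \<or> A$1$2 \<noteq> 0" "A$2$1 \<noteq> 0 \<or> A$2$2 \<noteq> 0" using assms(2) by (auto simp: det_2)
  from q[OF this(1)] q[OF this(2)] show ?thesis
    by (simp add: trace_2 matrix2_mult_nth transpose_def X(1) power2_eq_square algebra_simps)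
qed

lemma SL2_act_scale:
  assumes "X \<in> H2" "det A = 1"
  obtains c where "c > 0" "SL2_act A X = c *\<^sub>R (A ** X ** transpose A)"
  using trace_action_pos[OF assms] by (intro that[of "1 / trace (A ** X ** transpose A)"]) (auto simp: SL2_act_def)

lemma SL2_act_H2:
  assumes "X \<in> H2" "det A = 1"
  shows "SL2_act A X \<in> H2"
proof -
  let ?Y = "A ** X ** transpose A"
  have s: "?Y$2$1 = ?Y$1$2"
    using H2_D(1)[OF assms(1)] by (simp add: matrix2_mult_nth transpose_def algebra_simps)
  have d: "det ?Y > 0" using assms by (simp add: det_mul det_transpose H2_def)
  have t: "trace ?Y > 0" using trace_action_pos[OF assms] .
  have "transpose (SL2_act A X) = SL2_act A X"
    using s by (simp add: SL2_act_def matrix2_eq_iff transpose_def)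
  moreover have "trace (SL2_act A X) = 1" using t by (simp add: SL2_act_def trace_2 add_divide_distrib[symmetric])
  moreover have "det (SL2_act A X) > 0" using t d by (simp add: SL2_act_def det_scaleR_2)
  ultimately show ?thesis by (simp add: H2_def)
qed

lemma disc_form_action:
  assumes "X \<in> H2" "det A = 1"
  shows "disc_form (A ** X ** transpose A) (A *v l) = disc_form X l"
proof -
  have "disc_form (A ** X ** transpose A) (A *v l) = (det A)\<^sup>2 * disc_form X l"
    unfolding disc_form_def det_2 matrix2_mult_nth transpose_def matrix_vector_mult_def sum_2 H2_D(1)[OF assms(1)]
    by (simp add: H2_D(1)[OF assms(1)] power2_eq_square algebra_simps)
  then show ?thesis by (simp add: assms)
qed

text \<open>A point whose determinant is bounded below cannot be deep in the horoball of a long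
  vector. Each bound comes from completing the square, as the diagonal entries of \<open>Y\<close>
  lie between 0 and 1.\<close>

lemma disc_form_ge:
  assumes "Y \<in> H2"
  shows "disc_form Y l \<ge> det Y * (l$i)\<^sup>2"
proof -
  note Y = H2_D[OF assms]
  have d: "det Y = Y$1$1 * Y$2$2 - Y$1$2 * Y$1$2" using Y(1) by (simp add: det_2)
  have "Y$1$1 * disc_form Y l = (Y$1$1 * l$2 - Y$1$2 * l$1)\<^sup>2 + det Y * (l$1)\<^sup>2"
    unfolding disc_form_def d by (simp add: power2_eq_square algebra_simps)
  then have 1: "det Y * (l$1)\<^sup>2 \<le> Y$1$1 * disc_form Y l" by simp
  have "Y$2$2 * disc_form Y l = (Y$2$2 * l$1 - Y$1$2 * l$2)\<^sup>2 + det Y * (l$2)\<^sup>2"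
    unfolding disc_form_def d by (simp add: power2_eq_square algebra_simps)
  then have 2: "det Y * (l$2)\<^sup>2 \<le> Y$2$2 * disc_form Y l" by simp
  have "0 \<le> det Y * (l$1)\<^sup>2" using Y(5) d by simp
  then have nn: "0 \<le> disc_form Y l" using 1 Y(3) by (meson order_trans zero_le_mult_iff not_less)
  have "Y$1$1 * disc_form Y l \<le> disc_form Y l" "Y$2$2 * disc_form Y l \<le> disc_form Y l"
    using Y nn by (simp_all add: mult_left_le_one_le)
  then have "det Y * (l$1)\<^sup>2 \<le> disc_form Y l" "det Y * (l$2)\<^sup>2 \<le> disc_form Y l" using 1 2 by linarith+
  then show ?thesis using exhaust_2[of i] by auto
qed

lemma det_H2_le: "Y \<in> H2 \<Longrightarrow> det Y \<le> 1/4"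
proof -
  assume "Y \<in> H2"
  note Y = H2_D[OF this]
  have Y22: "Y$2$2 = 1 - Y$1$1" using Y(2) by simp
  have "1/4 - det Y = (Y$1$1 - 1/2)\<^sup>2 + (Y$1$2)\<^sup>2"
    unfolding det_2 Y(1) Y22 by (simp add: power2_eq_square field_simps)
  then show ?thesis by (smt (verit) zero_le_power2)
qed

text \<open>The sets \<open>U n\<close> are saturated and exhaust the hull, so that compactness of the quotient bounds
  the orbits away from the ideal boundary.\<close>

lemma convex_cocompact_bound:
  assumes "convex_cocompact \<Gamma>"
  obtains \<delta> where "\<delta> > 0"
    "\<And>X. X \<in> limit_hull \<Gamma> \<Longrightarrow> \<exists>A. det A = 1 \<and> psl A \<in> \<Gamma> \<and> det (SL2_act A X) > \<delta>"
proof -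
  let ?H = "limit_hull \<Gamma>" and ?Q = "quotient_topology (top_of_set (limit_hull \<Gamma>)) (orbit_of \<Gamma>)"
  have sub: "subgroup \<Gamma> PSL2" and comp: "compact_space ?Q"
    using assms by (auto simp: convex_cocompact_def discrete_subgroup_def)
  have HH: "?H \<subseteq> H2" by (simp add: limit_hull_def)
  define U where "U n = {X \<in> ?H. \<exists>Z\<in>orbit_of \<Gamma> X. det Z > 1 / real (Suc n)}" for n
  have openU: "openin (top_of_set ?H) (U n)" for n
  proof -
    have eq: "U n = (\<Union>A\<in>{A. det A = 1 \<and> psl A \<in> \<Gamma>}. {X \<in> ?H. 1 / real (Suc n) < det (SL2_act A X)})"
    proof -
      have 1: "\<exists>A. det A = 1 \<and> \<gamma> = psl A" if "\<gamma> \<in> \<Gamma>" for \<gamma>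
        using that subgroup.subset[OF sub] carrier_PSL2 by blast
      have "(\<exists>Z\<in>orbit_of \<Gamma> X. det Z > d) \<longleftrightarrow> (\<exists>A. det A = 1 \<and> psl A \<in> \<Gamma> \<and> d < det (SL2_act A X))" for X d
      proof
        assume "\<exists>Z\<in>orbit_of \<Gamma> X. det Z > d"
        then obtain \<gamma> where "\<gamma> \<in> \<Gamma>" "det (PSL2_act \<gamma> X) > d" by (auto simp: orbit_of_def)
        with 1[OF this(1)] show "\<exists>A. det A = 1 \<and> psl A \<in> \<Gamma> \<and> d < det (SL2_act A X)"
          by (metis PSL2_act_psl)
      next
        assume "\<exists>A. det A = 1 \<and> psl A \<in> \<Gamma> \<and> d < det (SL2_act A X)"
        then show "\<exists>Z\<in>orbit_of \<Gamma> X. det Z > d" unfolding orbit_of_def by (metis PSL2_act_psl image_eqI)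
      qed
      then show ?thesis unfolding U_def by blast
    qed
    have "openin (top_of_set ?H) {X \<in> ?H. 1 / real (Suc n) < det (SL2_act A X)}" if "det A = 1" for A
    proof -
      have "continuous_on ?H (\<lambda>X. det X / (trace (A ** X ** transpose A))\<^sup>2)"
        unfolding det_2 trace_2 matrix2_mult_nth
      proof (intro continuous_intros)
        show "\<forall>X\<in>?H. ((A$1$1 * X$1$1 + A$1$2 * X$2$1) * transpose A$1$1
          + (A$1$1 * X$1$2 + A$1$2 * X$2$2) * transpose A$2$1
          + ((A$2$1 * X$1$1 + A$2$2 * X$2$1) * transpose A$1$2
          + (A$2$1 * X$1$2 + A$2$2 * X$2$2) * transpose A$2$2))\<^sup>2 \<noteq> 0"
          using trace_action_pos[OF _ that] HH by (fastforce simp: trace_2 matrix2_mult_nth)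
      qed
      moreover have "det (SL2_act A X) = det X / (trace (A ** X ** transpose A))\<^sup>2" for X
        using that by (simp add: SL2_act_def det_scaleR_2 det_mul det_transpose power_divide)
      ultimately have "continuous_on ?H (\<lambda>X. det (SL2_act A X))" by simp
      then have "openin (top_of_set ?H) (?H \<inter> (\<lambda>X. det (SL2_act A X)) -` {1 / real (Suc n)<..})"
        by (rule continuous_openin_preimage_gen) simp
      moreover have "?H \<inter> (\<lambda>X. det (SL2_act A X)) -` {1 / real (Suc n)<..}
          = {X \<in> ?H. 1 / real (Suc n) < det (SL2_act A X)}" by auto
      ultimately show ?thesis by simp
    qed
    then show ?thesis unfolding eq by auto
  qed
  define V where "V n = orbit_of \<Gamma> ` U n" for n
  have openV: "openin ?Q (V n)" for n
  proof -
    have "{X \<in> ?H. orbit_of \<Gamma> X \<in> V n} = U n" unfolding V_def U_def by auto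
    then show ?thesis unfolding openin_quotient_topology using openU by (auto simp: V_def U_def)
  qed
  have cover: "?H \<subseteq> (\<Union>n. U n)"
  proof
    fix X assume X: "X \<in> ?H"
    then have X2: "X \<in> H2" using HH by blast
    have "psl (mat 1) \<in> \<Gamma>" using subgroup.one_closed[OF sub] by (simp add: one_PSL2)
    moreover have "SL2_act (mat 1) X = X"
      using X2 by (simp add: SL2_act_def H2_def transpose_mat)
    ultimately have "X \<in> orbit_of \<Gamma> X" unfolding orbit_of_def by (metis PSL2_act_psl image_eqI)
    moreover obtain n where "1 / real (Suc n) < det X"
      using X2 reals_Archimedean[of "det X"] by (auto simp: H2_def inverse_eq_divide)
    ultimately show "X \<in> (\<Union>n. U n)" using X by (auto simp: U_def)
  qed
  have top: "topspace ?Q = orbit_of \<Gamma> ` ?H"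
  proof
    show "topspace ?Q \<subseteq> orbit_of \<Gamma> ` ?H"
      using openin_topspace[of ?Q] unfolding openin_quotient_topology by simp
    have "V n \<subseteq> topspace ?Q" for n using openV by (rule openin_subset)
    then show "orbit_of \<Gamma> ` ?H \<subseteq> topspace ?Q" using cover unfolding V_def by blast
  qed
  have "topspace ?Q \<subseteq> \<Union>(range V)" unfolding top V_def using cover by blast
  then obtain F where F: "finite F" "F \<subseteq> range V" "topspace ?Q \<subseteq> \<Union>F"
    using comp openV unfolding compact_space_def compactin_def by (metis (no_types, lifting) imageE)
  obtain I where I: "finite I" "F = V ` I" using finite_subset_image[OF F(1,2)] by blast
  define N where "N = Max (insert 0 I)"
  have "\<exists>A. det A = 1 \<and> psl A \<in> \<Gamma> \<and> det (SL2_act A X) > 1 / real (Suc N)" if X: "X \<in> ?H" for X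
  proof -
    have "orbit_of \<Gamma> X \<in> \<Union>F" using F(3) X unfolding top by blast
    then obtain i where i: "i \<in> I" "orbit_of \<Gamma> X \<in> V i" unfolding I(2) by blast
    then obtain Z where Z: "Z \<in> orbit_of \<Gamma> X" "det Z > 1 / real (Suc i)" by (auto simp: V_def U_def)
    have "i \<le> N" using i(1) I(1) by (simp add: N_def)
    then have "1 / real (Suc N) \<le> 1 / real (Suc i)" by (intro divide_left_mono) auto
    then have "det Z > 1 / real (Suc N)" using Z(2) by linarith
    moreover obtain \<gamma> where "\<gamma> \<in> \<Gamma>" "Z = PSL2_act \<gamma> X" using Z(1) by (auto simp: orbit_of_def)
    moreover from this obtain A where "det A = 1" "\<gamma> = psl A"
      using subgroup.subset[OF sub] carrier_PSL2 by blast
    ultimately show ?thesis by (auto simp: PSL2_act_psl)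
  qed
  then show ?thesis by (intro that[of "1 / real (Suc N)"]) auto
qed

section \<open>Unipotent maps \<open>1 + k n m\<^sup>T\<close> and their limit points\<close>

definition transvection :: "real^2 \<Rightarrow> real^2 \<Rightarrow> real \<Rightarrow> real^2^2" where
  "transvection n m k = mat2 (1 + k * n$1 * m$1) (k * n$1 * m$2) (k * n$2 * m$1) (1 + k * n$2 * m$2)"

text \<open>The rank-one matrix \<open>n n\<^sup>T\<close>, scaled to trace one.\<close>

definition ideal_point :: "real^2 \<Rightarrow> real^2^2" where
  "ideal_point n = mat2 ((n$1)\<^sup>2 / ((n$1)\<^sup>2 + (n$2)\<^sup>2)) (n$1 * n$2 / ((n$1)\<^sup>2 + (n$2)\<^sup>2))
     (n$1 * n$2 / ((n$1)\<^sup>2 + (n$2)\<^sup>2)) ((n$2)\<^sup>2 / ((n$1)\<^sup>2 + (n$2)\<^sup>2))"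

lemma ideal_point_boundary:
  assumes "n \<noteq> 0"
  shows "ideal_point n \<in> ideal_boundary"
proof -
  have "(n$1)\<^sup>2 + (n$2)\<^sup>2 \<noteq> 0" using assms by (simp add: vec_eq_iff forall_2 sum_power2_eq_zero_iff)
  then show ?thesis
    by (simp add: ideal_boundary_def ideal_point_def matrix2_eq_iff transpose_def trace_2 det_2
        power2_eq_square flip: add_divide_distrib)
qed

text \<open>In the image of the centre of the disc under the \<open>k\<close>-th map the term with
  \<open>k\<^sup>2\<close> is a multiple of \<open>n n\<^sup>T\<close> and dominates, so the
  normalised images converge to the ideal point. They have positive determinant and thus differ from
  it, as a limit point demands.\<close>

lemma transvection_limit_set:
  assumes n: "n \<noteq> 0" "m \<noteq> 0" "n$1 * m$1 + n$2 * m$2 = 0"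
    and \<Gamma>: "\<And>k. psl (transvection n m (real k)) \<in> \<Gamma>"
  shows "ideal_point n \<in> limit_set \<Gamma>"
proof -
  define X :: "real^2^2" where "X = mat2 (1/2) 0 0 (1/2)"
  have X: "X \<in> H2" by (rule H2_I) (simp_all add: X_def)
  define s t where "s = (n$1)\<^sup>2 + (n$2)\<^sup>2" and "t = (m$1)\<^sup>2 + (m$2)\<^sup>2"
  have st: "s > 0" "t > 0" using n(1,2) by (simp_all add: s_def t_def sum_power2_gt_zero_iff vec_eq_iff forall_2)
  have dt: "det (transvection n m k) = 1" for k
  proof -
    have "det (transvection n m k) = 1 + k * (n$1 * m$1 + n$2 * m$2)"
      by (simp add: det_2 transvection_def algebra_simps)
    then show ?thesis by (simp add: n(3))
  qed
  define Y where "Y k = SL2_act (transvection n m (real k)) X" for k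
  let ?W = "\<lambda>k. transvection n m k ** X ** transpose (transvection n m k)"
  have W: "?W k $1$1 = 1/2 + k * (n$1 * m$1) + k\<^sup>2 * ((n$1)\<^sup>2 * t / 2)"
    "?W k $1$2 = k * ((n$1 * m$2 + n$2 * m$1) / 2) + k\<^sup>2 * (n$1 * n$2 * t / 2)"
    "?W k $2$1 = k * ((n$1 * m$2 + n$2 * m$1) / 2) + k\<^sup>2 * (n$1 * n$2 * t / 2)"
    "?W k $2$2 = 1/2 + k * (n$2 * m$2) + k\<^sup>2 * ((n$2)\<^sup>2 * t / 2)" for k
    by (simp_all add: matrix2_mult_nth transpose_def transvection_def X_def t_def power2_eq_square field_simps)
  have tr: "trace (?W k) = 1 + k\<^sup>2 * (s * t / 2)" for k
  proof -
    have "trace (?W k) = 1 + k * (n$1 * m$1 + n$2 * m$2) + k\<^sup>2 * (s * t / 2)"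
      unfolding trace_2 W s_def by (simp add: field_simps)
    then show ?thesis by (simp add: n(3))
  qed
  have lim: "(\<lambda>k. (a + real k * b + (real k)\<^sup>2 * (c * t / 2)) / (1 + (real k)\<^sup>2 * (s * t / 2))) \<longlonglongrightarrow> c / s"
    for a b c
  proof -
    have inv: "(\<lambda>k. 1 / real k) \<longlonglongrightarrow> 0" by (rule lim_1_over_n)
    have "(\<lambda>k. (a * (1 / real k)\<^sup>2 + b * (1 / real k) + c * t / 2) / ((1 / real k)\<^sup>2 + s * t / 2))
        \<longlonglongrightarrow> (a * 0\<^sup>2 + b * 0 + c * t / 2) / (0\<^sup>2 + s * t / 2)"
      using st by (intro tendsto_intros inv) auto
    moreover have "(a * 0\<^sup>2 + b * 0 + c * t / 2) / (0\<^sup>2 + s * t / 2) = c / s" using st by simp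
    moreover have "\<forall>\<^sub>F k in sequentially.
      (a * (1 / real k)\<^sup>2 + b * (1 / real k) + c * t / 2) / ((1 / real k)\<^sup>2 + s * t / 2)
      = (a + real k * b + (real k)\<^sup>2 * (c * t / 2)) / (1 + (real k)\<^sup>2 * (s * t / 2))"
    proof (rule eventually_mono[OF eventually_gt_at_top[of 0]])
      fix k :: nat assume "k > 0"
      define x where "x = real k"
      have x: "x > 0" using \<open>k > 0\<close> by (simp add: x_def)
      have "x\<^sup>2 * (a * (1 / x)\<^sup>2 + b * (1 / x) + c * t / 2) = a + x * b + x\<^sup>2 * (c * t / 2)"
        "x\<^sup>2 * ((1 / x)\<^sup>2 + s * t / 2) = 1 + x\<^sup>2 * (s * t / 2)"
        using x by (simp_all add: power2_eq_square distrib_left)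
      then have "(a + x * b + x\<^sup>2 * (c * t / 2)) / (1 + x\<^sup>2 * (s * t / 2))
        = (x\<^sup>2 * (a * (1 / x)\<^sup>2 + b * (1 / x) + c * t / 2)) / (x\<^sup>2 * ((1 / x)\<^sup>2 + s * t / 2))"
        by simp
      also have "\<dots> = (a * (1 / x)\<^sup>2 + b * (1 / x) + c * t / 2) / ((1 / x)\<^sup>2 + s * t / 2)"
        using x by (intro mult_divide_mult_cancel_left) simp
      finally show "(a * (1 / real k)\<^sup>2 + b * (1 / real k) + c * t / 2) / ((1 / real k)\<^sup>2 + s * t / 2)
        = (a + real k * b + (real k)\<^sup>2 * (c * t / 2)) / (1 + (real k)\<^sup>2 * (s * t / 2))"
        unfolding x_def by simp
    qed
    ultimately show ?thesis using tendsto_cong by force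
  qed
  have Yc: "Y k $ i $ j = ?W (real k) $ i $ j / (1 + (real k)\<^sup>2 * (s * t / 2))" for k i j
    by (simp add: Y_def SL2_act_def tr)
  have "Y \<longlonglongrightarrow> ideal_point n"
  proof (rule tendsto_matrix2)
    show "(\<lambda>k. Y k $1$1) \<longlonglongrightarrow> ideal_point n $1$1"
      unfolding Yc W using lim[of "1/2" "n$1 * m$1" "(n$1)\<^sup>2"] by (simp add: ideal_point_def s_def)
    show "(\<lambda>k. Y k $1$2) \<longlonglongrightarrow> ideal_point n $1$2"
      unfolding Yc W using lim[of 0 "(n$1 * m$2 + n$2 * m$1) / 2" "n$1 * n$2"] by (simp add: ideal_point_def s_def)
    show "(\<lambda>k. Y k $2$1) \<longlonglongrightarrow> ideal_point n $2$1"
      unfolding Yc W using lim[of 0 "(n$1 * m$2 + n$2 * m$1) / 2" "n$1 * n$2"] by (simp add: ideal_point_def s_def)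
    show "(\<lambda>k. Y k $2$2) \<longlonglongrightarrow> ideal_point n $2$2"
      unfolding Yc W using lim[of "1/2" "n$2 * m$2" "(n$2)\<^sup>2"] by (simp add: ideal_point_def s_def)
  qed
  moreover have "Y k \<in> orbit_of \<Gamma> X - {ideal_point n}" for k
  proof -
    have "Y k \<in> orbit_of \<Gamma> X" unfolding orbit_of_def Y_def using \<Gamma>[of k] PSL2_act_psl by (metis image_eqI)
    moreover have "det (Y k) > 0" using SL2_act_H2[OF X dt] by (simp add: Y_def H2_def)
    moreover have "det (ideal_point n) = 0" using ideal_point_boundary[OF n(1)] by (simp add: ideal_boundary_def)
    ultimately show ?thesis by auto
  qed
  ultimately have "ideal_point n islimpt orbit_of \<Gamma> X" unfolding islimpt_sequential by blast
  then show ?thesis using X ideal_point_boundary[OF n(1)] by (auto simp: limit_set_def)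
qed

lemma transvection_conj:
  assumes "conjugators g h"
  shows "h ** transvection n m k ** g = transvection (h *v n) (m v* g) k"
proof -
  have *: "(h ** transvection n m k ** g)$i$j = (h ** g)$i$j + k * (h *v n)$i * (m v* g)$j" for i j
    by (simp add: matrix2_mult_nth transvection_def matrix_vector_mult_def vector_matrix_mult_nth_2 sum_2 algebra_simps)
  show ?thesis
    unfolding matrix2_eq_iff * using assms by (simp add: conjugators_def mat_def transvection_def)
qed

lemma conj_transvection_limit_set:
  assumes gh: "conjugators g h" and sub: "subgroup \<Gamma> PSL2"
    and n: "n \<noteq> 0" "m \<noteq> 0" "n$1 * m$1 + n$2 * m$2 = 0"
    and \<Gamma>: "conj_psl g h (transvection n m 1) \<in> \<Gamma>"
  shows "ideal_point (h *v n) \<in> limit_set \<Gamma>"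
proof (rule transvection_limit_set)
  have det: "det (transvection n m 1) = 1"
    using n(3) by (simp add: det_2 transvection_def algebra_simps)
  have pow: "matpow (transvection n m 1) k = transvection n m (real k)" for k
  proof (induction k)
    case 0 then show ?case by (simp add: transvection_def matrix2_eq_iff mat_def)
  next
    case (Suc k)
    have "(transvection n m 1 ** transvection n m (real k))$i$j = transvection n m (real (Suc k))$i$j
        + real k * n$i * (n$1 * m$1 + n$2 * m$2) * m$j" for i j
      using exhaust_2[of i] exhaust_2[of j]
      by (auto simp: matrix2_mult_nth transvection_def algebra_simps)
    then have "transvection n m 1 ** transvection n m (real k) = transvection n m (real (Suc k))"
      unfolding matrix2_eq_iff by (simp only: n(3)) simp
    then show ?case using Suc by simp
  qed
  show "psl (transvection (h *v n) (m v* g) (real k)) \<in> \<Gamma>" for k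
    using conj_psl_matpow_in[OF gh sub det \<Gamma>, of k] by (simp add: pow conj_psl_def transvection_conj[OF gh])
  have ghn: "g *v (h *v n) = n" using gh by (simp add: matrix_vector_mul_assoc conjugators_def)
  then show "h *v n \<noteq> 0" using n(1) by auto
  have "m v* g v* h = m" using gh by (simp add: vector_matrix_mul_assoc conjugators_def)
  then show "m v* g \<noteq> 0" using n(2) by auto
  have "(h *v n)$1 * (m v* g)$1 + (h *v n)$2 * (m v* g)$2 = (g *v (h *v n))$1 * m$1 + (g *v (h *v n))$2 * m$2"
    by (simp add: vector_matrix_mult_nth_2 matrix_vector_mult_def sum_2 algebra_simps)
  then show "(h *v n)$1 * (m v* g)$1 + (h *v n)$2 * (m v* g)$2 = 0" unfolding ghn by (simp add: n(3))
qed

section \<open>The threshold case: an invariant lattice\<close>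

definition lattice_points :: "(real^2) set" where
  "lattice_points = {z. z \<noteq> 0 \<and> (\<exists>a b :: int. z$1 = of_int (a - b) \<and> z$2 = of_int (a + b))}"

text \<open>In the basis (1, 1), (-1, 1), where a lattice point has coordinates \<open>a\<close> and
  \<open>b\<close>, the generators at \<open>\<tau> = sqrt 3\<close> have integer entries. The
  witnesses below are these integer matrices applied to \<open>(a, b)\<close>.\<close>

lemma lattice_points_step:
  assumes "A \<in> {rotS, rotT (sqrt 3), rotT' (sqrt 3)}" "z \<in> lattice_points"
  shows "A *v z \<in> lattice_points"
proof -
  obtain a b :: int where z: "z$1 = of_int (a - b)" "z$2 = of_int (a + b)" "z \<noteq> 0"
    using assms(2) by (auto simp: lattice_points_def)
  have nz: "A *v z \<noteq> 0"
  proof -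
    have "det A = 1" using assms(1) by (auto simp: det_rotS det_rotT)
    then obtain B where "B ** A = mat 1" by (metis invertible_det_nz invertible_def zero_neq_one)
    then have "B *v (A *v z) = z" by (simp add: matrix_vector_mul_assoc)
    then show ?thesis using z(3) by auto
  qed
  have s3: "sqrt 3 * (sqrt 3 * x) = 3 * x" for x :: real by (simp flip: mult.assoc)
  have "\<exists>c d :: int. (A *v z)$1 = of_int (c - d) \<and> (A *v z)$2 = of_int (c + d)"
  proof -
    consider "A = rotS" | "A = rotT (sqrt 3)" | "A = rotT' (sqrt 3)" using assms(1) by blast
    then show ?thesis
    proof cases
      case 1
      then show ?thesis by (intro exI[of _ "- b"] exI[of _ a])
        (simp add: matrix_vector_mult_def sum_2 rotS_def z)
    next
      case 2
      then show ?thesis by (intro exI[of _ "- b"] exI[of _ "a + b"])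
        (simp add: matrix_vector_mult_def sum_2 rotT_def z s3 field_simps)
    next
      case 3
      then show ?thesis by (intro exI[of _ "a + b"] exI[of _ "- a"])
        (simp add: matrix_vector_mult_def sum_2 rotT'_def z s3 field_simps)
    qed
  qed
  then show ?thesis using nz by (simp add: lattice_points_def)
qed

lemma lattice_points_normal_words:
  assumes "M \<in> normal_words (sqrt 3)" "z \<in> lattice_points"
  shows "M *v z \<in> lattice_points"
proof -
  have w: "word (sqrt 3) l *v z \<in> lattice_points" if "z \<in> lattice_points" for l z
    using that
    by (induction l) (simp_all add: lattice_points_step rotT_pm_def flip: matrix_vector_mul_assoc)
  have neg: "- x \<in> lattice_points" if x: "x \<in> lattice_points" for x
  proof -
    obtain a b :: int where "x$1 = of_int (a - b)" "x$2 = of_int (a + b)" "x \<noteq> 0"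
      using x by (auto simp: lattice_points_def)
    then show ?thesis unfolding lattice_points_def mem_Collect_eq
      by (intro conjI exI[of _ "- a"] exI[of _ "- b"]) auto
  qed
  obtain a b l where ab: "a \<in> {mat 1, rotS}" "b \<in> {mat 1, rotT (sqrt 3), rotT' (sqrt 3)}"
    "M = a ** word (sqrt 3) l ** b \<or> M = - (a ** word (sqrt 3) l ** b)"
    using assms(1) unfolding normal_words_def by blast
  have b: "b *v z \<in> lattice_points" using ab(2) lattice_points_step[OF _ assms(2)] assms(2) by auto
  have "a *v (word (sqrt 3) l *v (b *v z)) \<in> lattice_points"
    using ab(1) lattice_points_step[OF _ w[OF b]] w[OF b] by auto
  then have *: "(a ** word (sqrt 3) l ** b) *v z \<in> lattice_points"
    by (simp only: matrix_vector_mul_assoc matrix_mul_assoc)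
  have "(- B) *v z = - (B *v z)" for B :: "real^2^2" by (simp add: vec_eq_iff matrix_vector_mult_def sum_2)
  then show ?thesis using ab(3) * neg[OF *] by auto
qed

text \<open>Some coordinate of a non-zero lattice point has modulus at least 1, since the
  coordinates are integers. If both coordinates of \<open>h *v z\<close> were below
  \<open>1 / G\<close>, applying \<open>g\<close> would give back a \<open>z\<close> with all
  coordinates below 1.\<close>

lemma lattice_points_norm:
  assumes "conjugators g h"
  obtains \<delta> where "\<delta> > 0" "\<And>z. z \<in> lattice_points \<Longrightarrow> \<exists>i. ((h *v z)$i)\<^sup>2 \<ge> \<delta>"
proof -
  define G where "G = 1 + \<bar>g$1$1\<bar> + \<bar>g$1$2\<bar> + \<bar>g$2$1\<bar> + \<bar>g$2$2\<bar>"
  have G: "G > 0" by (simp add: G_def add_pos_nonneg)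
  have "\<exists>i. ((h *v z)$i)\<^sup>2 \<ge> (1 / G)\<^sup>2" if z: "z \<in> lattice_points" for z
  proof (rule ccontr)
    assume "\<not> ?thesis"
    then have "\<And>i. ((h *v z)$i)\<^sup>2 < (1 / G)\<^sup>2" by (simp add: not_le)
    then have lt: "\<bar>(h *v z)$i\<bar> < 1 / G" for i using G by (metis abs_le_square_iff abs_of_pos not_le zero_less_divide_1_iff)
    obtain a b :: int where ab: "z$1 = of_int (a - b)" "z$2 = of_int (a + b)" "z \<noteq> 0"
      using z by (auto simp: lattice_points_def)
    have "g *v (h *v z) = z" using assms by (simp add: matrix_vector_mul_assoc conjugators_def)
    then have zi: "z$i = g$i$1 * (h *v z)$1 + g$i$2 * (h *v z)$2" for i
      by (metis (no_types, lifting) matrix_vector_mult_def sum_2 vec_lambda_beta)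
    have "\<bar>z$i\<bar> < 1" for i
    proof -
      have "\<bar>z$i\<bar> \<le> \<bar>g$i$1\<bar> * \<bar>(h *v z)$1\<bar> + \<bar>g$i$2\<bar> * \<bar>(h *v z)$2\<bar>"
        unfolding zi[of i] by (intro order_trans[OF abs_triangle_ineq]) (simp add: abs_mult)
      also have "\<dots> \<le> \<bar>g$i$1\<bar> * (1 / G) + \<bar>g$i$2\<bar> * (1 / G)"
        using lt by (intro add_mono mult_left_mono) (auto intro: less_imp_le)
      also have "\<dots> = (\<bar>g$i$1\<bar> + \<bar>g$i$2\<bar>) / G" by (simp add: add_divide_distrib)
      also have "\<dots> < 1"
      proof -
        have "\<bar>g$i$1\<bar> + \<bar>g$i$2\<bar> < G" using exhaust_2[of i] by (auto simp: G_def add_pos_nonneg)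
        then show ?thesis using G by simp
      qed
      finally show ?thesis .
    qed
    then have "\<bar>real_of_int (a - b)\<bar> < 1" "\<bar>real_of_int (a + b)\<bar> < 1" using ab by metis+
    then have "a - b = 0" "a + b = 0" by linarith+
    then show False using ab by (simp add: vec_eq_iff forall_2)
  qed
  then show ?thesis using G by (intro that[of "(1 / G)\<^sup>2"]) auto
qed

text \<open>The hull contains points that run into a cusp. Elements of the group send the cusp
  vector to vectors that the lattice keeps away from zero, so by invariance of
  \<open>disc_form\<close> they cannot bring such points back to the region of determinant above
  \<open>\<delta>\<close>.\<close>

lemma lattice_not_cocompact:
  assumes gh: "conjugators g h" and cc: "convex_cocompact \<Gamma>"
    and S: "conj_psl g h rotS \<in> \<Gamma>" and T: "conj_psl g h (rotT (sqrt 3)) \<in> \<Gamma>"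
    and words: "\<Gamma> \<subseteq> conj_psl g h ` normal_words (sqrt 3)"
  shows False
proof -
  have sub: "subgroup \<Gamma> PSL2" using cc by (simp add: convex_cocompact_def discrete_subgroup_def)
  \<comment> \<open>\<open>e1\<close> and \<open>e2\<close> form the basis of the lattice and are
    fixed by the parabolic products of the two rotations, up to sign; \<open>m1\<close> and
    \<open>m2\<close> write these products as transvections.\<close>
  define e1 e2 m1 m2 :: "real^2" where "e1 = vector [1, 1]" and "e2 = vector [-1, 1]"
    and "m1 = vector [-1/2, 1/2]" and "m2 = vector [-1/2, -1/2]"
  have comp: "e1$1 = 1" "e1$2 = 1" "e2$1 = -1" "e2$2 = 1" "m1$1 = -1/2" "m1$2 = 1/2"
    "m2$1 = -1/2" "m2$2 = -1/2" by (simp_all add: e1_def e2_def m1_def m2_def)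
  have nz: "e1 \<noteq> 0" "e2 \<noteq> 0" "m1 \<noteq> 0" "m2 \<noteq> 0"
    using comp by (metis one_neq_zero zero_index, metis one_neq_zero zero_index, auto simp: vec_eq_iff forall_2)
  have tv: "transvection e1 m1 1 = - (rotS ** rotT (sqrt 3))" "transvection e2 m2 1 = - (rotT (sqrt 3) ** rotS)"
    by (simp_all add: transvection_def comp matrix2_eq_iff matrix2_mult_nth rotS_def rotT_def)
  have "conj_psl g h (transvection e1 m1 1) \<in> \<Gamma>" "conj_psl g h (transvection e2 m2 1) \<in> \<Gamma>"
    using S T sub gh by (simp_all add: tv conj_psl_mult det_rotS det_rotT subgroup.m_closed)
  then have Z: "ideal_point (h *v e1) \<in> limit_set \<Gamma>" "ideal_point (h *v e2) \<in> limit_set \<Gamma>"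
    using nz conj_transvection_limit_set[OF gh sub, of e1 m1] conj_transvection_limit_set[OF gh sub, of e2 m2]
    by (simp_all add: comp)
  define n1 n2 where "n1 = h *v e1" and "n2 = h *v e2"
  define s1 s2 w where "s1 = (n1$1)\<^sup>2 + (n1$2)\<^sup>2" and "s2 = (n2$1)\<^sup>2 + (n2$2)\<^sup>2" and "w = wedge n1 n2"
  have w: "w \<noteq> 0"
  proof -
    have "w = det h * 2" unfolding w_def n1_def n2_def wedge_def det_2
      by (simp add: matrix_vector_mult_def sum_2 comp algebra_simps)
    then show ?thesis using gh by (simp add: conjugators_def)
  qed
  have s: "s1 > 0" "s2 > 0"
    using w unfolding s1_def s2_def sum_power2_gt_zero_iff w_def wedge_def by auto
  obtain \<delta> where \<delta>: "\<delta> > 0"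
    "\<And>X. X \<in> limit_hull \<Gamma> \<Longrightarrow> \<exists>A. det A = 1 \<and> psl A \<in> \<Gamma> \<and> det (SL2_act A X) > \<delta>"
    using convex_cocompact_bound[OF cc] by blast
  obtain \<eta> where \<eta>: "\<eta> > 0" "\<And>z. z \<in> lattice_points \<Longrightarrow> \<exists>i. ((h *v z)$i)\<^sup>2 \<ge> \<eta>"
    using lattice_points_norm[OF gh] by blast
  define c where "c = w\<^sup>2 * s1 / s2"
  have c: "c > 0" using w s by (simp add: c_def)
  have key: "\<delta>\<^sup>2 * \<eta>\<^sup>2 \<le> e / (1 - e) * c / 4" if e: "0 < e" "e < 1" for e
  proof -
    \<comment> \<open>A point on the geodesic between the two cusps, which tends to the cusp of
      \<open>n1\<close> as \<open>e\<close> tends to 0.\<close>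
    define X where "X = (1 - e) *\<^sub>R ideal_point n1 + e *\<^sub>R ideal_point n2"
    have Xc: "X$1$1 = (1 - e) * ((n1$1)\<^sup>2 / s1) + e * ((n2$1)\<^sup>2 / s2)"
      "X$1$2 = (1 - e) * (n1$1 * n1$2 / s1) + e * (n2$1 * n2$2 / s2)"
      "X$2$1 = (1 - e) * (n1$1 * n1$2 / s1) + e * (n2$1 * n2$2 / s2)"
      "X$2$2 = (1 - e) * ((n1$2)\<^sup>2 / s1) + e * ((n2$2)\<^sup>2 / s2)"
      by (simp_all add: X_def ideal_point_def s1_def s2_def)
    define p q where "p = (1 - e) / s1" and "q = e / s2"
    have Xpq: "X$1$1 = p * (n1$1)\<^sup>2 + q * (n2$1)\<^sup>2" "X$1$2 = p * (n1$1 * n1$2) + q * (n2$1 * n2$2)"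
      "X$2$1 = p * (n1$1 * n1$2) + q * (n2$1 * n2$2)" "X$2$2 = p * (n1$2)\<^sup>2 + q * (n2$2)\<^sup>2"
      unfolding Xc p_def q_def by simp_all
    have "det X = p * q * w\<^sup>2"
      unfolding det_2 Xpq w_def wedge_def by (simp add: algebra_simps power2_eq_square)
    then have detX: "det X = (1 - e) * e * w\<^sup>2 / (s1 * s2)" by (simp add: p_def q_def)
    have "disc_form X n1 = q * w\<^sup>2"
      unfolding disc_form_def Xpq w_def wedge_def by (simp add: algebra_simps power2_eq_square)
    then have form: "disc_form X n1 = e * w\<^sup>2 / s2" by (simp add: q_def)
    have tr: "X$1$1 + X$2$2 = 1"
    proof -
      have "X$1$1 + X$2$2 = (1 - e) * (((n1$1)\<^sup>2 + (n1$2)\<^sup>2) / s1) + e * (((n2$1)\<^sup>2 + (n2$2)\<^sup>2) / s2)"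
        unfolding Xc by (simp add: add_divide_distrib algebra_simps)
      then show ?thesis using s by (simp flip: s1_def s2_def)
    qed
    have dpos: "det X > 0" unfolding detX using e w s by simp
    have X2: "X \<in> H2"
      by (rule H2_I) (use dpos tr in \<open>simp_all add: det_2 Xc\<close>)
    have "X \<in> convex hull (limit_set \<Gamma>)"
      unfolding X_def n1_def n2_def using Z e
      by (intro convexD[OF convex_convex_hull] hull_inc) auto
    then have "X \<in> limit_hull \<Gamma>" using X2 by (simp add: limit_hull_def)
    then obtain A where A: "det A = 1" "psl A \<in> \<Gamma>" "det (SL2_act A X) > \<delta>" using \<delta>(2) by blast
    obtain k where k: "k > 0" "SL2_act A X = k *\<^sub>R (A ** X ** transpose A)"
      using SL2_act_scale[OF X2 A(1)] by blast
    let ?Y = "SL2_act A X"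
    have Y2: "?Y \<in> H2" using SL2_act_H2[OF X2 A(1)] .
    have detY: "det ?Y = k\<^sup>2 * det X" unfolding k(2) det_scaleR_2 using A(1) by (simp add: det_mul det_transpose)
    have "disc_form ?Y (A *v n1) = k * disc_form (A ** X ** transpose A) (A *v n1)"
      unfolding k(2) disc_form_def by (simp add: algebra_simps)
    then have formY: "disc_form ?Y (A *v n1) = k * (e * w\<^sup>2 / s2)"
      unfolding disc_form_action[OF X2 A(1)] form .
    obtain M where M: "M \<in> normal_words (sqrt 3)" "psl A = conj_psl g h M" using A(2) words by blast
    then have AM: "A = h ** M ** g \<or> A = - (h ** M ** g)" by (simp add: conj_psl_def psl_eq_iff)
    have "e1 \<in> lattice_points"
      unfolding lattice_points_def mem_Collect_eq
      using nz comp by (intro conjI exI[of _ 1] exI[of _ 0]) simp_all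
    from \<eta>(2)[OF lattice_points_normal_words[OF M(1) this]]
    obtain i where i: "((h *v (M *v e1))$i)\<^sup>2 \<ge> \<eta>" by blast
    have "h ** M ** g *v n1 = h *v (M *v e1)"
    proof -
      have "h ** M ** g ** h = h ** M" using gh by (simp add: conjugators_def flip: matrix_mul_assoc)
      then show ?thesis unfolding n1_def by (simp add: matrix_vector_mul_assoc)
    qed
    moreover have "(- B) *v x = - (B *v x)" for B :: "real^2^2" and x
      by (simp add: vec_eq_iff matrix_vector_mult_def sum_2)
    ultimately have "((A *v n1)$i)\<^sup>2 \<ge> \<eta>" using AM i by auto
    then have "\<delta> * \<eta> \<le> det ?Y * ((A *v n1)$i)\<^sup>2" using A(3) \<delta>(1) \<eta>(1) by (intro mult_mono) auto
    also have "\<dots> \<le> k * (e * w\<^sup>2 / s2)" using disc_form_ge[OF Y2, of "A *v n1" i] formY by simp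
    \<comment> \<open>Squaring removes the unknown factor \<open>k\<close>: it then occurs only in
      \<open>k\<^sup>2 * det X\<close>, which is the determinant of a point of the disc and hence at
      most 1/4.\<close>
    finally have "(\<delta> * \<eta>)\<^sup>2 \<le> (k * (e * w\<^sup>2 / s2))\<^sup>2" using \<delta>(1) \<eta>(1) by (intro power_mono) auto
    also have "\<dots> = k\<^sup>2 * det X * (e / (1 - e) * c)"
      unfolding detX c_def using e s by (simp add: power2_eq_square field_simps)
    also have "\<dots> \<le> (1/4) * (e / (1 - e) * c)"
      using det_H2_le[OF Y2] e c unfolding detY by (intro mult_right_mono) auto
    finally show ?thesis
      by (simp only: power_mult_distrib divide_inverse mult_ac mult_1_left mult_1_right)
  qed
  define a where "a = \<delta>\<^sup>2 * \<eta>\<^sup>2"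
  have a: "a > 0" using \<delta>(1) \<eta>(1) by (simp add: a_def)
  \<comment> \<open>With this value \<open>e / (1 - e) * c\<close> equals \<open>a\<close>, and
    \<open>key\<close> turns into \<open>a \<le> a / 4\<close>.\<close>
  define e where "e = a / (a + c)"
  have e: "0 < e" "e < 1" using a c by (simp_all add: e_def)
  have "1 - e = c / (a + c)" using a c by (simp add: e_def field_simps)
  then have "e / (1 - e) = a / c" using a c by (simp add: e_def)
  then have "a \<le> a / 4" using key[OF e] c by (simp add: a_def)
  then show False using a by simp
qed

lemma deformation_pingpong:
  assumes "convex_cocompact_deformation_PSL2Z \<Gamma>"
  obtains g h \<tau> where "conjugators g h" "\<tau> > sqrt 3" "subgroup \<Gamma> PSL2"
    "conj_psl g h rotS \<in> \<Gamma>" "conj_psl g h (rotT \<tau>) \<in> \<Gamma>" "\<Gamma> \<subseteq> conj_psl g h ` normal_words \<tau>"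
proof -
  obtain g h \<tau> where gh: "conjugators g h" and \<tau>: "\<tau> \<ge> 1" and sub: "subgroup \<Gamma> PSL2"
    and S: "conj_psl g h rotS \<in> \<Gamma>" and T: "conj_psl g h (rotT \<tau>) \<in> \<Gamma>"
    and words: "\<Gamma> \<subseteq> conj_psl g h ` normal_words \<tau>"
    and inf: "\<And>n. n > 0 \<Longrightarrow> conj_psl g h (matpow (rotS ** rotT \<tau>) n) \<noteq> \<one>\<^bsub>PSL2\<^esub>"
    using deformation_normal_form[OF assms] by blast
  have cc: "convex_cocompact \<Gamma>" using assms by (simp add: convex_cocompact_deformation_PSL2Z_def)
  have disc: "discrete_subgroup \<Gamma>" using cc by (simp add: convex_cocompact_def)
  have d: "det (rotS ** rotT \<tau>) = 1" using \<tau> by (simp add: det_mul det_rotS det_rotT)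
  have "conj_psl g h (rotS ** rotT \<tau>) \<in> \<Gamma>"
    using S T sub gh \<tau> by (simp add: conj_psl_mult det_rotS det_rotT subgroup.m_closed)
  from no_elliptic_of_infinite_order[OF disc gh d this inf]
  have tr: "\<bar>(rotS ** rotT \<tau>)$1$1 + (rotS ** rotT \<tau>)$2$2\<bar> \<ge> 2" .
  have eq: "(rotS ** rotT \<tau>)$1$1 + (rotS ** rotT \<tau>)$2$2 = - (sqrt 3 * (1 / \<tau> + \<tau>) / 2)"
    using \<tau> by (simp add: matrix2_mult_nth rotS_def rotT_def field_simps)
  have "0 \<le> sqrt 3 * (1 / \<tau> + \<tau>) / 2" using \<tau> by simp
  then have "4 \<le> sqrt 3 * (1 / \<tau> + \<tau>)" using tr unfolding eq by simp
  then have "4 * \<tau> \<le> sqrt 3 * (1 / \<tau> + \<tau>) * \<tau>" using \<tau> by (intro mult_right_mono) auto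
  then have "4 * \<tau> \<le> sqrt 3 + sqrt 3 * \<tau>\<^sup>2" using \<tau> by (simp add: power2_eq_square algebra_simps)
  then have "sqrt 3 * (4 * \<tau>) \<le> sqrt 3 * (sqrt 3 + sqrt 3 * \<tau>\<^sup>2)" by (intro mult_left_mono) auto
  also have "\<dots> = 3 + 3 * \<tau>\<^sup>2" by (simp add: distrib_left flip: mult.assoc)
  \<comment> \<open>The bound on the trace, in factored form: the roots in \<open>\<tau>\<close> are
    \<open>sqrt 3\<close> and \<open>1 / sqrt 3\<close>, and the second lies below 1.\<close>
  finally have "0 \<le> (\<tau> - sqrt 3) * (3 * \<tau> - sqrt 3)"
    by (simp add: power2_eq_square algebra_simps)
  moreover have "3 * \<tau> - sqrt 3 > 0"
  proof -
    have "sqrt 3 < 3" by (rule real_less_lsqrt) auto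
    then show ?thesis using \<tau> by linarith
  qed
  ultimately have "\<tau> \<ge> sqrt 3" by (simp add: zero_le_mult_iff)
  moreover have "\<tau> \<noteq> sqrt 3" using lattice_not_cocompact[OF gh cc S] T words by blast
  ultimately show ?thesis using that[OF gh _ sub S T words] by linarith
qed

section \<open>Properness\<close>

text \<open>Applying \<open>g\<close> to the values of \<open>u\<close> intertwines the action of
  \<open>h ** A ** g\<close> with that of \<open>A\<close>, so the cocycle is carried to normal
  position together with the group.\<close>

lemma conj_cocycle:
  assumes gh: "conjugators g h" and \<tau>: "\<tau> > 1" and sub: "subgroup \<Gamma> PSL2"
    and S: "conj_psl g h rotS \<in> \<Gamma>" and T: "conj_psl g h (rotT \<tau>) \<in> \<Gamma>"
    and u: "cocycle \<Gamma> u"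
  shows "matrix_cocycle {M. det M = 1 \<and> conj_psl g h M \<in> \<Gamma>} (\<lambda>M. Sym6_act g (u (conj_psl g h M))) \<tau>"
proof
  fix A B assume A: "A \<in> {M. det M = 1 \<and> conj_psl g h M \<in> \<Gamma>}" and B: "B \<in> {M. det M = 1 \<and> conj_psl g h M \<in> \<Gamma>}"
  show "A ** B \<in> {M. det M = 1 \<and> conj_psl g h M \<in> \<Gamma>}"
    using A B gh sub by (simp add: det_mul conj_psl_mult subgroup.m_closed)
  have "g ** (h ** A ** g) = (g ** h) ** A ** g" by (simp add: matrix_mul_assoc)
  then have intertwine: "Sym6_act g (Sym6_act (h ** A ** g) v) = Sym6_act A (Sym6_act g v)" for v
    using gh by (simp add: conjugators_def flip: Sym6_act_mult)
  have "u (conj_psl g h (A ** B)) = Sym6_act (h ** A ** g) (u (conj_psl g h B)) + u (conj_psl g h A)"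
    using A B u gh sigma7_psl[of "h ** A ** g"] unfolding cocycle_def
    by (simp add: conj_psl_mult flip: conj_psl_def)
  then show "Sym6_act g (u (conj_psl g h (A ** B)))
      = Sym6_act A (Sym6_act g (u (conj_psl g h B))) + Sym6_act g (u (conj_psl g h A))"
    by (simp add: Sym6_act_arith intertwine)
qed (use \<tau> S T in \<open>auto simp: det_rotS det_rotT\<close>)

context matrix_cocycle
begin

text \<open>Being the coboundary of a fixed \<open>v\<close> passes to products and to negatives.
  Hence a cocycle that is one on the two rotations is one on the whole group, which is how
  non-triviality of \<open>u\<close> is brought to the generators.\<close>

lemma coboundary_on_normal_words:
  assumes "f rotS = v - Sym6_act rotS v" "f (rotT \<tau>) = v - Sym6_act (rotT \<tau>) v"
    and "M \<in> normal_words \<tau>"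
  shows "f M = v - Sym6_act M v"
proof -
  define P where "P A \<longleftrightarrow> A \<in> G \<and> f A = v - Sym6_act A v" for A
  have mult: "P (A ** B)" if "P A" "P B" for A B
    using that by (simp add: P_def mult_in f_mult Sym6_act_arith Sym6_act_mult)
  have um: "P (- A)" if "P A" for A
    using that by (simp add: P_def uminus_in f_uminus)
  have one: "P (mat 1)" by (simp add: P_def one_in f_one)
  have S: "P rotS" and T: "P (rotT \<tau>)" using assms rotS_in rotT_in by (auto simp: P_def)
  have T': "P (rotT' \<tau>)" using um[OF mult[OF T T]] tau by (simp add: rotT_square)
  have w: "P (word \<tau> l)" for l
    by (induction l) (auto simp: rotT_pm_def intro: one mult S T T')
  have "P M" using assms(3) unfolding normal_words_def by (auto intro: um mult w one S T T')
  then show ?thesis by (simp add: P_def)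
qed

end

lemma bounded_Sym6_act_image:
  assumes "bounded C"
  shows "bounded ((\<lambda>x. Sym6_act A x + b) ` C)"
proof -
  have "bounded (Sym6_act A ` C)"
    using assms bounded_linear_image linear_conv_bounded_linear linear_Sym6_act by blast
  then have "bounded ((\<lambda>y. b + y) ` Sym6_act A ` C)" by (rule bounded_translation)
  then show ?thesis by (simp add: image_image add.commute)
qed

theorem corollary5p2:
  fixes \<Gamma> :: "(real^2^2) set set" and u :: "(real^2^2) set \<Rightarrow> real^7"
  assumes "convex_cocompact_deformation_PSL2Z \<Gamma>"
    and "cocycle \<Gamma> u"
    and "\<not> coboundary \<Gamma> u"
  shows "properly_discontinuous \<Gamma> (affine_act u) UNIV"
proof -
  obtain g h \<tau> where gh: "conjugators g h" and \<tau>3: "\<tau> > sqrt 3" and sub: "subgroup \<Gamma> PSL2"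
    and S: "conj_psl g h rotS \<in> \<Gamma>" and T: "conj_psl g h (rotT \<tau>) \<in> \<Gamma>"
    and words: "\<Gamma> \<subseteq> conj_psl g h ` normal_words \<tau>"
    using deformation_pingpong[OF assms(1)] by blast
  have "1 < sqrt 3" by simp
  then have \<tau>: "\<tau> > 1" using \<tau>3 by linarith
  obtain m where m: "pingpong \<tau> m" using ex_pingpong[OF \<tau>3] by blast
  define f where "f M = Sym6_act g (u (conj_psl g h M))" for M
  interpret matrix_cocycle "{M. det M = 1 \<and> conj_psl g h M \<in> \<Gamma>}" f \<tau>
    unfolding f_def[abs_def] using conj_cocycle[OF gh \<tau> sub S T assms(2)] .
  have "\<nexists>v. f rotS = v - Sym6_act rotS v \<and> f (rotT \<tau>) = v - Sym6_act (rotT \<tau>) v"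
  proof
    assume "\<exists>v. f rotS = v - Sym6_act rotS v \<and> f (rotT \<tau>) = v - Sym6_act (rotT \<tau>) v"
    then obtain v where v: "f rotS = v - Sym6_act rotS v" "f (rotT \<tau>) = v - Sym6_act (rotT \<tau>) v" by blast
    have "u \<gamma> = Sym6_act h v - sigma7 \<gamma> (Sym6_act h v)" if \<gamma>: "\<gamma> \<in> \<Gamma>" for \<gamma>
    proof -
      obtain M where M: "M \<in> normal_words \<tau>" "\<gamma> = conj_psl g h M" using \<gamma> words by blast
      have "u \<gamma> = Sym6_act h (f M)"
        using gh M(2) by (simp add: f_def conjugators_def flip: Sym6_act_mult)
      also have "\<dots> = Sym6_act h v - Sym6_act (h ** M) v"
        using coboundary_on_normal_words[OF v M(1)] by (simp add: Sym6_act_arith Sym6_act_mult)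
      also have "h ** M = h ** M ** g ** h" using gh by (simp add: conjugators_def flip: matrix_mul_assoc)
      finally show ?thesis by (simp add: M(2) conj_psl_def sigma7_psl Sym6_act_mult)
    qed
    then show False using assms(3) by (auto simp: coboundary_def)
  qed
  note not_cob = this
  show ?thesis
    unfolding properly_discontinuous_def
  proof (intro allI impI)
    fix C :: "(real^7) set" assume "C \<subseteq> UNIV \<and> compact C"
    then have C: "bounded C" by (simp add: compact_imp_bounded)
    define As Bs where "As = {mat 1, rotS}" and "Bs = {mat 1, rotT \<tau>, rotT' \<tau>}"
    \<comment> \<open>The outer letters of a normal word are moved onto the points: \<open>b\<close>
      acts on the argument, \<open>a\<close> is undone on the image. There are finitely many of
      them, so the resulting copies of \<open>C\<close> are jointly bounded and only the inner word
      is left to estimate.\<close>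
    define Z where "Z = (\<Union>b\<in>Bs. (\<lambda>x. Sym6_act (b ** g) x + f b) ` C)
      \<union> (\<Union>a\<in>As. (\<lambda>y. Sym6_act (a ** g) y + (- Sym6_act a (f a))) ` C)"
    have "bounded Z"
      unfolding Z_def bounded_Un
    proof
      show "bounded (\<Union>b\<in>Bs. (\<lambda>x. Sym6_act (b ** g) x + f b) ` C)"
        by (intro bounded_UN ballI bounded_Sym6_act_image[OF C]) (simp add: Bs_def)
      show "bounded (\<Union>a\<in>As. (\<lambda>y. Sym6_act (a ** g) y + (- Sym6_act a (f a))) ` C)"
        by (intro bounded_UN ballI bounded_Sym6_act_image[OF C]) (simp add: As_def)
    qed
    then obtain R where bound: "\<forall>z\<in>Z. norm z \<le> R" unfolding bounded_iff by blast
    have R: "b \<in> Bs \<Longrightarrow> x \<in> C \<Longrightarrow> norm (Sym6_act (b ** g) x + f b) \<le> R"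
      "a \<in> As \<Longrightarrow> x \<in> C \<Longrightarrow> norm (Sym6_act (a ** g) x + (- Sym6_act a (f a))) \<le> R" for a b x
      by (rule bound[rule_format], unfold Z_def, blast)+
    obtain n where n: "\<And>l x. norm x \<le> R \<Longrightarrow> norm (Sym6_act (word \<tau> l) x + f (word \<tau> l)) \<le> R \<Longrightarrow> length l \<le> n"
      using word_length_bounded[OF m not_cob] by blast
    let ?W = "(\<lambda>(a, b, l). conj_psl g h (a ** word \<tau> l ** b)) ` (As \<times> Bs \<times> {l. set l \<subseteq> UNIV \<and> length l \<le> n})"
    have "{\<gamma> \<in> \<Gamma>. affine_act u \<gamma> ` C \<inter> C \<noteq> {}} \<subseteq> ?W"
    proof
      fix \<gamma> assume "\<gamma> \<in> {\<gamma> \<in> \<Gamma>. affine_act u \<gamma> ` C \<inter> C \<noteq> {}}"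
      then obtain x where \<gamma>: "\<gamma> \<in> \<Gamma>" and x: "x \<in> C" "affine_act u \<gamma> x \<in> C" by blast
      obtain N where "N \<in> normal_words \<tau>" "\<gamma> = conj_psl g h N" using \<gamma> words by blast
      then obtain a b l where ab: "a \<in> As" "b \<in> Bs" and \<gamma>M: "\<gamma> = conj_psl g h (a ** word \<tau> l ** b)"
        unfolding normal_words_def As_def Bs_def by fastforce
      let ?w = "word \<tau> l" and ?M = "a ** word \<tau> l ** b"
      have aG: "a \<in> {M. det M = 1 \<and> conj_psl g h M \<in> \<Gamma>}" using ab(1) one_in rotS_in unfolding As_def by blast
      have bG: "b \<in> {M. det M = 1 \<and> conj_psl g h M \<in> \<Gamma>}" using ab(2) one_in rotT_in rotT'_in unfolding Bs_def by blast
      \<comment> \<open>The square of \<open>rotS\<close> is minus the identity, which acts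
        trivially on sextics, so \<open>a\<close> acts as its own inverse.\<close>
      have aa: "Sym6_act a (Sym6_act a v) = v" for v
        using ab(1) by (auto simp: As_def rotS_rotS simp flip: Sym6_act_mult)
      define x' where "x' = Sym6_act (b ** g) x + f b"
      have fM: "f ?M = Sym6_act (a ** ?w) (f b) + (Sym6_act a (f ?w) + f a)"
        using f_mult[OF mult_in[OF aG word_in] bG] f_mult[OF aG word_in] by simp
      have "g ** (h ** ?M ** g) = (g ** h) ** ?M ** g" by (simp add: matrix_mul_assoc)
      then have "Sym6_act g (affine_act u \<gamma> x) = Sym6_act (?M ** g) x + f ?M"
        using gh unfolding affine_act_def \<gamma>M conj_psl_def sigma7_psl f_def Sym6_act_arith
        by (simp add: conjugators_def flip: Sym6_act_mult)
      then have "Sym6_act g (affine_act u \<gamma> x) = Sym6_act a (Sym6_act ?w x' + f ?w) + f a"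
        by (simp add: fM x'_def Sym6_act_arith Sym6_act_mult)
      then have "Sym6_act (a ** g) (affine_act u \<gamma> x) + (- Sym6_act a (f a)) = Sym6_act ?w x' + f ?w"
        by (simp add: Sym6_act_mult Sym6_act_arith aa)
      then have "norm (Sym6_act ?w x' + f ?w) \<le> R" using R(2)[OF ab(1) x(2)] by simp
      moreover have "norm x' \<le> R" using R(1)[OF ab(2) x(1)] by (simp add: x'_def)
      ultimately have "length l \<le> n" using n by blast
      then show "\<gamma> \<in> ?W" using ab \<gamma>M by auto
    qed
    moreover have "finite ?W"
      by (intro finite_imageI finite_cartesian_product finite_lists_length_le) (auto simp: As_def Bs_def)
    ultimately show "finite {\<gamma> \<in> \<Gamma>. affine_act u \<gamma> ` C \<inter> C \<noteq> {}}" by (rule finite_subset)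
  qed
qed

end
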